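(* There exists a positive constant $C\le C_\nu$ such that for every real $\lambda$ with $|\lambda|<C$ the following hold for the random field $\{Q_t\mid t\in\mathbb{Z}^\nu\}$ on the limiting probability space with measure $P_\lambda$ and its renormalization group transforms $\{Y^{(k)}_\tau\mid\tau\in\mathbb{Z}^\nu\}$ with parameters $k$ and $\alpha$, where $Y^{(k)}_\tau=k^{-\alpha/2}\sum_{t\in G_k^{-1}(\tau)}Q_t$. 1. Suppose $\alpha>\nu$. Then $Y^{(k)}_\tau\to 0$ in mean square as $k\to\infty$, for each $\tau\in\mathbb{Z}^\nu$. 2. Suppose $\alpha=\nu$. Then as $k\to\infty$ the field $\{Y^{(k)}_\tau\mid\tau\in\mathbb{Z}^\nu\}$ converges in distribution to an independent field with Gaussian distribution; that is, for any finite set of distinct points $\tau_1,\ldots,\tau_m\in\mathbb{Z}^\nu$ the random vector $(Y^{(k)}_{\tau_1},\ldots,Y^{(k)}_{\tau_m})$ converges in distribution to a multivariate normal vector with independent components. Each of the variables of the limiting field has expectation $0$ and the positive variance $$V=1+\sum_{n=1}^{\infty}\lambda^nV_n,\qquad V_n=\sum_{\substack{\gamma\in R^*,\ |\gamma|=n,\\ \gamma\text{ connects }(\bar 0)}}\ \sum_{\substack{t\in\tilde\gamma,\ t\neq\bar 0,\\ \gamma\text{ connects }(\bar 0,t)}}\frac{1}{\gamma!}\langle Q_{\bar 0},Q_t,\Phi^\backprime_\gamma\rangle_0 .$$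
   Context: Fix a natural number $\nu\ge 1$. On $\mathbb{Z}^\nu$ use the distance $\rho(s,t)=\sum_{i=1}^\nu|s_i-t_i|$; $\bar 0=(0,\ldots,0)$. $R=\{\{s,t\}\mid s,t\in\mathbb{Z}^\nu,\ \rho(s,t)=1\}$. $\Omega$ is the set of all functions $\omega:\mathbb{Z}^\nu\to\{-1,1\}$, and $Q_t(\omega)=\omega(t)$ for $t\in\mathbb{Z}^\nu$. For finite $T\subset\mathbb{Z}^\nu$, $Q_T=\prod_{t\in T}Q_t$. Gibbs measure on a cube: for $N\ge1$ let $\Lambda_N=\{t\in\mathbb{Z}^\nu\mid |t_i|\le N\text{ for all }i\}$ and $R_N=\{\{r,s\}\in R\mid r,s\in\Lambda_N\}$. For $\delta:\Lambda_N\to\{-1,1\}$ let $A_\delta=\{\omega\in\Omega\mid\omega(t)=\delta(t)\ \forall t\in\Lambda_N\}$. For real $\lambda$, $P_{\lambda,N}$ is the probability measure on the finite unions of sets $A_\delta$ with $P_{\lambda,N}(A_\delta)=\Xi^{-1}\exp\big(\lambda\sum_{\{r,s\}\in R_N}\delta(r)\delta(s)\big)$, where $\Xi=\sum_{\delta'}\exp\big(\lambda\sum_{\{r,s\}\in R_N}\delta'(r)\delta'(s)\big)$. Semi-invariants (cumulants): for random variables $X_1,\ldots,X_m$ on one probability space, $\langle X_1,\ldots,X_m\rangle=\sum_{\{S_1,\ldots,S_j\}}(-1)^{j-1}(j-1)!\,E(X_{S_1})\cdots E(X_{S_j})$, the sum over all partitions of $\{1,\ldots,m\}$ into non-empty disjoint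 sets, with $X_S=\prod_{i\in S}X_i$; in particular $\langle X\rangle=E(X)$. $\langle\cdot\rangle_{\lambda,N}$ denotes semi-invariants with respect to $P_{\lambda,N}$. For $\lambda=0$ the variables $Q_t$, $t\in\Lambda_N$, are independent and uniform on $\{-1,1\}$ under $P_{0,N}$, so semi-invariants with respect to $P_{0,N}$ do not depend on $N$ (for $N$ large enough to contain the points involved) and are denoted $\langle\cdot\rangle_0$. Limiting probability space (thermodynamic limit): let $L=4\nu+1$, $C_2=4\nu^2$, $C_3=3Le^{L^2+1}$, $C_\nu=\frac{1}{2C_2C_3}$. For $|\lambda|<C_\nu$ the limit $f(Q_T)=\lim_{N\to\infty}\langle Q_T\rangle_{\lambda,N}$ exists for every finite $T\subset\mathbb{Z}^\nu$, and $P_\lambda$ is the probability measure on $\Omega$ (on the sigma-algebra generated by the sets below) determined by $$P_\lambda(\omega(t_1)=a_1,\ldots,\omega(t_m)=a_m)=\frac{(-1)^{q}}{2^m}\sum_{T'\subseteq T}f(Q_{T'})\prod_{\{i:\,t_i\in T\setminus T'\}}a_i$$ for $T=\{t_1,\ldots,t_m\}$ (distinct points) and $a_1,\ldots,a_m\in\{-1,1\}$, where $q$ is the number of indices $i$ with $a_i=-1$. Renormalization group with parameters $k$ (natural, $k>1$) and $\alpha$ (real, $\alpha\ge\nu$): $G_k(t_1,\ldots,t_\nu)=([t_1/k],\ldots,[t_\nu/k])$ with $[x]$ the integer part (floor) of $x$; it sends a field $\{X_t\}$ to $Y^{(k)}_\tau=k^{-\alpha/2}\sum_{t\in G_k^{-1}(\tau)}X_t$.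 Families: a family of elements of a set $\mathfrak A$ is a set of pairs $\gamma=\{(T_1,n_1),\ldots,(T_m,n_m)\}$ with $T_1,\ldots,T_m$ distinct elements of $\mathfrak A$ and integers $n_i\ge1$; $|\gamma|=n_1+\cdots+n_m$, $\gamma!=n_1!\cdots n_m!$, and (if the $T_i$ are sets) $\tilde\gamma=\bigcup_iT_i$. The associated sequence $\widehat\gamma$ lists each $T_i$ exactly $n_i$ times. $R^*$ is the set of families of elements of $R$. For a sequence $b=(t_1,\ldots,t_m)$ of points of $\mathbb{Z}^\nu$ and $\gamma\in R^*$ with $\widehat\gamma=(A_1,\ldots,A_n)$, the associated graph of $b$ and $\gamma$ has edges $A_1,\ldots,A_n$ and vertex set $\{t_1,\ldots,t_m\}\cup\bigcup_iA_i$; $\gamma$ connects $b$ if this graph is connected. For $A=\{r,s\}\in R$, $\Phi_A=Q_rQ_s$, and $\langle Q_s,Q_t,\Phi^\backprime_\gamma\rangle_0=\langle Q_s,Q_t,\Phi_{A_1},\ldots,\Phi_{A_n}\rangle_0$. *)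

theory Defs
  imports "HOL-Probability.Probability" "HOL-Library.Multiset" "HOL-Library.Disjoint_Sets"
begin

text \<open>The lattice of dimension nu is the type int ^ 'n, with nu = CARD('n).\<close>

definition ldist :: "int ^ 'n \<Rightarrow> int ^ 'n \<Rightarrow> int" where
  "ldist s t = (\<Sum>i\<in>UNIV. \<bar>s $ i - t $ i\<bar>)"

definition bonds :: "(int ^ 'n) set set" where
  "bonds = {{s, t} | s t. ldist s t = 1}"

type_synonym 'n config = "int ^ 'n \<Rightarrow> real"

definition Omega :: "('n::finite) config set" where
  "Omega = {\<omega>. \<forall>t. \<omega> t \<in> {-1, 1}}"

definition spin :: "int ^ 'n \<Rightarrow> ('n::finite) config \<Rightarrow> real" where
  "spin t \<omega> = \<omega> t"

definition spin_prod :: "(int ^ 'n) set \<Rightarrow> ('n::finite) config \<Rightarrow> real" where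
  "spin_prod T \<omega> = (\<Prod>t\<in>T. spin t \<omega>)"

text \<open>The set of configurations that agree with \<open>a\<close> on \<open>T\<close>.  The sets \<open>A_\<delta>\<close> of the Gibbs measure
  on a cube are the case \<open>T = cube N\<close>.\<close>

definition cylinder :: "(int ^ 'n) set \<Rightarrow> (int ^ 'n \<Rightarrow> real) \<Rightarrow> ('n::finite) config set" where
  "cylinder T a = {\<omega> \<in> Omega. \<forall>t\<in>T. \<omega> t = a t}"

definition cube :: "nat \<Rightarrow> (int ^ 'n) set" where
  "cube N = {t. \<forall>i. \<bar>t $ i\<bar> \<le> int N}"

definition cube_bonds :: "nat \<Rightarrow> (int ^ 'n) set set" where
  "cube_bonds N = {A \<in> bonds. A \<subseteq> cube N}"

definition cube_configs :: "nat \<Rightarrow> (int ^ 'n \<Rightarrow> real) set" where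
  "cube_configs N = cube N \<rightarrow>\<^sub>E {-1, 1}"

definition boltzmann :: "real \<Rightarrow> nat \<Rightarrow> (int ^ 'n::finite \<Rightarrow> real) \<Rightarrow> real" where
  "boltzmann lam N \<delta> = exp (lam * (\<Sum>A\<in>cube_bonds N. \<Prod>t\<in>A. \<delta> t))"

definition partition_sum :: "'n::finite itself \<Rightarrow> real \<Rightarrow> nat \<Rightarrow> real" where
  "partition_sum _ lam N = (\<Sum>\<delta>\<in>(cube_configs N :: (int ^ 'n \<Rightarrow> real) set). boltzmann lam N \<delta>)"

text \<open>A union of atoms \<open>cylinder (cube N) \<delta>\<close> gets the total weight of the atoms it contains.\<close>

definition gibbs :: "real \<Rightarrow> nat \<Rightarrow> ('n::finite) config measure" where
  "gibbs lam N = measure_of Omega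
     {\<Union>\<delta>\<in>D. cylinder (cube N) \<delta> | D. D \<subseteq> cube_configs N}
     (\<lambda>A. \<Sum>\<delta> | \<delta> \<in> cube_configs N \<and> cylinder (cube N) \<delta> \<subseteq> A.
            ennreal (boltzmann lam N \<delta> / partition_sum TYPE('n) lam N))"

definition semi_inv :: "'w measure \<Rightarrow> ('w \<Rightarrow> real) list \<Rightarrow> real" where
  "semi_inv M Xs = (\<Sum>P | partition_on {..<length Xs} P.
      (-1) ^ (card P - 1) * fact (card P - 1) *
      (\<Prod>S\<in>P. \<integral>\<omega>. (\<Prod>i\<in>S. (Xs ! i) \<omega>) \<partial>M))"

text \<open>For products of spins the semi-invariant with respect to \<open>gibbs 0 N\<close> does not depend on \<open>N\<close>
  once \<open>cube N\<close> contains the points involved; \<open>semi_inv0\<close> is this common value.\<close>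

definition semi_inv0 :: "(('n::finite) config \<Rightarrow> real) list \<Rightarrow> real" where
  "semi_inv0 Xs = (THE c. \<forall>\<^sub>F N in sequentially. semi_inv (gibbs 0 N) Xs = c)"

definition C_nu :: "nat \<Rightarrow> real" where
  "C_nu \<nu> = (let L = 4 * real \<nu> + 1; C\<^sub>2 = 4 * (real \<nu>)\<^sup>2; C\<^sub>3 = 3 * L * exp (L\<^sup>2 + 1)
            in 1 / (2 * C\<^sub>2 * C\<^sub>3))"

definition limit_corr :: "real \<Rightarrow> (int ^ 'n::finite) set \<Rightarrow> real" where
  "limit_corr lam T = lim (\<lambda>N. semi_inv (gibbs lam N) [spin_prod T])"

text \<open>The \<open>lim\<close> above and the \<open>THE\<close> below are meaningful for \<open>|lam| < C_nu CARD('n)\<close>, where the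
  limits exist and the prescribed cylinder probabilities determine a unique probability measure.
  Distinct points \<open>t_1, ..., t_m\<close> with values \<open>a_1, ..., a_m\<close> are given by a finite set \<open>T\<close> and
  a function \<open>a\<close> on it.\<close>

definition limit_measure :: "real \<Rightarrow> ('n::finite) config measure" where
  "limit_measure lam = (THE P. prob_space P \<and> space P = Omega \<and>
     sets P = sigma_sets Omega {cylinder T a | T a. finite T \<and> a \<in> T \<rightarrow> {-1, 1}} \<and>
     (\<forall>T a. finite T \<longrightarrow> a \<in> T \<rightarrow> {-1, 1} \<longrightarrow>
        measure P (cylinder T a) =
          (-1) ^ card {t \<in> T. a t = -1} / 2 ^ card T *
          (\<Sum>T'\<in>Pow T. limit_corr lam T' * (\<Prod>t\<in>T - T'. a t))))"

definition block_map :: "nat \<Rightarrow> int ^ 'n \<Rightarrow> int ^ 'n" where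
  "block_map k t = (\<chi> i. \<lfloor>of_int (t $ i) / real k\<rfloor>)"

definition renorm ::
    "nat \<Rightarrow> real \<Rightarrow> (int ^ 'n \<Rightarrow> 'w \<Rightarrow> real) \<Rightarrow> int ^ 'n \<Rightarrow> 'w \<Rightarrow> real" where
  "renorm k \<alpha> X \<tau> \<omega> = real k powr (- \<alpha> / 2) * (\<Sum>t | block_map k t = \<tau>. X t \<omega>)"

text \<open>A family, i.e. a set of pairs \<open>(T_i, n_i)\<close> with distinct \<open>T_i\<close> and \<open>n_i \<ge> 1\<close>, is the multiset
  that contains each \<open>T_i\<close> with multiplicity \<open>n_i\<close>; its \<open>|\<gamma>|\<close> is \<open>size\<close>.\<close>

definition bond_families :: "(int ^ 'n) set multiset set" where
  "bond_families = {\<gamma>. set_mset \<gamma> \<subseteq> bonds}"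

definition family_fact :: "'a multiset \<Rightarrow> nat" where
  "family_fact \<gamma> = (\<Prod>T\<in>set_mset \<gamma>. fact (count \<gamma> T))"

definition family_support :: "'a set multiset \<Rightarrow> 'a set" where
  "family_support \<gamma> = \<Union>(set_mset \<gamma>)"

text \<open>Only used inside semi-invariants, which do not depend on the order.\<close>

definition family_seq :: "'a multiset \<Rightarrow> 'a list" where
  "family_seq \<gamma> = (SOME xs. mset xs = \<gamma>)"

definition graph_connected :: "'a set \<Rightarrow> 'a set set \<Rightarrow> bool" where
  "graph_connected V E \<longleftrightarrow> (\<forall>u\<in>V. \<forall>v\<in>V. (u, v) \<in> {(x, y). {x, y} \<in> E}\<^sup>*)"

definition connects :: "'a set multiset \<Rightarrow> 'a list \<Rightarrow> bool" where
  "connects \<gamma> b \<longleftrightarrow> graph_connected (set b \<union> family_support \<gamma>) (set_mset \<gamma>)"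

text \<open>For a bond \<open>A = {r, s}\<close> the variable \<open>\<Phi>_A = Q_r Q_s\<close> is \<open>spin_prod A\<close>.
  The index sets of both sums are finite.\<close>

definition var_coeff :: "'n::finite itself \<Rightarrow> nat \<Rightarrow> real" where
  "var_coeff _ n =
     (\<Sum>\<gamma> | (\<gamma> :: (int ^ 'n) set multiset) \<in> bond_families \<and> size \<gamma> = n \<and> connects \<gamma> [0].
      \<Sum>t | t \<in> family_support \<gamma> \<and> t \<noteq> 0 \<and> connects \<gamma> [0, t].
        1 / real (family_fact \<gamma>) *
        semi_inv0 ([spin 0, spin t] @ map spin_prod (family_seq \<gamma>)))"

definition tendsto_mean_square ::
    "'w measure \<Rightarrow> (nat \<Rightarrow> 'w \<Rightarrow> real) \<Rightarrow> ('w \<Rightarrow> real) \<Rightarrow> bool" where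
  "tendsto_mean_square M X Z \<longleftrightarrow>
     (\<forall>k. X k \<in> borel_measurable M) \<and> Z \<in> borel_measurable M \<and>
     (\<forall>k. integrable M (\<lambda>\<omega>. (X k \<omega> - Z \<omega>)\<^sup>2)) \<and>
     (\<lambda>k. \<integral>\<omega>. (X k \<omega> - Z \<omega>)\<^sup>2 \<partial>M) \<longlonglongrightarrow> 0"

text \<open>Convergence in distribution of random vectors indexed by a finite set \<open>I\<close> to a probability
  measure \<open>\<mu>\<close> on the product space over \<open>I\<close>: convergence of the expectations of all bounded
  continuous functions.\<close>

definition tendsto_distr ::
    "'w measure \<Rightarrow> 'i set \<Rightarrow> (nat \<Rightarrow> 'i \<Rightarrow> 'w \<Rightarrow> real) \<Rightarrow> ('i \<Rightarrow> real) measure \<Rightarrow> bool" where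
  "tendsto_distr M I X \<mu> \<longleftrightarrow>
     (\<forall>k. \<forall>i\<in>I. X k i \<in> borel_measurable M) \<and>
     (\<forall>g :: ('i \<Rightarrow> real) \<Rightarrow> real.
        continuous_on (I \<rightarrow>\<^sub>E UNIV) g \<and> bounded (g ` (I \<rightarrow>\<^sub>E UNIV)) \<longrightarrow>
        (\<lambda>k. \<integral>\<omega>. g (\<lambda>i\<in>I. X k i \<omega>) \<partial>M) \<longlonglongrightarrow> (\<integral>y. g y \<partial>\<mu>))"

text \<open>The law of a vector with independent normal components of mean 0 and variance \<open>V\<close>.\<close>

definition indep_normal :: "'i set \<Rightarrow> real \<Rightarrow> ('i \<Rightarrow> real) measure" where
  "indep_normal I V = PiM I (\<lambda>_. density lborel (\<lambda>x. ennreal (normal_density 0 (sqrt V) x)))"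

end

theory Submission
  imports Defs "HOL-Complex_Analysis.Complex_Analysis" "HOL-Combinatorics.Multiset_Permutations"
begin

text \<open>
  The proof rests on one linear equation for spin correlations. Given its neighbours, the spin at a
  site \<open>t\<close> of an Ising system with coupling \<open>lam\<close> and field \<open>h\<close> has conditional mean
  \<open>tanh (lam * (sum of the neighbours) + h t)\<close>. Expanding this function of finitely many signs into
  products of spins turns the correlations \<open>\<rho>(T) = E Q_T\<close> into a solution of
  \<open>\<rho>(T) = \<Sum>S. c t S * \<rho>((T - {t}) \<triangle> S)\<close>, where \<open>S\<close> runs over sets of neighbours of \<open>t\<close>
  (lemma \<open>callen_identity\<close>). When the complex parameters \<open>lam\<close> and \<open>h t\<close> are small, the coefficients
  have absolute sum at most \<open>kappa0 = 1/(8 \<nu>)\<close>, and each use of the equation gains this factor while it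
  moves the points by at most one step. This gives, uniformly in the volume: the partition
  function does not vanish and all correlations are at most 1 (\<open>weight_sum_dominated\<close>);
  \<open>\<rho>({s, t})\<close> is at most \<open>kappa0\<close> to the power of the distance (\<open>corr_pair_decay\<close>); correlations hardly
  depend on the volume (\<open>corr_volume_dependence\<close>), so that their limits exist and are translation
  invariant (\<open>corr_lim_translate\<close>). Kolmogorov's extension theorem then yields the limiting measure
  (\<open>limit_measure\<close>).

  The variance of the limiting field is the sum of all pair correlations \<open>E Q_0 Q_t\<close>. It is positive
  because the sum of \<open>kappa0 ^ |t|\<close> over \<open>t \<noteq> 0\<close> is below 1. In a finite cube the pair correlation
  is analytic in \<open>lam\<close>; differentiating a cumulant in \<open>lam\<close> appends the energy to its list of
  variables (\<open>has_field_derivative_cumulant\<close>), so the Taylor coefficients are sums of cumulants of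
  independent spins, and those belonging to disconnected graphs vanish (\<open>cumulant_disconnected\<close>). The
  Cauchy estimates on a disc of radius \<open>rad0\<close> allow all limits and sums to be exchanged, which gives
  the power series of the variance (\<open>limit_variance_series\<close>).

  For the Gaussian limit let \<open>X\<close> be a linear combination of the spins in finitely many blocks of side
  \<open>k\<close>, with bounded coefficients. The function \<open>E exp (z X)\<close> is a quotient of partition functions with
  a complex field, hence it has no zeros in a disc whose radius does not depend on \<open>k\<close>, and its
  logarithmic derivative is bounded there by the number of sites. Thus its logarithm is
  \<open>z\<^sup>2 Var X / 2\<close> up to an error of order \<open>k ^ \<nu> * |z| ^ 3\<close>, which vanishes in the limit for \<open>|z|\<close> of order
  \<open>k powr (- \<nu> / 2)\<close> (\<open>limit_characteristic_function\<close>). Covariances of distinct blocks are of smaller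
  order than the volume of a block (\<open>block_covariance\<close>), and convergence of the joint characteristic
  functions together with bounded second moments implies convergence in distribution
  (\<open>convergence_from_characteristic_functions\<close>).
\<close>

section \<open>Functions of finitely many signs\<close>

text \<open>The Walsh characters, that is, products of spins. They are complex valued because coupling and
  field will be complex.\<close>

definition chi :: "'v set \<Rightarrow> ('v \<Rightarrow> real) \<Rightarrow> complex" where
  "chi T \<omega> = (\<Prod>t\<in>T. of_real (\<omega> t))"

definition symdiff :: "'v set \<Rightarrow> 'v set \<Rightarrow> 'v set" where
  "symdiff A B = (A - B) \<union> (B - A)"

text \<open>The Fourier coefficient of \<open>f\<close> on the group \<open>{-1, 1} ^ F\<close>.\<close>

definition walsh :: "'v set \<Rightarrow> (('v \<Rightarrow> real) \<Rightarrow> complex) \<Rightarrow> 'v set \<Rightarrow> complex" where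
  "walsh F f S = (\<Sum>\<eta>\<in>F \<rightarrow>\<^sub>E {-1, 1}. f \<eta> * chi S \<eta>) / 2 ^ card F"

lemma chi_empty [simp]: "chi {} \<omega> = 1"
  by (simp add: chi_def)

lemma chi_insert: "finite T \<Longrightarrow> t \<notin> T \<Longrightarrow> chi (insert t T) \<omega> = of_real (\<omega> t) * chi T \<omega>"
  by (simp add: chi_def)

lemma chi_cong: "(\<And>t. t \<in> T \<Longrightarrow> \<omega> t = \<eta> t) \<Longrightarrow> chi T \<omega> = chi T \<eta>"
  by (simp add: chi_def)

lemma chi_eq_of_real: "chi T \<omega> = of_real (\<Prod>t\<in>T. \<omega> t)"
  by (simp add: chi_def)

lemma norm_chi:
  assumes "\<And>t. t \<in> T \<Longrightarrow> \<omega> t \<in> {-1, 1}"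
  shows "norm (chi T \<omega>) = 1"
proof -
  have "norm (chi T \<omega>) = (\<Prod>t\<in>T. \<bar>\<omega> t\<bar>)"
    by (simp add: chi_def prod_norm [symmetric])
  also have "\<dots> = 1"
    using assms by (intro prod.neutral) fastforce
  finally show ?thesis .
qed

lemma finite_symdiff [simp]: "finite A \<Longrightarrow> finite B \<Longrightarrow> finite (symdiff A B)"
  by (simp add: symdiff_def)

lemma symdiff_subset: "A \<subseteq> C \<Longrightarrow> B \<subseteq> C \<Longrightarrow> symdiff A B \<subseteq> C"
  by (auto simp: symdiff_def)

lemma chi_symdiff:
  assumes "finite A" "finite B" "\<And>t. t \<in> A \<union> B \<Longrightarrow> \<omega> t \<in> {-1, 1}"
  shows "chi A \<omega> * chi B \<omega> = chi (symdiff A B) \<omega>"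
proof -
  have "chi A \<omega> = chi (A - B) \<omega> * chi (A \<inter> B) \<omega>"
    unfolding chi_def using assms(1)
    by (subst prod.union_disjoint [symmetric]) (auto intro!: prod.cong)
  moreover have "chi B \<omega> = chi (B - A) \<omega> * chi (A \<inter> B) \<omega>"
    unfolding chi_def using assms(2)
    by (subst prod.union_disjoint [symmetric]) (auto intro!: prod.cong)
  moreover have "chi (A \<inter> B) \<omega> * chi (A \<inter> B) \<omega> = 1"
    unfolding chi_def prod.distrib [symmetric]
  proof (rule prod.neutral, rule ballI)
    fix t assume "t \<in> A \<inter> B"
    then have "\<omega> t \<in> {-1, 1}" using assms(3) by blast
    then show "complex_of_real (\<omega> t) * complex_of_real (\<omega> t) = 1" by auto
  qed
  moreover have "chi (symdiff A B) \<omega> = chi (A - B) \<omega> * chi (B - A) \<omega>"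
    unfolding chi_def symdiff_def using assms(1,2) by (subst prod.union_disjoint) auto
  ultimately show ?thesis by (simp add: mult_ac)
qed

lemma finite_sign_configs [simp]: "finite F \<Longrightarrow> finite (F \<rightarrow>\<^sub>E {-1, 1::real})"
  by (rule finite_PiE) auto

lemma card_sign_configs: "finite F \<Longrightarrow> card (F \<rightarrow>\<^sub>E {-1, 1::real}) = 2 ^ card F"
  by (simp add: card_PiE numeral_2_eq_2)

text \<open>The sum factorizes as \<open>\<Prod>s\<in>F. (1 + \<omega> s * \<eta> s)\<close>, and each factor is 2 or 0.\<close>

lemma walsh_kernel:
  assumes F: "finite F" and w: "\<And>s. s \<in> F \<Longrightarrow> \<omega> s \<in> {-1, 1}" and e: "\<And>s. s \<in> F \<Longrightarrow> \<eta> s \<in> {-1, 1}"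
  shows "(\<Sum>S\<in>Pow F. chi S \<omega> * chi S \<eta>) = (if \<forall>s\<in>F. \<omega> s = \<eta> s then 2 ^ card F else 0)"
proof -
  have "(\<Sum>S\<in>Pow F. chi S \<omega> * chi S \<eta>) = (\<Prod>s\<in>F. complex_of_real (\<omega> s * \<eta> s) + 1)"
    using F by (simp add: prod_add chi_def prod.distrib)
  also have "\<dots> = (if \<forall>s\<in>F. \<omega> s = \<eta> s then 2 ^ card F else 0)"
  proof (cases "\<forall>s\<in>F. \<omega> s = \<eta> s")
    case True
    have "(\<Prod>s\<in>F. complex_of_real (\<omega> s * \<eta> s) + 1) = (\<Prod>s\<in>F. 2)"
    proof (rule prod.cong)
      fix s assume "s \<in> F"
      then have "\<omega> s = \<eta> s" "\<omega> s \<in> {-1, 1}" using True w by auto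
      then show "complex_of_real (\<omega> s * \<eta> s) + 1 = 2" by auto
    qed simp
    with True show ?thesis by simp
  next
    case False
    then obtain s where s: "s \<in> F" "\<omega> s \<noteq> \<eta> s" by auto
    then have "\<omega> s * \<eta> s = -1" using w [of s] e [of s] by auto
    then have "(\<Prod>s\<in>F. complex_of_real (\<omega> s * \<eta> s) + 1) = 0"
      using F s by (auto intro!: prod_zero bexI [of _ s] simp flip: of_real_mult)
    with False show ?thesis by simp
  qed
  finally show ?thesis .
qed

lemma walsh_expand:
  assumes F: "finite F" and w: "\<And>s. s \<in> F \<Longrightarrow> \<omega> s \<in> {-1, 1}"
  shows "f (restrict \<omega> F) = (\<Sum>S\<in>Pow F. walsh F f S * chi S \<omega>)"
proof -
  have "(\<Sum>S\<in>Pow F. walsh F f S * chi S \<omega>)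
      = (\<Sum>\<eta>\<in>F \<rightarrow>\<^sub>E {-1, 1}. f \<eta> / 2 ^ card F * (\<Sum>S\<in>Pow F. chi S \<eta> * chi S \<omega>))"
    unfolding walsh_def sum_divide_distrib sum_distrib_right sum_distrib_left
    by (subst sum.swap) (simp add: field_simps)
  also have "\<dots> = (\<Sum>\<eta>\<in>F \<rightarrow>\<^sub>E {-1, 1}. if \<eta> = restrict \<omega> F then f \<eta> else 0)"
  proof (rule sum.cong)
    fix \<eta> assume eta: "\<eta> \<in> F \<rightarrow>\<^sub>E {-1, 1::real}"
    have "(\<forall>s\<in>F. \<eta> s = \<omega> s) \<longleftrightarrow> \<eta> = restrict \<omega> F"
      using eta by (auto simp: fun_eq_iff PiE_def extensional_def restrict_def)
    moreover have "(\<Sum>S\<in>Pow F. chi S \<eta> * chi S \<omega>) = (if \<forall>s\<in>F. \<eta> s = \<omega> s then 2 ^ card F else 0)"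
      using eta w by (intro walsh_kernel F) auto
    ultimately show "f \<eta> / 2 ^ card F * (\<Sum>S\<in>Pow F. chi S \<eta> * chi S \<omega>)
        = (if \<eta> = restrict \<omega> F then f \<eta> else 0)"
      by auto
  qed simp
  also have "\<dots> = f (restrict \<omega> F)"
    using F w by (subst sum.delta [OF finite_sign_configs]) auto
  finally show ?thesis by simp
qed

lemma norm_walsh_le:
  assumes F: "finite F" and S: "S \<subseteq> F" and B: "\<And>\<eta>. \<eta> \<in> F \<rightarrow>\<^sub>E {-1, 1} \<Longrightarrow> norm (f \<eta>) \<le> B"
  shows "norm (walsh F f S) \<le> B"
proof -
  have "norm (\<Sum>\<eta>\<in>F \<rightarrow>\<^sub>E {-1, 1}. f \<eta> * chi S \<eta>) \<le> (\<Sum>\<eta>\<in>F \<rightarrow>\<^sub>E {-1, 1::real}. B)"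
  proof (rule sum_norm_le)
    fix \<eta> assume eta: "\<eta> \<in> F \<rightarrow>\<^sub>E {-1, 1::real}"
    then have "norm (chi S \<eta>) = 1" using S by (intro norm_chi) auto
    then show "norm (f \<eta> * chi S \<eta>) \<le> B" using B [OF eta] by (simp add: norm_mult)
  qed
  also have "\<dots> = 2 ^ card F * B"
    by (simp add: card_sign_configs F)
  finally show ?thesis
    by (simp add: walsh_def norm_divide norm_power divide_le_eq mult.commute)
qed

text \<open>Write \<open>tanh z = (exp (2z) - 1) / (exp (2z) + 1)\<close>; for small \<open>z\<close> the numerator is of order \<open>z\<close> and
  the denominator is close to 2.\<close>

lemma norm_tanh_le:
  fixes z :: complex
  assumes "norm z \<le> 1/4"
  shows "norm (tanh z) \<le> 4 * norm z" and "cosh z \<noteq> 0"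
proof -
  have b: "norm (exp (2*z) - 1) \<le> 3/2 * norm (2*z)"
    by (rule norm_exp_bounds) (use assms in \<open>simp add: norm_mult\<close>)
  have "norm (2::complex) \<le> norm (exp (2*z) + 1) + norm (exp (2*z) - 1)"
    using norm_triangle_ineq4 [of "exp (2*z) + 1" "exp (2*z) - 1"] by simp
  with b assms have c: "norm (exp (2*z) + 1) \<ge> 1" by (simp add: norm_mult)
  have e: "exp (2*z) = exp z * exp z" by (metis exp_add mult_2)
  have e': "exp (z*2) = exp z * exp z" by (metis exp_add mult_2_right)
  have ch: "cosh z = (exp (2*z) + 1) / (2 * exp z)"
    by (simp add: cosh_def e' exp_minus scaleR_conv_of_real field_simps)
  have sh: "sinh z = (exp (2*z) - 1) / (2 * exp z)"
    by (simp add: sinh_def e' exp_minus scaleR_conv_of_real field_simps)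
  have n0: "exp (2*z) + 1 \<noteq> 0" using c by force
  then show "cosh z \<noteq> 0" by (simp add: ch)
  have "tanh z = (exp (2*z) - 1) / (exp (2*z) + 1)"
    using n0 by (simp add: tanh_def ch sh)
  then have "norm (tanh z) \<le> norm (exp (2*z) - 1) / 1"
    using c by (simp add: norm_divide divide_le_eq mult_le_cancel_left1)
  also have "\<dots> \<le> 3 * norm z" using b by (simp add: norm_mult)
  also have "\<dots> \<le> 4 * norm z" by (rule mult_right_mono) auto
  finally show "norm (tanh z) \<le> 4 * norm z" .
qed

section \<open>The Callen equation and the decay of its solutions\<close>

text \<open>The Callen equation at the site \<open>t\<close>: a point \<open>t\<close> of \<open>T\<close> may be traded for sets of neighbours \<open>S\<close>,
  and points that occur twice cancel, since the square of a spin is 1.\<close>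

definition callen_at :: "('v \<Rightarrow> 'v set) \<Rightarrow> ('v \<Rightarrow> 'v set \<Rightarrow> complex) \<Rightarrow> ('v set \<Rightarrow> complex) \<Rightarrow> 'v \<Rightarrow> bool" where
  "callen_at nb c D t \<longleftrightarrow> (\<forall>T. finite T \<longrightarrow> t \<in> T \<longrightarrow> D T = (\<Sum>S\<in>Pow (nb t). c t S * D (symdiff (T - {t}) S)))"

lemma callen_at_diff: "callen_at nb c D t \<Longrightarrow> callen_at nb c D' t \<Longrightarrow> callen_at nb c (\<lambda>T. D T - D' T) t"
  by (simp add: callen_at_def sum_subtractf right_diff_distrib)

text \<open>Multiplying all correlations by the fixed product of spins over \<open>B\<close> does not affect the equation at
  sites outside \<open>B\<close>. This turns decay of solutions into decay of correlations.\<close>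

lemma callen_at_shift:
  assumes "callen_at nb c D t" "t \<notin> B" "finite B"
  shows "callen_at nb c (\<lambda>T. D (symdiff T B)) t"
  unfolding callen_at_def
proof (intro allI impI)
  fix T assume T: "finite T" "t \<in> T"
  have eq: "symdiff (symdiff T B - {t}) S = symdiff (symdiff (T - {t}) S) B" for S
    using T assms(2) by (auto simp: symdiff_def)
  have "finite (symdiff T B)" "t \<in> symdiff T B" using T assms by (auto simp: symdiff_def)
  then have "D (symdiff T B) = (\<Sum>S\<in>Pow (nb t). c t S * D (symdiff (symdiff T B - {t}) S))"
    using assms(1) by (auto simp: callen_at_def)
  then show "D (symdiff T B) = (\<Sum>S\<in>Pow (nb t). c t S * D (symdiff (symdiff (T - {t}) S) B))"
    by (simp only: eq)
qed

lemma ldist_triangle: "ldist s u \<le> ldist s t + ldist t u"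
  unfolding ldist_def sum.distrib [symmetric] by (rule sum_mono) simp

lemma ldist_nonneg: "0 \<le> ldist s t"
  unfolding ldist_def by (rule sum_nonneg) simp

lemma ldist_commute: "ldist s t = ldist t s"
  by (simp add: ldist_def abs_minus_commute)

lemma ldist_self [simp]: "ldist s s = 0"
  by (simp add: ldist_def)

text \<open>The equation may be applied \<open>n\<close> times in succession as long as the points reached stay in \<open>U\<close>, where
  it holds. Every application gains a factor \<open>\<kappa>\<close>, and branches that arrive at the empty set contribute
  nothing because \<open>D\<close> vanishes there.\<close>

lemma callen_decay:
  fixes D :: "(int ^ 'n::finite) set \<Rightarrow> complex"
  assumes bound: "\<And>T. finite T \<Longrightarrow> norm (D T) \<le> M" and empty: "D {} = 0"
    and sol: "\<And>t. t \<in> U \<Longrightarrow> callen_at nb c D t"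
    and nb: "\<And>t. t \<in> U \<Longrightarrow> nb t \<subseteq> {s. ldist s t \<le> 1}" and fin: "\<And>t. t \<in> U \<Longrightarrow> finite (nb t)"
    and c: "\<And>t. t \<in> U \<Longrightarrow> (\<Sum>S\<in>Pow (nb t). norm (c t S)) \<le> \<kappa>" and k: "0 \<le> \<kappa>"
  shows "finite T \<Longrightarrow> (\<And>t s. t \<in> T \<Longrightarrow> ldist s t < int n \<Longrightarrow> s \<in> U) \<Longrightarrow> norm (D T) \<le> M * \<kappa> ^ n"
proof (induction n arbitrary: T)
  case 0
  then show ?case using bound by simp
next
  case (Suc n)
  show ?case
  proof (cases "T = {}")
    case True
    have "0 \<le> M" using bound [of "{}"] empty by simp
    then show ?thesis using True empty k by simp
  next
    case False
    then obtain t where t: "t \<in> T" by auto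
    have tU: "t \<in> U" using Suc.prems(2) [OF t, of t] by simp
    have "norm (D T) = norm (\<Sum>S\<in>Pow (nb t). c t S * D (symdiff (T - {t}) S))"
      using sol [OF tU] t Suc.prems(1) by (simp add: callen_at_def)
    also have "\<dots> \<le> (\<Sum>S\<in>Pow (nb t). norm (c t S) * (M * \<kappa> ^ n))"
    proof (rule sum_norm_le)
      fix S assume S: "S \<in> Pow (nb t)"
      have "norm (D (symdiff (T - {t}) S)) \<le> M * \<kappa> ^ n"
      proof (rule Suc.IH)
        show "finite (symdiff (T - {t}) S)"
          using S fin [OF tU] Suc.prems(1) by (intro finite_symdiff) (auto intro: finite_subset)
        fix t' s assume t': "t' \<in> symdiff (T - {t}) S" and s: "ldist s t' < int n"
        show "s \<in> U"
        proof (cases "t' \<in> T")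
          case True
          then show ?thesis using Suc.prems(2) [of t' s] s by simp
        next
          case False
          then have "t' \<in> nb t" using t' S by (auto simp: symdiff_def)
          then have "ldist t' t \<le> 1" using nb [OF tU] by auto
          then have "ldist s t < int (Suc n)" using ldist_triangle [of s t t'] s by simp
          then show ?thesis using Suc.prems(2) [OF t] by simp
        qed
      qed
      then show "norm (c t S * D (symdiff (T - {t}) S)) \<le> norm (c t S) * (M * \<kappa> ^ n)"
        by (simp add: norm_mult mult_left_mono)
    qed
    also have "\<dots> = (\<Sum>S\<in>Pow (nb t). norm (c t S)) * (M * \<kappa> ^ n)"
      by (simp add: sum_distrib_right)
    also have "\<dots> \<le> \<kappa> * (M * \<kappa> ^ n)"
    proof (rule mult_right_mono [OF c [OF tU]])
      show "0 \<le> M * \<kappa> ^ n" using bound [of "{}"] empty k by simp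
    qed
    finally show ?thesis by (simp add: mult_ac)
  qed
qed

section \<open>Gibbs weights with complex parameters\<close>

definition energy :: "nat \<Rightarrow> (int ^ 'n \<Rightarrow> real) \<Rightarrow> complex" where
  "energy N \<delta> = (\<Sum>A\<in>cube_bonds N. chi A \<delta>)"

text \<open>The Boltzmann factor with complex coupling and a complex external field. The field generates
  exponential moments of linear combinations of spins.\<close>

definition spin_weight :: "complex \<Rightarrow> (int ^ 'n \<Rightarrow> complex) \<Rightarrow> nat \<Rightarrow> (int ^ 'n \<Rightarrow> real) \<Rightarrow> complex" where
  "spin_weight lam h N \<delta> = exp (lam * energy N \<delta> + (\<Sum>t\<in>cube N. h t * of_real (\<delta> t)))"

definition weight_sum :: "complex \<Rightarrow> (int ^ 'n::finite \<Rightarrow> complex) \<Rightarrow> nat \<Rightarrow> ((int ^ 'n \<Rightarrow> real) \<Rightarrow> complex) \<Rightarrow> complex" where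
  "weight_sum lam h N X = (\<Sum>\<delta>\<in>cube_configs N. X \<delta> * spin_weight lam h N \<delta>)"

definition nbrs :: "nat \<Rightarrow> int ^ 'n \<Rightarrow> (int ^ 'n) set" where
  "nbrs N t = {s \<in> cube N. ldist s t = 1}"

definition lattice_degree :: "'n::finite itself \<Rightarrow> nat" where
  "lattice_degree _ = card {u :: int ^ 'n. ldist u 0 = 1}"

text \<open>Sites outside the cube get coefficient 0, so that with the convention made for \<open>corr\<close> below the Callen
  equation holds at every site of the lattice.\<close>

definition callen_coeff :: "complex \<Rightarrow> (int ^ 'n \<Rightarrow> complex) \<Rightarrow> nat \<Rightarrow> int ^ 'n \<Rightarrow> (int ^ 'n) set \<Rightarrow> complex" where
  "callen_coeff lam h N t S = (if t \<in> cube N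
     then walsh (nbrs N t) (\<lambda>\<eta>. tanh (lam * (\<Sum>s\<in>nbrs N t. of_real (\<eta> s)) + h t)) S else 0)"

text \<open>Spins outside the cube count as independent and symmetric; hence the value 0 unless \<open>T\<close> is
  contained in the cube.\<close>

definition corr :: "complex \<Rightarrow> (int ^ 'n::finite \<Rightarrow> complex) \<Rightarrow> nat \<Rightarrow> (int ^ 'n) set \<Rightarrow> complex" where
  "corr lam h N T = (if T \<subseteq> cube N then weight_sum lam h N (chi T) / weight_sum lam h N (\<lambda>_. 1) else 0)"

lemma vec_box_eq: "{t :: 'a ^ 'n. \<forall>i. t $ i \<in> F i} = vec_lambda ` (Pi\<^sub>E UNIV F)"
proof (intro set_eqI iffI)
  fix t :: "'a ^ 'n" assume "t \<in> {t. \<forall>i. t $ i \<in> F i}"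
  then have "vec_nth t \<in> Pi\<^sub>E UNIV F" "t = vec_lambda (vec_nth t)" by auto
  then show "t \<in> vec_lambda ` (Pi\<^sub>E UNIV F)" by blast
qed auto

lemma inj_vec_lambda: "inj_on vec_lambda A"
  by (metis inj_onI vec_lambda_beta vec_lambda_inverse UNIV_I)

lemma finite_vec_box: "(\<And>i. finite (F i)) \<Longrightarrow> finite {t :: 'a ^ 'n::finite. \<forall>i. t $ i \<in> F i}"
  unfolding vec_box_eq by (intro finite_imageI finite_PiE) auto

lemma cube_eq_box: "cube N = {t. \<forall>i. t $ i \<in> {- int N..int N}}"
  by (auto simp: cube_def abs_le_iff) (metis minus_le_iff)+

lemma finite_cube [simp]: "finite (cube N :: (int ^ 'n::finite) set)"
  unfolding cube_eq_box by (rule finite_vec_box) simp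

lemma finite_cube_bonds [simp]: "finite (cube_bonds N :: (int ^ 'n::finite) set set)"
  by (rule finite_subset [of _ "Pow (cube N)"]) (auto simp: cube_bonds_def)

lemma finite_cube_configs [simp]: "finite (cube_configs N :: (int ^ 'n::finite \<Rightarrow> real) set)"
  by (simp add: cube_configs_def)

lemma finite_nbrs [simp]: "finite (nbrs N t)"
  by (simp add: nbrs_def)

lemma abs_component_le_ldist: "\<bar>s $ i - t $ i\<bar> \<le> ldist s t"
  unfolding ldist_def by (rule member_le_sum) auto

lemma ldist_cube: "t \<in> cube N \<Longrightarrow> ldist s t \<le> int m \<Longrightarrow> s \<in> cube (N + m)"
proof -
  assume t: "t \<in> cube N" and m: "ldist s t \<le> int m"
  have "\<bar>s $ i\<bar> \<le> int (N + m)" for i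
    using t m abs_component_le_ldist [of s i t] unfolding cube_def by (simp, smt (verit) )
  then show ?thesis by (simp add: cube_def)
qed

lemma ldist_diff: "ldist s t = ldist (s - t) 0"
  by (simp add: ldist_def)

lemma cube_mono: "M \<le> N \<Longrightarrow> cube M \<subseteq> cube N"
  unfolding cube_def by (auto intro: order_trans)

lemma zero_in_cube [simp]: "0 \<in> cube N"
  by (simp add: cube_def)

lemma card_nbrs_le: "card (nbrs N (t :: int ^ 'n::finite)) \<le> lattice_degree TYPE('n)"
  unfolding lattice_degree_def
proof (rule card_inj_on_le [of "\<lambda>s. s - t"])
  show "inj_on (\<lambda>s. s - t) (nbrs N t)" by (auto simp: inj_on_def)
  show "(\<lambda>s. s - t) ` nbrs N t \<subseteq> {u. ldist u 0 = 1}"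
    by (auto simp: nbrs_def ldist_diff [symmetric])
  have "{u :: int ^ 'n. ldist u 0 = 1} \<subseteq> cube 1"
    by (auto intro!: ldist_cube [of 0 0 _ 1, simplified])
  then show "finite {u :: int ^ 'n. ldist u 0 = 1}" by (rule finite_subset) simp
qed

lemma cube_config_values: "\<delta> \<in> cube_configs N \<Longrightarrow> t \<in> cube N \<Longrightarrow> \<delta> t \<in> {-1, 1}"
  unfolding cube_configs_def by auto

text \<open>The dependence of the energy on a single spin is linear, with the sum of the neighbouring spins as
  coefficient.\<close>

lemma energy_at_site:
  fixes t :: "int ^ 'n::finite"
  assumes t: "t \<in> cube N"
  shows "energy N \<delta> = of_real (\<delta> t) * (\<Sum>s\<in>nbrs N t. of_real (\<delta> s)) + (\<Sum>A | A \<in> cube_bonds N \<and> t \<notin> A. chi A \<delta>)"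
proof -
  have inj: "inj_on (\<lambda>s. {s, t}) (nbrs N t)"
    by (auto simp: inj_on_def doubleton_eq_iff)
  have split: "cube_bonds N = (\<lambda>s. {s, t}) ` nbrs N t \<union> {A \<in> cube_bonds N. t \<notin> A}"
  proof (intro set_eqI iffI)
    fix A :: "(int ^ 'n) set" assume A: "A \<in> cube_bonds N"
    then obtain s s' where s: "A = {s, s'}" "ldist s s' = 1" "s \<in> cube N" "s' \<in> cube N"
      by (auto simp: cube_bonds_def bonds_def)
    show "A \<in> (\<lambda>s. {s, t}) ` nbrs N t \<union> {A \<in> cube_bonds N. t \<notin> A}"
    proof (cases "t \<in> A")
      case True
      then consider "t = s'" | "t = s" using s by auto
      then show ?thesis
      proof cases
        case 1
        then have "s \<in> nbrs N t" "A = {s, t}" using s by (auto simp: nbrs_def)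
        then show ?thesis by blast
      next
        case 2
        then have "s' \<in> nbrs N t" "A = {s', t}" using s by (auto simp: nbrs_def ldist_commute)
        then show ?thesis by blast
      qed
    qed (use A in auto)
  next
    fix A :: "(int ^ 'n) set" assume "A \<in> (\<lambda>s. {s, t}) ` nbrs N t \<union> {A \<in> cube_bonds N. t \<notin> A}"
    then show "A \<in> cube_bonds N"
      using t by (auto simp: cube_bonds_def bonds_def nbrs_def)
  qed
  have "energy N \<delta> = (\<Sum>A\<in>(\<lambda>s. {s, t}) ` nbrs N t. chi A \<delta>) + (\<Sum>A | A \<in> cube_bonds N \<and> t \<notin> A. chi A \<delta>)"
    unfolding energy_def by (subst split, rule sum.union_disjoint) auto
  also have "(\<Sum>A\<in>(\<lambda>s. {s, t}) ` nbrs N t. chi A \<delta>) = (\<Sum>s\<in>nbrs N t. chi {s, t} \<delta>)"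
    by (simp add: sum.reindex [OF inj])
  also have "\<dots> = (\<Sum>s\<in>nbrs N t. of_real (\<delta> t) * of_real (\<delta> s))"
  proof (rule sum.cong [OF refl])
    fix s assume "s \<in> nbrs N t"
    then have "s \<noteq> t" by (auto simp: nbrs_def)
    then show "chi {s, t} \<delta> = of_real (\<delta> t) * of_real (\<delta> s)" by (simp add: chi_def)
  qed
  finally show ?thesis by (simp add: sum_distrib_left)
qed

text \<open>Flipping the spin at \<open>t\<close> changes the sign of
  \<open>(\<delta> t - tanh x) * exp (\<delta> t * x) = \<delta> t / cosh x\<close>, where \<open>x\<close> is the local field at \<open>t\<close>, and leaves
  everything else unchanged. So inside the sum \<open>\<delta> t\<close> can be replaced by \<open>tanh x\<close>, which is a function
  of the neighbouring spins and has a Walsh expansion.\<close>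

lemma callen_identity:
  fixes t :: "int ^ 'n::finite"
  assumes t: "t \<in> T" "T \<subseteq> cube N" and ch: "\<And>\<delta>. \<delta> \<in> cube_configs N \<Longrightarrow> cosh (lam * (\<Sum>s\<in>nbrs N t. of_real (\<delta> s)) + h t) \<noteq> 0"
  shows "weight_sum lam h N (chi T) = (\<Sum>S\<in>Pow (nbrs N t). callen_coeff lam h N t S * weight_sum lam h N (chi (symdiff (T - {t}) S)))"
proof -
  have tc: "t \<in> cube N" and fT: "finite T" using t by (auto intro: finite_subset)
  define x where "x \<delta> = lam * (\<Sum>s\<in>nbrs N t. of_real (\<delta> s)) + h t" for \<delta> :: "int ^ 'n \<Rightarrow> real"
  define flip where "flip \<delta> = \<delta>(t := - \<delta> t)" for \<delta> :: "int ^ 'n \<Rightarrow> real"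
  define rest where "rest \<delta> = exp (lam * (\<Sum>A | A \<in> cube_bonds N \<and> t \<notin> A. chi A \<delta>) + (\<Sum>s\<in>cube N - {t}. h s * of_real (\<delta> s)))"
    for \<delta> :: "int ^ 'n \<Rightarrow> real"
  \<comment> \<open>the term that is antisymmetric under the flip at \<open>t\<close>\<close>
  define g where "g \<delta> = chi (T - {t}) \<delta> * (of_real (\<delta> t) - tanh (x \<delta>)) * spin_weight lam h N \<delta>"
    for \<delta> :: "int ^ 'n \<Rightarrow> real"
  have tn: "t \<notin> nbrs N t" by (simp add: nbrs_def)
  have x_flip: "x (flip \<delta>) = x \<delta>" for \<delta>
    unfolding x_def flip_def using tn by (auto intro!: sum.cong)
  have rest_flip: "rest (flip \<delta>) = rest \<delta>" for \<delta>
    unfolding rest_def flip_def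
    by (intro arg_cong [of _ _ exp] arg_cong2 [of _ _ _ _ "(+)"] arg_cong2 [of _ _ _ _ "(*)"] refl sum.cong) (auto intro!: chi_cong)
  have chi_flip: "chi (T - {t}) (flip \<delta>) = chi (T - {t}) \<delta>" for \<delta>
    by (rule chi_cong) (auto simp: flip_def)
  have w: "spin_weight lam h N \<delta> = rest \<delta> * exp (of_real (\<delta> t) * x \<delta>)" for \<delta>
  proof -
    have "(\<Sum>s\<in>cube N. h s * of_real (\<delta> s)) = h t * of_real (\<delta> t) + (\<Sum>s\<in>cube N - {t}. h s * of_real (\<delta> s))"
      by (rule sum.remove) (use tc in auto)
    then show ?thesis
      by (simp add: spin_weight_def rest_def x_def energy_at_site [OF tc] exp_add [symmetric] algebra_simps)
  qed
  have key: "(of_real (\<delta> t) - tanh (x \<delta>)) * exp (of_real (\<delta> t) * x \<delta>) = of_real (\<delta> t) / cosh (x \<delta>)"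
    if d: "\<delta> \<in> cube_configs N" for \<delta>
  proof -
    have c0: "cosh (x \<delta>) \<noteq> 0" using ch [OF d] by (simp add: x_def)
    have e: "exp (x \<delta>) = cosh (x \<delta>) + sinh (x \<delta>)" "exp (- x \<delta>) = cosh (x \<delta>) - sinh (x \<delta>)"
      by (simp_all add: cosh_plus_sinh cosh_minus_sinh)
    have s: "cosh (x \<delta>) ^ 2 - sinh (x \<delta>) ^ 2 = 1" by (simp add: cosh_square_eq)
    have "\<delta> t \<in> {-1, 1}" using cube_config_values [OF d tc] .
    then show ?thesis
    proof (elim insertE)
      assume "\<delta> t = -1"
      then show ?thesis using c0 s
        by (simp add: e tanh_def field_simps power2_eq_square)
    next
      assume "\<delta> t = 1"
      then show ?thesis using c0 s
        by (simp add: e tanh_def field_simps power2_eq_square)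
    qed simp
  qed
  have g: "g \<delta> = chi (T - {t}) \<delta> * rest \<delta> * (of_real (\<delta> t) / cosh (x \<delta>))" if "\<delta> \<in> cube_configs N" for \<delta>
  proof -
    have "g \<delta> = chi (T - {t}) \<delta> * rest \<delta> * ((of_real (\<delta> t) - tanh (x \<delta>)) * exp (of_real (\<delta> t) * x \<delta>))"
      by (simp add: g_def w mult_ac)
    then show ?thesis by (simp only: key [OF that])
  qed
  have flip_in: "flip \<delta> \<in> cube_configs N" if "\<delta> \<in> cube_configs N" for \<delta>
    using that tc cube_config_values [OF that tc] unfolding cube_configs_def flip_def
    by (auto simp: PiE_def Pi_def extensional_def)
  have "(\<Sum>\<delta>\<in>cube_configs N. g \<delta>) = (\<Sum>\<delta>\<in>cube_configs N. g (flip \<delta>))"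
    by (rule sum.reindex_bij_witness [of _ flip flip]) (auto simp: flip_in, auto simp: flip_def)
  also have "\<dots> = (\<Sum>\<delta>\<in>cube_configs N. - g \<delta>)"
    by (rule sum.cong) (auto simp: g flip_in x_flip rest_flip chi_flip, simp add: flip_def)
  also have "\<dots> = - (\<Sum>\<delta>\<in>cube_configs N. g \<delta>)" by (simp add: sum_negf)
  finally have g0: "(\<Sum>\<delta>\<in>cube_configs N. g \<delta>) = 0" by simp
  have "weight_sum lam h N (chi T) = (\<Sum>\<delta>\<in>cube_configs N. chi (T - {t}) \<delta> * tanh (x \<delta>) * spin_weight lam h N \<delta>)"
  proof -
    have "chi T \<delta> = of_real (\<delta> t) * chi (T - {t}) \<delta>" for \<delta>
      using t fT by (metis chi_insert Diff_iff finite_Diff insertI1 insert_Diff)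
    then have "weight_sum lam h N (chi T) - (\<Sum>\<delta>\<in>cube_configs N. chi (T - {t}) \<delta> * tanh (x \<delta>) * spin_weight lam h N \<delta>) = (\<Sum>\<delta>\<in>cube_configs N. g \<delta>)"
      unfolding weight_sum_def g_def sum_subtractf [symmetric] by (simp add: algebra_simps)
    then show ?thesis using g0 by simp
  qed
  also have "\<dots> = (\<Sum>\<delta>\<in>cube_configs N. \<Sum>S\<in>Pow (nbrs N t). callen_coeff lam h N t S * (chi (symdiff (T - {t}) S) \<delta> * spin_weight lam h N \<delta>))"
  proof (rule sum.cong [OF refl])
    fix \<delta> :: "int ^ 'n \<Rightarrow> real" assume d: "\<delta> \<in> cube_configs N"
    let ?f = "\<lambda>\<eta>. tanh (lam * (\<Sum>s\<in>nbrs N t. of_real (\<eta> s)) + h t)"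
    have v: "\<delta> s \<in> {-1, 1}" if "s \<in> cube N" for s using cube_config_values [OF d that] .
    have "tanh (x \<delta>) = ?f (restrict \<delta> (nbrs N t))" by (simp add: x_def)
    also have "\<dots> = (\<Sum>S\<in>Pow (nbrs N t). walsh (nbrs N t) ?f S * chi S \<delta>)"
      by (rule walsh_expand) (use v in \<open>auto simp: nbrs_def\<close>)
    finally have "tanh (x \<delta>) = (\<Sum>S\<in>Pow (nbrs N t). callen_coeff lam h N t S * chi S \<delta>)"
      by (simp add: callen_coeff_def tc)
    moreover have "chi (T - {t}) \<delta> * chi S \<delta> = chi (symdiff (T - {t}) S) \<delta>" if "S \<in> Pow (nbrs N t)" for S
    proof (rule chi_symdiff)
      show "finite S" using that by (auto intro: finite_subset [OF _ finite_nbrs])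
      show "\<delta> s \<in> {-1, 1}" if "s \<in> (T - {t}) \<union> S" for s
        using that \<open>S \<in> Pow (nbrs N t)\<close> t by (intro v) (auto simp: nbrs_def)
    qed (use fT in auto)
    ultimately show "chi (T - {t}) \<delta> * tanh (x \<delta>) * spin_weight lam h N \<delta>
       = (\<Sum>S\<in>Pow (nbrs N t). callen_coeff lam h N t S * (chi (symdiff (T - {t}) S) \<delta> * spin_weight lam h N \<delta>))"
      by (simp add: sum_distrib_left sum_distrib_right) (auto intro!: sum.cong simp: mult_ac)
  qed
  also have "\<dots> = (\<Sum>S\<in>Pow (nbrs N t). callen_coeff lam h N t S * weight_sum lam h N (chi (symdiff (T - {t}) S)))"
    unfolding weight_sum_def sum_distrib_left by (rule sum.swap)
  finally show ?thesis .
qed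

section \<open>High temperature bounds, uniform in the volume\<close>

text \<open>The factor gained by one application of the Callen equation. The value makes the sum of
  \<open>kappa0 ^ |t|\<close> over \<open>t \<noteq> 0\<close> smaller than 1, which gives positivity of the limiting variance.\<close>

definition kappa0 :: "'n::finite itself \<Rightarrow> real" where
  "kappa0 _ = 1 / (8 * real CARD('n))"

text \<open>For coupling and field up to this size the local field is at most \<open>kappa0 / (4 * 2 ^ d)\<close>, where \<open>d\<close> is
  the number of neighbours; this compensates the \<open>2 ^ d\<close> Walsh coefficients and the constant 4 in the
  bound for \<open>tanh\<close>.\<close>

definition rad0 :: "'n::finite itself \<Rightarrow> real" where
  "rad0 _ = kappa0 TYPE('n) / (2 ^ lattice_degree TYPE('n) * 4 * (real (lattice_degree TYPE('n)) + 1))"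

definition high_temp :: "complex \<Rightarrow> (int ^ 'n::finite \<Rightarrow> complex) \<Rightarrow> bool" where
  "high_temp lam h \<longleftrightarrow> norm lam \<le> rad0 TYPE('n) \<and> (\<forall>t. norm (h t) \<le> rad0 TYPE('n))"

lemma kappa0_bounds: "0 < kappa0 TYPE('n::finite)" "kappa0 TYPE('n) \<le> 1/8"
  by (auto simp: kappa0_def field_simps)

lemma rad0_pos: "0 < rad0 TYPE('n::finite)"
  using kappa0_bounds(1) [where 'n = 'n] unfolding rad0_def by (intro divide_pos_pos mult_pos_pos) auto

lemma high_temp_field_le:
  fixes h :: "int ^ 'n::finite \<Rightarrow> complex"
  assumes sm: "high_temp lam h" and d: "\<And>s. s \<in> nbrs N t \<Longrightarrow> \<delta> s \<in> {-1, 1}"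
  shows "norm (lam * (\<Sum>s\<in>nbrs N t. of_real (\<delta> s)) + h t) \<le> kappa0 TYPE('n) / (2 ^ lattice_degree TYPE('n) * 4)"
proof -
  let ?d = "lattice_degree TYPE('n)"
  have r: "0 \<le> rad0 TYPE('n)" using rad0_pos [where 'n = 'n] by simp
  have "norm (\<Sum>s\<in>nbrs N t. complex_of_real (\<delta> s)) \<le> (\<Sum>s\<in>nbrs N t. 1)"
    by (rule sum_norm_le) (use d in fastforce)
  also have "\<dots> \<le> real ?d" using card_nbrs_le [of N t] by simp
  finally have "norm (lam * (\<Sum>s\<in>nbrs N t. complex_of_real (\<delta> s))) \<le> rad0 TYPE('n) * real ?d"
    unfolding norm_mult using sm r by (intro mult_mono) (auto simp: high_temp_def)
  moreover have "norm (h t) \<le> rad0 TYPE('n)" using sm by (simp add: high_temp_def)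
  ultimately have "norm (lam * (\<Sum>s\<in>nbrs N t. of_real (\<delta> s)) + h t) \<le> rad0 TYPE('n) * real ?d + rad0 TYPE('n)"
    by (meson norm_triangle_mono)
  also have "\<dots> = rad0 TYPE('n) * (real ?d + 1)" by (simp add: algebra_simps)
  also have "\<dots> = kappa0 TYPE('n) / (2 ^ ?d * 4)" by (simp add: rad0_def)
  finally show ?thesis .
qed

lemma high_temp_field_le_quarter: "kappa0 TYPE('n::finite) / (2 ^ d * 4) \<le> 1/4"
proof -
  have "kappa0 TYPE('n) \<le> 2 ^ d"
    using kappa0_bounds(2) [where 'n = 'n] one_le_power [of "2::real" d] by linarith
  then show ?thesis by (simp add: field_simps)
qed

lemma callen_sum_le:
  fixes h :: "int ^ 'n::finite \<Rightarrow> complex"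
  assumes sm: "high_temp lam h"
  shows "(\<Sum>S\<in>Pow (nbrs N t). norm (callen_coeff lam h N t S)) \<le> kappa0 TYPE('n)"
proof -
  let ?d = "lattice_degree TYPE('n)"
  let ?b = "kappa0 TYPE('n) / 2 ^ ?d"
  have k: "0 \<le> kappa0 TYPE('n)" using kappa0_bounds(1) [where 'n = 'n] by simp
  have "norm (callen_coeff lam h N t S) \<le> ?b" if S: "S \<subseteq> nbrs N t" for S
  proof (cases "t \<in> cube N")
    case True
    have "norm (walsh (nbrs N t) (\<lambda>\<eta>. tanh (lam * (\<Sum>s\<in>nbrs N t. of_real (\<eta> s)) + h t)) S) \<le> ?b"
    proof (rule norm_walsh_le [OF finite_nbrs S])
      fix \<eta> assume e: "\<eta> \<in> nbrs N t \<rightarrow>\<^sub>E {-1, 1::real}"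
      let ?x = "lam * (\<Sum>s\<in>nbrs N t. complex_of_real (\<eta> s)) + h t"
      have n: "norm ?x \<le> kappa0 TYPE('n) / (2 ^ ?d * 4)"
        by (rule high_temp_field_le [OF sm]) (use e in auto)
      then have "norm ?x \<le> 1/4" using high_temp_field_le_quarter [where 'n = 'n, of ?d] by linarith
      then have "norm (tanh ?x) \<le> 4 * norm ?x" by (rule norm_tanh_le)
      also have "\<dots> \<le> 4 * (kappa0 TYPE('n) / (2 ^ ?d * 4))" using n by simp
      finally show "norm (tanh ?x) \<le> ?b" by simp
    qed
    then show ?thesis using True by (simp add: callen_coeff_def)
  qed (simp add: callen_coeff_def k)
  then have "(\<Sum>S\<in>Pow (nbrs N t). norm (callen_coeff lam h N t S)) \<le> (\<Sum>S\<in>Pow (nbrs N t). ?b)"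
    by (intro sum_mono) auto
  also have "\<dots> = 2 ^ card (nbrs N t) * ?b" by (simp add: card_Pow)
  also have "\<dots> \<le> 2 ^ ?d * ?b"
    using k card_nbrs_le [of N t] by (intro mult_right_mono power_increasing) auto
  finally show ?thesis by simp
qed

lemma callen_identity_high_temp:
  fixes h :: "int ^ 'n::finite \<Rightarrow> complex"
  assumes sm: "high_temp lam h" and t: "t \<in> T" "T \<subseteq> cube N"
  shows "weight_sum lam h N (chi T) = (\<Sum>S\<in>Pow (nbrs N t). callen_coeff lam h N t S * weight_sum lam h N (chi (symdiff (T - {t}) S)))"
proof (rule callen_identity [OF t])
  fix \<delta> :: "int ^ 'n \<Rightarrow> real" assume "\<delta> \<in> cube_configs N"
  then have "norm (lam * (\<Sum>s\<in>nbrs N t. of_real (\<delta> s)) + h t) \<le> kappa0 TYPE('n) / (2 ^ lattice_degree TYPE('n) * 4)"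
    by (intro high_temp_field_le [OF sm] cube_config_values) (auto simp: nbrs_def)
  also have "\<dots> \<le> 1/4" by (rule high_temp_field_le_quarter)
  finally show "cosh (lam * (\<Sum>s\<in>nbrs N t. of_real (\<delta> s)) + h t) \<noteq> 0" by (rule norm_tanh_le)
qed

lemma one_config: "(\<lambda>t\<in>cube N. 1) \<in> cube_configs N"
  by (auto simp: cube_configs_def)

lemma symdiff_nbrs_cube: "T \<subseteq> cube N \<Longrightarrow> S \<subseteq> nbrs N t \<Longrightarrow> symdiff (T - {t}) S \<subseteq> cube N"
  by (auto simp: symdiff_def nbrs_def)

text \<open>Let \<open>T0\<close> maximize the modulus of the weighted sum of \<open>chi T\<close>. If \<open>T0\<close> were nonempty, the Callen
  equation would bound the maximum by \<open>kappa0\<close> times itself, so the maximum would be 0. Then all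
  Walsh coefficients of the weight would vanish, although the weight is an exponential. Hence the
  maximum is attained at the empty set and is positive. This works for complex parameters, where
  positivity of the weights is not available.\<close>

lemma weight_sum_dominated:
  fixes h :: "int ^ 'n::finite \<Rightarrow> complex"
  assumes sm: "high_temp lam h"
  shows "weight_sum lam h N (\<lambda>_. 1) \<noteq> 0"
    and "T \<subseteq> cube N \<Longrightarrow> norm (weight_sum lam h N (chi T)) \<le> norm (weight_sum lam h N (\<lambda>_. 1))"
proof -
  let ?n = "\<lambda>T. norm (weight_sum lam h N (chi T))"
  define m where "m = Max (?n ` Pow (cube N))"
  have fin: "finite (?n ` Pow (cube N))" by simp
  have le_m: "?n T \<le> m" if "T \<subseteq> cube N" for T
    unfolding m_def using fin that by (intro Max_ge) auto
  have "m \<in> ?n ` Pow (cube N)" unfolding m_def by (rule Max_in [OF fin]) auto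
  then obtain T0 where T0: "T0 \<subseteq> cube N" "?n T0 = m" by auto
  have m_pos: "m > 0"
  proof (rule ccontr)
    assume "\<not> m > 0"
    then have z: "weight_sum lam h N (chi T) = 0" if "T \<subseteq> cube N" for T
      using le_m [OF that] by (metis norm_le_zero_iff order_trans not_less)
    let ?o = "\<lambda>t\<in>cube N. 1::real"
    have "(\<Sum>T\<in>Pow (cube N). chi T ?o * weight_sum lam h N (chi T)) = 0"
      by (rule sum.neutral) (auto simp: z)
    moreover have "(\<Sum>T\<in>Pow (cube N). chi T ?o * weight_sum lam h N (chi T))
        = (\<Sum>\<delta>\<in>cube_configs N. (\<Sum>T\<in>Pow (cube N). chi T ?o * chi T \<delta>) * spin_weight lam h N \<delta>)"
      unfolding weight_sum_def sum_distrib_left sum_distrib_right by (subst sum.swap) (simp add: mult_ac)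
    moreover have "\<dots> = (\<Sum>\<delta>\<in>cube_configs N. if ?o = \<delta> then 2 ^ card (cube N :: (int ^ 'n) set) * spin_weight lam h N \<delta> else 0)"
    proof (rule sum.cong [OF refl])
      fix \<delta> :: "int ^ 'n \<Rightarrow> real" assume d: "\<delta> \<in> cube_configs N"
      have "(\<forall>s\<in>cube N. ?o s = \<delta> s) \<longleftrightarrow> ?o = \<delta>"
        using d by (auto simp: cube_configs_def fun_eq_iff PiE_def extensional_def restrict_def)
      moreover have "(\<Sum>T\<in>Pow (cube N). chi T ?o * chi T \<delta>) = (if \<forall>s\<in>cube N. ?o s = \<delta> s then 2 ^ card (cube N :: (int ^ 'n) set) else 0)"
        by (rule walsh_kernel) (use cube_config_values [OF d] in auto)
      ultimately show "(\<Sum>T\<in>Pow (cube N). chi T ?o * chi T \<delta>) * spin_weight lam h N \<delta>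
         = (if ?o = \<delta> then 2 ^ card (cube N :: (int ^ 'n) set) * spin_weight lam h N \<delta> else 0)" by simp
    qed
    moreover have "\<dots> = 2 ^ card (cube N :: (int ^ 'n) set) * spin_weight lam h N ?o"
      by (subst sum.delta' [OF finite_cube_configs]) (simp add: one_config)
    ultimately show False by (simp add: spin_weight_def)
  qed
  have "T0 = {}"
  proof (rule ccontr)
    assume "T0 \<noteq> {}"
    then obtain t where t: "t \<in> T0" by auto
    have "m = norm (\<Sum>S\<in>Pow (nbrs N t). callen_coeff lam h N t S * weight_sum lam h N (chi (symdiff (T0 - {t}) S)))"
      using callen_identity_high_temp [OF sm t T0(1)] T0(2) by simp
    also have "\<dots> \<le> (\<Sum>S\<in>Pow (nbrs N t). norm (callen_coeff lam h N t S) * m)"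
    proof (rule sum_norm_le)
      fix S assume "S \<in> Pow (nbrs N t)"
      then have "?n (symdiff (T0 - {t}) S) \<le> m" using T0 by (intro le_m symdiff_nbrs_cube) auto
      then show "norm (callen_coeff lam h N t S * weight_sum lam h N (chi (symdiff (T0 - {t}) S))) \<le> norm (callen_coeff lam h N t S) * m"
        by (simp add: norm_mult mult_left_mono)
    qed
    also have "\<dots> \<le> kappa0 TYPE('n) * m"
      unfolding sum_distrib_right [symmetric] using callen_sum_le [OF sm] m_pos by (intro mult_right_mono) auto
    also have "\<dots> \<le> 1/8 * m" using kappa0_bounds(2) [where 'n = 'n] m_pos by (intro mult_right_mono) auto
    finally show False using m_pos by simp
  qed
  then have e: "m = norm (weight_sum lam h N (\<lambda>_. 1))" using T0(2) by (simp add: chi_def [abs_def])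
  then show "weight_sum lam h N (\<lambda>_. 1) \<noteq> 0" using m_pos by auto
  show "T \<subseteq> cube N \<Longrightarrow> norm (weight_sum lam h N (chi T)) \<le> norm (weight_sum lam h N (\<lambda>_. 1))"
    using le_m e by simp
qed

lemma norm_corr_le:
  "high_temp lam h \<Longrightarrow> norm (corr lam h N T) \<le> 1"
  using weight_sum_dominated(1) [of lam h N] weight_sum_dominated(2) [of lam h T N] by (auto simp: corr_def norm_divide divide_le_eq)

lemma corr_empty: "high_temp lam h \<Longrightarrow> corr lam h N {} = 1"
  using weight_sum_dominated(1) [of lam h N] by (simp add: corr_def chi_def [abs_def])

lemma callen_at_corr:
  fixes h :: "int ^ 'n::finite \<Rightarrow> complex"
  assumes sm: "high_temp lam h"
  shows "callen_at (nbrs N) (callen_coeff lam h N) (corr lam h N) t"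
  unfolding callen_at_def
proof (intro allI impI)
  fix T :: "(int ^ 'n) set" assume T: "finite T" "t \<in> T"
  show "corr lam h N T = (\<Sum>S\<in>Pow (nbrs N t). callen_coeff lam h N t S * corr lam h N (symdiff (T - {t}) S))"
  proof (cases "T \<subseteq> cube N")
    case True
    then show ?thesis
      using callen_identity_high_temp [OF sm T(2) True] symdiff_nbrs_cube [OF True]
      by (simp add: corr_def sum_divide_distrib)
  next
    case False
    then obtain x where x: "x \<in> T" "x \<notin> cube N" by auto
    have "callen_coeff lam h N t S * corr lam h N (symdiff (T - {t}) S) = 0" if "S \<in> Pow (nbrs N t)" for S
    proof (cases "t \<in> cube N")
      case True
      then have "x \<in> symdiff (T - {t}) S" using x that by (auto simp: symdiff_def nbrs_def)
      then show ?thesis using x by (auto simp: corr_def)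
    qed (simp add: callen_coeff_def)
    then have "(\<Sum>S\<in>Pow (nbrs N t). callen_coeff lam h N t S * corr lam h N (symdiff (T - {t}) S)) = 0"
      by (intro sum.neutral) auto
    moreover have "corr lam h N T = 0" using False by (simp add: corr_def)
    ultimately show ?thesis by simp
  qed
qed

text \<open>The coefficients of a cube at high temperature satisfy the hypotheses of \<open>callen_decay\<close> with
  \<open>\<kappa> = kappa0\<close>.\<close>

lemma corr_decay:
  fixes D :: "(int ^ 'n::finite) set \<Rightarrow> complex"
  assumes sm: "high_temp lam h" and bound: "\<And>T. finite T \<Longrightarrow> norm (D T) \<le> M" and empty: "D {} = 0"
    and sol: "\<And>t. t \<in> U \<Longrightarrow> callen_at (nbrs N) (callen_coeff lam h N) D t"
    and T: "finite T" "\<And>t s. t \<in> T \<Longrightarrow> ldist s t < int n \<Longrightarrow> s \<in> U"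
  shows "norm (D T) \<le> M * kappa0 TYPE('n) ^ n"
proof (rule callen_decay [where U = U and nb = "nbrs N" and c = "callen_coeff lam h N"])
  show "nbrs N t \<subseteq> {s. ldist s t \<le> 1}" for t by (auto simp: nbrs_def)
qed (use assms callen_sum_le [OF sm] kappa0_bounds(1) [where 'n = 'n] in \<open>auto intro: less_imp_le\<close>)

lemma callen_interior:
  assumes "\<And>s. ldist s t \<le> 1 \<Longrightarrow> s \<in> cube N \<and> s \<in> cube N'"
  shows "nbrs N t = nbrs N' t" "callen_coeff lam h N t = callen_coeff lam h N' t"
proof -
  show *: "nbrs N t = nbrs N' t" using assms by (auto simp: nbrs_def)
  have "t \<in> cube N" "t \<in> cube N'" using assms [of t] by auto
  then show "callen_coeff lam h N t = callen_coeff lam h N' t" by (simp add: callen_coeff_def fun_eq_iff *)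
qed

text \<open>The correlations of two cubes satisfy the same equation at all sites whose neighbours lie in both,
  and they agree at the empty set. So \<open>corr_decay\<close> applies to their difference.\<close>

lemma corr_volume_dependence:
  fixes h :: "int ^ 'n::finite \<Rightarrow> complex"
  assumes sm: "high_temp lam h" and T: "T \<subseteq> cube M" and N: "M + n \<le> N" "M + n \<le> N'"
  shows "norm (corr lam h N T - corr lam h N' T) \<le> 2 * kappa0 TYPE('n) ^ n"
proof (rule corr_decay [OF sm, where D = "\<lambda>T. corr lam h N T - corr lam h N' T" and N = N
    and U = "{t. \<forall>s. ldist s t \<le> 1 \<longrightarrow> s \<in> cube N \<and> s \<in> cube N'}"])
  show "norm (corr lam h N T - corr lam h N' T) \<le> 2" for T
    using norm_triangle_ineq4 [of "corr lam h N T" "corr lam h N' T"] norm_corr_le [OF sm, of N T] norm_corr_le [OF sm, of N' T]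
    by linarith
  show "corr lam h N {} - corr lam h N' {} = 0" by (simp add: corr_empty [OF sm])
  show "finite T" using T by (rule finite_subset) simp
  show "callen_at (nbrs N) (callen_coeff lam h N) (\<lambda>T. corr lam h N T - corr lam h N' T) t"
    if "t \<in> {t. \<forall>s. ldist s t \<le> 1 \<longrightarrow> s \<in> cube N \<and> s \<in> cube N'}" for t
  proof (rule callen_at_diff [OF callen_at_corr [OF sm]])
    have "nbrs N t = nbrs N' t" "callen_coeff lam h N t = callen_coeff lam h N' t"
      using that by (auto intro!: callen_interior)
    then show "callen_at (nbrs N) (callen_coeff lam h N) (corr lam h N') t"
      using callen_at_corr [OF sm, of N' t] by (simp add: callen_at_def)
  qed
  fix t s assume "t \<in> T" "ldist s t < int n"
  show "s \<in> {t. \<forall>s. ldist s t \<le> 1 \<longrightarrow> s \<in> cube N \<and> s \<in> cube N'}"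
  proof safe
    fix x assume "ldist x s \<le> 1"
    then have "ldist x t \<le> int n" using ldist_triangle [of x t s] \<open>ldist s t < int n\<close> by linarith
    then have "x \<in> cube (M + n)" using \<open>t \<in> T\<close> T by (intro ldist_cube) auto
    then show "x \<in> cube N" "x \<in> cube N'" using cube_mono N by blast+
  qed
qed

text \<open>Every bond has two end points, so a global spin flip preserves the energy.\<close>

lemma spin_weight_neg:
  fixes \<delta> :: "int ^ 'n::finite \<Rightarrow> real"
  shows "spin_weight lam (\<lambda>_. 0) N (\<lambda>s\<in>cube N. - \<delta> s) = spin_weight lam (\<lambda>_. 0) N \<delta>"
proof -
  have "chi A (\<lambda>s\<in>cube N. - \<delta> s) = chi A \<delta>" if "A \<in> cube_bonds N" for A :: "(int ^ 'n) set"
  proof -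
    from that obtain s s' where s: "A = {s, s'}" "ldist s s' = 1" "s \<in> cube N" "s' \<in> cube N"
      by (auto simp: cube_bonds_def bonds_def)
    then have "s \<noteq> s'" by auto
    with s show ?thesis by (simp add: chi_def)
  qed
  then show ?thesis by (simp add: spin_weight_def energy_def)
qed

lemma corr_single:
  fixes t :: "int ^ 'n::finite"
  shows "corr lam (\<lambda>_. 0) N {t} = 0"
proof (cases "t \<in> cube N")
  case True
  let ?flip = "\<lambda>\<delta>. \<lambda>s\<in>cube N. - \<delta> s :: real"
  let ?g = "\<lambda>\<delta> :: int ^ 'n \<Rightarrow> real. chi {t} \<delta> * spin_weight lam (\<lambda>_. 0) N \<delta>"
  have flip_flip: "?flip (?flip \<delta>) = \<delta>" if "\<delta> \<in> cube_configs N" for \<delta> :: "int ^ 'n \<Rightarrow> real"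
    using that by (auto simp: cube_configs_def PiE_def extensional_def fun_eq_iff restrict_def)
  have flip_in: "?flip \<delta> \<in> cube_configs N" if "\<delta> \<in> cube_configs N" for \<delta> :: "int ^ 'n \<Rightarrow> real"
    using that by (auto simp: cube_configs_def)
  have "weight_sum lam (\<lambda>_. 0) N (chi {t}) = (\<Sum>\<delta>\<in>cube_configs N. ?g (?flip \<delta>))"
    unfolding weight_sum_def
    by (rule sum.reindex_bij_witness [of _ ?flip ?flip]) (simp_all only: flip_flip flip_in)
  also have "\<dots> = (\<Sum>\<delta>\<in>cube_configs N. - ?g \<delta>)"
    by (rule sum.cong) (use True in \<open>auto simp: spin_weight_neg chi_def\<close>)
  also have "\<dots> = - weight_sum lam (\<lambda>_. 0) N (chi {t})" by (simp add: weight_sum_def sum_negf)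
  finally show ?thesis by (simp add: corr_def)
qed (simp add: corr_def)

lemma high_temp_zero_field: "norm lam \<le> rad0 TYPE('n::finite) \<Longrightarrow> high_temp lam (\<lambda>_ :: int ^ 'n. 0)"
  using rad0_pos [where 'n = 'n] by (simp add: high_temp_def)

text \<open>Shift by \<open>{t}\<close>: the function \<open>T \<mapsto> corr (T \<triangle> {t})\<close> solves the equation away from \<open>t\<close> and vanishes at the
  empty set because single spins have mean 0.\<close>

lemma corr_pair_decay:
  fixes s t :: "int ^ 'n::finite"
  assumes lam: "norm lam \<le> rad0 TYPE('n)" and st: "s \<noteq> t"
  shows "norm (corr lam (\<lambda>_. 0) N {s, t}) \<le> kappa0 TYPE('n) ^ nat (ldist s t)"
proof -
  note sm = high_temp_zero_field [OF lam]
  have "norm (corr lam (\<lambda>_. 0) N (symdiff {s} {t})) \<le> 1 * kappa0 TYPE('n) ^ nat (ldist s t)"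
  proof (rule corr_decay [OF sm, where U = "- {t}" and D = "\<lambda>T. corr lam (\<lambda>_. 0) N (symdiff T {t})" and N = N])
    show "norm (corr lam (\<lambda>_. 0) N (symdiff T {t})) \<le> 1" for T by (rule norm_corr_le [OF sm])
    show "corr lam (\<lambda>_. 0) N (symdiff {} {t}) = 0" by (simp add: symdiff_def corr_single)
    show "callen_at (nbrs N) (callen_coeff lam (\<lambda>_. 0) N) (\<lambda>T. corr lam (\<lambda>_. 0) N (symdiff T {t})) u" if "u \<in> - {t}" for u
      using that by (intro callen_at_shift callen_at_corr [OF sm]) auto
    show "x \<in> - {t}" if "y \<in> {s}" "ldist x y < int (nat (ldist s t))" for x y
      using that ldist_commute [of t s] by (auto simp: ldist_nonneg)
  qed simp
  moreover have "symdiff {s} {t} = {s, t}" using st by (auto simp: symdiff_def)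
  ultimately show ?thesis by simp
qed

text \<open>Without coupling and field all Callen coefficients vanish, as \<open>tanh 0 = 0\<close>.\<close>

lemma corr_zero:
  fixes T :: "(int ^ 'n::finite) set"
  assumes "T \<noteq> {}" "T \<subseteq> cube N"
  shows "corr 0 (\<lambda>_. 0) N T = 0"
proof -
  obtain t where t: "t \<in> T" using assms by auto
  have fT: "finite T" using assms by (auto intro: finite_subset)
  have "callen_coeff 0 (\<lambda>_. 0) N t S = 0" for S by (simp add: callen_coeff_def walsh_def)
  then show ?thesis
    using callen_at_corr [OF high_temp_zero_field, of 0 N t] t fT rad0_pos [where 'n = 'n]
    by (simp add: callen_at_def)
qed

section \<open>The Gibbs measure on a cube as a finite average\<close>

text \<open>One representative of the atom \<open>cylinder (cube N) \<delta>\<close>.\<close>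

definition extend_config :: "nat \<Rightarrow> (int ^ 'n \<Rightarrow> real) \<Rightarrow> int ^ 'n \<Rightarrow> real" where
  "extend_config N \<delta> = (\<lambda>t. if t \<in> cube N then \<delta> t else 1)"

text \<open>Functions of the spins in \<open>T\<close>; only their values on \<open>Omega\<close> matter.\<close>

definition local_on :: "(int ^ 'n::finite) set \<Rightarrow> ('n config \<Rightarrow> 'b) \<Rightarrow> bool" where
  "local_on T f \<longleftrightarrow> (\<forall>\<omega>\<in>Omega. \<forall>\<omega>'\<in>Omega. (\<forall>t\<in>T. \<omega> t = \<omega>' t) \<longrightarrow> f \<omega> = f \<omega>')"

lemma local_onD: "local_on T f \<Longrightarrow> \<omega> \<in> Omega \<Longrightarrow> \<omega>' \<in> Omega \<Longrightarrow> (\<And>t. t \<in> T \<Longrightarrow> \<omega> t = \<omega>' t) \<Longrightarrow> f \<omega> = f \<omega>'"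
  unfolding local_on_def by blast

lemma local_on_comp: "local_on T f \<Longrightarrow> local_on T (\<lambda>\<omega>. g (f \<omega>))"
  unfolding local_on_def by (intro ballI impI arg_cong [of _ _ g]) blast

lemma local_on_spin_prod: "local_on T (spin_prod T)"
  by (auto simp: local_on_def spin_prod_def spin_def intro!: prod.cong)

lemma extend_config_Omega: "\<delta> \<in> cube_configs N \<Longrightarrow> extend_config N \<delta> \<in> Omega"
  by (auto simp: extend_config_def Omega_def cube_configs_def PiE_iff)

lemma extend_config_cylinder:
  "\<delta> \<in> cube_configs N \<Longrightarrow> extend_config N \<delta> \<in> cylinder (cube N) \<delta>"
  by (simp add: cylinder_def extend_config_Omega) (simp add: extend_config_def)

lemma config_in_atom:
  "\<omega> \<in> Omega \<Longrightarrow> restrict \<omega> (cube N) \<in> cube_configs N"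
  "\<omega> \<in> Omega \<Longrightarrow> \<omega> \<in> cylinder (cube N) (restrict \<omega> (cube N))"
  by (auto simp: cube_configs_def Omega_def cylinder_def)

lemma atom_unique:
  "\<delta> \<in> cube_configs N \<Longrightarrow> \<omega> \<in> cylinder (cube N) \<delta> \<Longrightarrow> \<delta> = restrict \<omega> (cube N)"
  by (auto simp: cube_configs_def cylinder_def fun_eq_iff PiE_def extensional_def restrict_def)

abbreviation cube_events :: "nat \<Rightarrow> ('n::finite) config set set" where
  "cube_events N \<equiv> {\<Union>\<delta>\<in>D. cylinder (cube N) \<delta> | D. D \<subseteq> cube_configs N}"

lemma cube_events_subset: "(cube_events N :: ('n::finite) config set set) \<subseteq> Pow Omega"
  by (auto simp: cylinder_def)

text \<open>The sets that contain or avoid each atom form a sigma-algebra, so a measurable set contains an atom as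
  soon as it meets it.\<close>

lemma cube_event_atoms:
  assumes A: "A \<in> sigma_sets Omega (cube_events N)" and d: "\<delta> \<in> cube_configs N"
  shows "cylinder (cube N) \<delta> \<subseteq> A \<longleftrightarrow> extend_config N \<delta> \<in> A"
proof -
  have "cylinder (cube N) \<delta> \<subseteq> A \<or> cylinder (cube N) \<delta> \<inter> A = {}"
    using A
  proof induction
    case (Basic A)
    then obtain D where D: "D \<subseteq> cube_configs N" "A = (\<Union>\<delta>\<in>D. cylinder (cube N) \<delta>)" by auto
    show ?case
    proof (cases "\<delta> \<in> D")
      case False
      then have "cylinder (cube N) \<delta> \<inter> A = {}"
        using D atom_unique [OF d] atom_unique by blast
      then show ?thesis ..
    qed (use D in auto)
  next
    case (Compl A)
    then show ?case by (auto simp: cylinder_def)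
  next
    case (Union A)
    then show ?case by blast
  qed auto
  then show ?thesis using extend_config_cylinder [OF d] by blast
qed

definition gibbs_prob :: "real \<Rightarrow> nat \<Rightarrow> (int ^ 'n::finite \<Rightarrow> real) \<Rightarrow> real" where
  "gibbs_prob lam N \<delta> = boltzmann lam N \<delta> / partition_sum TYPE('n) lam N"

lemma cube_configs_nonempty: "cube_configs N \<noteq> {}"
  using one_config by auto

lemma gibbs_prob:
  shows "0 \<le> gibbs_prob lam N \<delta>"
    and "(\<Sum>\<delta>\<in>(cube_configs N :: (int ^ 'n::finite \<Rightarrow> real) set). gibbs_prob lam N \<delta>) = 1"
proof -
  have "0 < partition_sum TYPE('n) lam N"
    unfolding partition_sum_def boltzmann_def by (intro sum_pos) (auto simp: cube_configs_nonempty)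
  then show "(\<Sum>\<delta>\<in>(cube_configs N :: (int ^ 'n::finite \<Rightarrow> real) set). gibbs_prob lam N \<delta>) = 1"
    by (simp add: gibbs_prob_def sum_divide_distrib [symmetric]) (simp add: partition_sum_def)
  show "0 \<le> gibbs_prob lam N \<delta>"
    unfolding gibbs_prob_def partition_sum_def boltzmann_def by (intro divide_nonneg_nonneg sum_nonneg) auto
qed

lemma measurable_extend_config:
  "(extend_config N :: _ \<Rightarrow> ('n::finite) config) \<in>
    measurable (point_measure (cube_configs N) p) (sigma Omega (cube_events N))"
  by (rule measurable_measure_of [OF cube_events_subset])
    (auto simp: space_point_measure sets_point_measure extend_config_Omega)

text \<open>The set function that defines the Gibbs measure adds the weights of the atoms in a set. By \<open>cube_event_atoms\<close> it agrees
  on measurable sets with the image of a weighted counting measure under the choice of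
  representatives, and so it inherits countable additivity.\<close>

lemma gibbs_eq_distr:
  "gibbs lam N = distr (point_measure (cube_configs N) (\<lambda>\<delta>. ennreal (gibbs_prob lam N \<delta>)))
     (sigma Omega (cube_events N)) (extend_config N :: _ \<Rightarrow> ('n::finite) config)"
  (is "_ = ?M")
proof (rule measure_eqI)
  let ?\<mu> = "\<lambda>A :: 'n config set. \<Sum>\<delta> | \<delta> \<in> cube_configs N \<and> cylinder (cube N) \<delta> \<subseteq> A.
            ennreal (boltzmann lam N \<delta> / partition_sum TYPE('n) lam N)"
  show sets_eq: "sets (gibbs lam N) = sets ?M"
    using cube_events_subset [where 'n = 'n, of N] by (simp add: gibbs_def sets_measure_of)
  have sM: "sets ?M = sigma_sets Omega (cube_events N)"
    using cube_events_subset [where 'n = 'n, of N] by (simp add: sets_measure_of)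
  have mu: "?\<mu> A = emeasure ?M A" if A: "A \<in> sets ?M" for A
  proof -
    have "emeasure ?M A = emeasure (point_measure (cube_configs N) (\<lambda>\<delta>. ennreal (gibbs_prob lam N \<delta>)))
        (extend_config N -` A \<inter> cube_configs N)"
      using emeasure_distr [OF measurable_extend_config] A by (simp add: space_point_measure)
    also have "\<dots> = (\<Sum>\<delta>\<in>extend_config N -` A \<inter> cube_configs N. ennreal (gibbs_prob lam N \<delta>))"
      by (rule emeasure_point_measure_finite) auto
    also have "extend_config N -` A \<inter> cube_configs N = {\<delta>. \<delta> \<in> cube_configs N \<and> cylinder (cube N) \<delta> \<subseteq> A}"
      using cube_event_atoms A unfolding sM by blast
    finally show ?thesis by (simp add: gibbs_prob_def)
  qed
  fix A assume "A \<in> sets (gibbs lam N :: 'n config measure)"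
  then have A: "A \<in> sets ?M" by (simp only: sets_eq)
  have "emeasure (gibbs lam N) A = ?\<mu> A"
  proof (rule emeasure_measure_of [OF gibbs_def])
    show "cube_events N \<subseteq> Pow Omega" by (rule cube_events_subset)
    show "positive (sets (gibbs lam N)) ?\<mu>"
      unfolding sets_eq using mu [of "{}"] by (simp add: positive_def)
    show "countably_additive (sets (gibbs lam N)) ?\<mu>"
      unfolding sets_eq
    proof (rule countably_additiveI)
      fix F :: "nat \<Rightarrow> 'n config set" assume F: "range F \<subseteq> sets ?M" "disjoint_family F" "\<Union> (range F) \<in> sets ?M"
      have "(\<Sum>i. ?\<mu> (F i)) = (\<Sum>i. emeasure ?M (F i))" using F(1) by (intro suminf_cong mu) auto
      also have "\<dots> = emeasure ?M (\<Union> (range F))" by (rule suminf_emeasure) (use F in auto)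
      also have "\<dots> = ?\<mu> (\<Union> (range F))" using mu [OF F(3)] by simp
      finally show "(\<Sum>i. ?\<mu> (F i)) = ?\<mu> (\<Union> (range F))" .
    qed
    show "A \<in> sets (gibbs lam N)" using A sets_eq by simp
  qed
  then show "emeasure (gibbs lam N) A = emeasure ?M A" using mu [OF A] by simp
qed

lemma space_gibbs [simp]: "space (gibbs lam N) = Omega"
  unfolding gibbs_def by (rule space_measure_of [OF cube_events_subset])

lemma sets_gibbs: "sets (gibbs lam N) = sigma_sets Omega (cube_events N)"
  unfolding gibbs_def by (rule sets_measure_of [OF cube_events_subset])

lemma prob_space_gibbs: "prob_space (gibbs lam N :: ('n::finite) config measure)"
proof -
  have "prob_space (point_measure (cube_configs N :: (int ^ 'n \<Rightarrow> real) set) (\<lambda>\<delta>. ennreal (gibbs_prob lam N \<delta>)))"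
    by (rule prob_spaceI) (simp add: space_point_measure emeasure_point_measure_finite sum_ennreal gibbs_prob)
  then show ?thesis
    unfolding gibbs_eq_distr by (rule prob_space.prob_space_distr [OF _ measurable_extend_config])
qed

lemma local_measurable_gibbs:
  fixes f :: "('n::finite) config \<Rightarrow> 'b::topological_space"
  assumes f: "local_on (cube N) f"
  shows "f \<in> borel_measurable (gibbs lam N)"
proof (rule measurableI)
  fix B :: "'b set"
  have "f -` B \<inter> Omega = (\<Union>\<delta>\<in>{\<delta> \<in> cube_configs N. f (extend_config N \<delta>) \<in> B}. cylinder (cube N) \<delta>)" (is "_ = ?R")
  proof (intro set_eqI iffI)
    fix \<omega> assume w: "\<omega> \<in> f -` B \<inter> Omega"
    then have "f (extend_config N (restrict \<omega> (cube N))) = f \<omega>"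
      by (intro local_onD [OF f]) (auto simp: config_in_atom extend_config_Omega, auto simp: extend_config_def)
    then show "\<omega> \<in> ?R" using w config_in_atom [of \<omega> N] by auto
  next
    fix \<omega> assume "\<omega> \<in> ?R"
    then obtain \<delta> where d: "\<delta> \<in> cube_configs N" "f (extend_config N \<delta>) \<in> B" "\<omega> \<in> cylinder (cube N) \<delta>" by auto
    then have "f (extend_config N \<delta>) = f \<omega>"
      by (intro local_onD [OF f]) (auto simp: extend_config_Omega cylinder_def, auto simp: extend_config_def)
    then show "\<omega> \<in> f -` B \<inter> Omega" using d by (auto simp: cylinder_def)
  qed
  moreover have "?R \<in> cube_events N" by blast
  ultimately show "f -` B \<inter> space (gibbs lam N) \<in> sets (gibbs lam N)"
    by (simp add: sets_gibbs sigma_sets.Basic)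
qed simp

lemma integral_gibbs:
  fixes f :: "('n::finite) config \<Rightarrow> 'b::{banach, second_countable_topology}"
  assumes f: "local_on (cube N) f"
  shows "(\<integral>\<omega>. f \<omega> \<partial>gibbs lam N) = (\<Sum>\<delta>\<in>cube_configs N. gibbs_prob lam N \<delta> *\<^sub>R f (extend_config N \<delta>))"
proof -
  have "f \<in> borel_measurable (sigma Omega (cube_events N))"
    using local_measurable_gibbs [OF f] by (simp add: gibbs_eq_distr)
  then show ?thesis
    unfolding gibbs_eq_distr
    by (subst integral_distr [OF measurable_extend_config])
      (auto simp: lebesgue_integral_point_measure_finite gibbs_prob)
qed

lemma spin_weight_real: "spin_weight (of_real lam) (\<lambda>_. 0) N \<delta> = of_real (boltzmann lam N \<delta>)"
  unfolding spin_weight_def boltzmann_def energy_def chi_def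
  by (simp flip: exp_of_real)

lemma integral_gibbs_weight_sum:
  fixes f :: "('n::finite) config \<Rightarrow> complex"
  assumes f: "local_on (cube N) f"
  shows "(\<integral>\<omega>. f \<omega> \<partial>gibbs lam N) = weight_sum (of_real lam) (\<lambda>_. 0) N (\<lambda>\<delta>. f (extend_config N \<delta>)) / weight_sum (of_real lam) (\<lambda>_ :: int ^ 'n. 0) N (\<lambda>_. 1)"
proof -
  have Z: "weight_sum (of_real lam) (\<lambda>_ :: int ^ 'n. 0) N (\<lambda>_. 1) = of_real (partition_sum TYPE('n) lam N)"
    by (simp add: weight_sum_def spin_weight_real partition_sum_def)
  show ?thesis
    unfolding integral_gibbs [OF f] Z unfolding weight_sum_def
    by (simp add: sum_divide_distrib gibbs_prob_def spin_weight_real scaleR_conv_of_real mult_ac)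
qed

lemma spin_prod_chi: "complex_of_real (spin_prod T \<omega>) = chi T \<omega>"
  by (simp add: spin_prod_def spin_def chi_eq_of_real)

lemma integral_gibbs_chi:
  assumes "T \<subseteq> cube N"
  shows "(\<integral>\<omega>. chi T \<omega> \<partial>gibbs lam N) = corr (of_real lam) (\<lambda>_. 0) N T"
proof -
  have l: "local_on (cube N) (chi T)"
    using assms by (auto simp: local_on_def intro!: chi_cong)
  have "chi T (extend_config N \<delta>) = chi T \<delta>" for \<delta>
    by (rule chi_cong) (use assms in \<open>auto simp: extend_config_def\<close>)
  then show ?thesis
    using assms by (simp add: integral_gibbs_weight_sum [OF l] corr_def)
qed

lemma integral_gibbs_spin_prod:
  "T \<subseteq> cube N \<Longrightarrow> complex_of_real (\<integral>\<omega>. spin_prod T \<omega> \<partial>gibbs lam N) = corr (of_real lam) (\<lambda>_. 0) N T"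
  using integral_gibbs_chi [of T N lam] by (simp flip: spin_prod_chi)

lemma cylinder_in_gibbs:
  assumes "T \<subseteq> cube N"
  shows "cylinder T a \<in> sets (gibbs lam N)"
proof -
  have l: "local_on (cube N) (\<lambda>\<omega>. \<omega> \<in> cylinder T a)"
    unfolding local_on_def
  proof (intro ballI impI)
    fix \<omega> \<omega>' :: "int ^ 'a \<Rightarrow> real"
    assume w: "\<omega> \<in> Omega" "\<omega>' \<in> Omega" "\<forall>t\<in>cube N. \<omega> t = \<omega>' t"
    then have "\<omega> t = \<omega>' t" if "t \<in> T" for t using that assms by blast
    then show "(\<omega> \<in> cylinder T a) = (\<omega>' \<in> cylinder T a)"
      using w(1,2) by (simp add: cylinder_def)
  qed
  have "(\<lambda>\<omega>. if \<omega> \<in> cylinder T a then 1 else 0::real) \<in> borel_measurable (gibbs lam N)"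
    using local_on_comp [OF l, of "\<lambda>b. if b then 1 else 0"] by (rule local_measurable_gibbs)
  then have "(\<lambda>\<omega>. if \<omega> \<in> cylinder T a then 1 else 0::real) -` {1} \<inter> space (gibbs lam N) \<in> sets (gibbs lam N)"
    by (rule measurable_sets) simp
  also have "(\<lambda>\<omega>. if \<omega> \<in> cylinder T a then 1 else 0::real) -` {1} \<inter> space (gibbs lam N) = cylinder T a"
    by (auto simp: cylinder_def split: if_splits)
  finally show ?thesis .
qed

text \<open>A local function is a finite combination of indicators of cylinders.\<close>

lemma integral_local:
  fixes f :: "('n::finite) config \<Rightarrow> 'b::{banach, second_countable_topology}"
  assumes M: "prob_space M" "space M = Omega" "\<And>a. cylinder T a \<in> sets M" and T: "finite T"
    and f: "local_on T f"
  shows "f \<in> borel_measurable M" "integrable M f"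
    and "(\<integral>\<omega>. f \<omega> \<partial>M) = (\<Sum>a\<in>T \<rightarrow>\<^sub>E {-1, 1}. measure M (cylinder T a) *\<^sub>R f (\<lambda>t. if t \<in> T then a t else 1))"
proof -
  interpret prob_space M by fact
  let ?e = "\<lambda>a. f (\<lambda>t. if t \<in> T then a t else 1)"
  let ?g = "\<lambda>\<omega>. \<Sum>a\<in>T \<rightarrow>\<^sub>E {-1, 1}. indicator (cylinder T a) \<omega> *\<^sub>R ?e a"
  have fg: "f \<omega> = ?g \<omega>" if w: "\<omega> \<in> space M" for \<omega>
  proof -
    have wO: "\<omega> \<in> Omega" using w M by simp
    have r: "restrict \<omega> T \<in> T \<rightarrow>\<^sub>E {-1, 1}" using wO by (auto simp: Omega_def)
    have "?g \<omega> = (\<Sum>a\<in>T \<rightarrow>\<^sub>E {-1, 1}. if a = restrict \<omega> T then ?e a else 0)"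
    proof (rule sum.cong [OF refl])
      fix a assume a: "a \<in> T \<rightarrow>\<^sub>E {-1, 1::real}"
      have "\<omega> \<in> cylinder T a \<longleftrightarrow> a = restrict \<omega> T"
        using a wO by (auto simp: cylinder_def fun_eq_iff PiE_def extensional_def restrict_def)
      then show "indicator (cylinder T a) \<omega> *\<^sub>R ?e a = (if a = restrict \<omega> T then ?e a else 0)"
        by (auto simp: indicator_def)
    qed
    also have "\<dots> = ?e (restrict \<omega> T)"
      using r by (subst sum.delta [OF finite_sign_configs [OF T]]) auto
    also have "\<dots> = f \<omega>"
      using wO by (intro local_onD [OF f]) (auto simp: Omega_def)
    finally show ?thesis by simp
  qed
  have int: "integrable M ?g"
    by (intro Bochner_Integration.integrable_sum integrable_scaleR_left integrable_real_indicator M)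
      (simp add: emeasure_eq_measure)
  show "integrable M f"
    using int fg by (subst Bochner_Integration.integrable_cong [OF refl]) auto
  then show "f \<in> borel_measurable M" by auto
  have "(\<integral>\<omega>. f \<omega> \<partial>M) = (\<integral>\<omega>. ?g \<omega> \<partial>M)"
    by (rule Bochner_Integration.integral_cong [OF refl fg])
  also have "\<dots> = (\<Sum>a\<in>T \<rightarrow>\<^sub>E {-1, 1}. measure M (cylinder T a) *\<^sub>R ?e a)"
    using M(3) sets.sets_into_space [OF M(3)]
    by (subst Bochner_Integration.integral_sum)
      (auto intro!: integrable_scaleR_left integrable_real_indicator sum.cong simp: emeasure_eq_measure Int_absorb2)
  finally show "(\<integral>\<omega>. f \<omega> \<partial>M) = (\<Sum>a\<in>T \<rightarrow>\<^sub>E {-1, 1}. measure M (cylinder T a) *\<^sub>R ?e a)" .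
qed

section \<open>Thermodynamic limit of the correlations\<close>

lemma finite_subset_cube:
  assumes "finite (T :: (int ^ 'n::finite) set)"
  obtains M where "T \<subseteq> cube M"
proof -
  have "\<exists>M. T \<subseteq> cube M" using assms
  proof induction
    case (insert t T)
    then obtain M where M: "T \<subseteq> cube M" by auto
    have "t \<in> cube (nat (ldist t 0))"
      using ldist_cube [of 0 0 t "nat (ldist t 0)"] ldist_nonneg [of t 0] by simp
    then have "insert t T \<subseteq> cube (max M (nat (ldist t 0)))"
      using M cube_mono [of M "max M (nat (ldist t 0))"] cube_mono [of "nat (ldist t 0)" "max M (nat (ldist t 0))"] by auto
    then show ?case by blast
  qed simp
  then show thesis using that by blast
qed

lemma eventually_subset_cube: "finite T \<Longrightarrow> eventually (\<lambda>N. T \<subseteq> cube N) sequentially"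
  by (metis finite_subset_cube cube_mono eventually_sequentiallyI subset_trans)

definition corr_lim :: "complex \<Rightarrow> (int ^ 'n::finite) set \<Rightarrow> complex" where
  "corr_lim lam T = lim (\<lambda>N. corr lam (\<lambda>_. 0) N T)"

lemma kappa0_power_tendsto: "(\<lambda>n. c * kappa0 TYPE('n::finite) ^ n) \<longlonglongrightarrow> 0"
  using kappa0_bounds [where 'n = 'n] by (intro tendsto_mult_right_zero LIMSEQ_realpow_zero) auto

lemma corr_lim:
  fixes T :: "(int ^ 'n::finite) set"
  assumes lam: "norm lam \<le> rad0 TYPE('n)" and T: "finite T"
  shows "(\<lambda>N. corr lam (\<lambda>_. 0) N T) \<longlonglongrightarrow> corr_lim lam T"
proof -
  obtain M where M: "T \<subseteq> cube M" using finite_subset_cube [OF T] .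
  have "Cauchy (\<lambda>N. corr lam (\<lambda>_. 0) N T)"
  proof (rule metric_CauchyI)
    fix e :: real assume "0 < e"
    then have "eventually (\<lambda>n. 2 * kappa0 TYPE('n) ^ n < e) sequentially"
      using order_tendstoD(2) [OF kappa0_power_tendsto [where 'n = 'n, of 2]] by simp
    then obtain n where n: "2 * kappa0 TYPE('n) ^ n < e" by (auto simp: eventually_sequentially)
    have "dist (corr lam (\<lambda>_. 0) N T) (corr lam (\<lambda>_. 0) N' T) < e" if "N \<ge> M + n" "N' \<ge> M + n" for N N'
      using corr_volume_dependence [OF high_temp_zero_field [OF lam] M that] n by (simp add: dist_norm)
    then show "\<exists>K. \<forall>N\<ge>K. \<forall>N'\<ge>K. dist (corr lam (\<lambda>_. 0) N T) (corr lam (\<lambda>_. 0) N' T) < e" by blast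
  qed
  then show ?thesis by (simp add: Cauchy_convergent_iff convergent_LIMSEQ_iff corr_lim_def)
qed

lemma corr_lim_empty:
  "norm lam \<le> rad0 TYPE('n::finite) \<Longrightarrow> corr_lim lam ({} :: (int ^ 'n) set) = 1"
  using corr_lim [of lam "{} :: (int ^ 'n) set"] by (simp add: corr_empty high_temp_zero_field LIMSEQ_const_iff)

lemma corr_lim_pair_decay:
  assumes "norm lam \<le> rad0 TYPE('n::finite)" "s \<noteq> (t :: int ^ 'n)"
  shows "norm (corr_lim lam {s, t}) \<le> kappa0 TYPE('n) ^ nat (ldist s t)"
  using corr_pair_decay [OF assms] by (intro Lim_norm_ubound [OF _ corr_lim [OF assms(1)]]) auto

lemma partition_on_singleton: "{P. partition_on {..<Suc 0} P} = {{{0}}}"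
proof (intro set_eqI iffI)
  fix P :: "nat set set" assume "P \<in> {P. partition_on {..<Suc 0} P}"
  then have P: "\<Union>P = {0}" "{} \<notin> P" by (auto simp: partition_on_def)
  then have "S = {0}" if "S \<in> P" for S using that by (metis Union_upper subset_singletonD)
  then show "P \<in> {{{0}}}" using P by auto
next
  fix P :: "nat set set" assume "P \<in> {{{0}}}"
  then show "P \<in> {P. partition_on {..<Suc 0} P}" by (auto simp: partition_on_def)
qed

text \<open>The semi-invariant of a single variable is its expectation, so the limits that define \<open>limit_corr\<close> are
  those of the finite volume correlations.\<close>

lemma limit_corr_tendsto:
  fixes T :: "(int ^ 'n::finite) set"
  assumes lam: "\<bar>lam\<bar> \<le> rad0 TYPE('n)" and T: "finite T"
  shows "(\<lambda>N. \<integral>\<omega>. spin_prod T \<omega> \<partial>gibbs lam N) \<longlonglongrightarrow> limit_corr lam T"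
    and "complex_of_real (limit_corr lam T) = corr_lim (of_real lam) T"
proof -
  have "semi_inv (gibbs lam N) [spin_prod T] = (\<integral>\<omega>. spin_prod T \<omega> \<partial>gibbs lam N)" for N
    by (simp add: semi_inv_def partition_on_singleton)
  then have lc: "limit_corr lam T = lim (\<lambda>N. \<integral>\<omega>. spin_prod T \<omega> \<partial>gibbs lam N)"
    by (simp add: limit_corr_def)
  have "(\<lambda>N. corr (of_real lam) (\<lambda>_. 0) N T) \<longlonglongrightarrow> corr_lim (of_real lam) T"
    by (rule corr_lim) (use lam T in auto)
  then have c: "(\<lambda>N. complex_of_real (\<integral>\<omega>. spin_prod T \<omega> \<partial>gibbs lam N)) \<longlonglongrightarrow> corr_lim (of_real lam) T"
    by (rule Lim_transform_eventually)
      (use eventually_subset_cube [OF T] in \<open>auto elim!: eventually_mono simp: integral_gibbs_spin_prod\<close>)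
  from tendsto_Re [OF this] have r: "(\<lambda>N. \<integral>\<omega>. spin_prod T \<omega> \<partial>gibbs lam N) \<longlonglongrightarrow> Re (corr_lim (of_real lam) T)"
    by simp
  then have l: "limit_corr lam T = Re (corr_lim (of_real lam) T)" unfolding lc by (rule limI)
  then show "(\<lambda>N. \<integral>\<omega>. spin_prod T \<omega> \<partial>gibbs lam N) \<longlonglongrightarrow> limit_corr lam T" using r by simp
  show "complex_of_real (limit_corr lam T) = corr_lim (of_real lam) T"
    using LIMSEQ_unique [OF c tendsto_of_real [OF r]] l by simp
qed

text \<open>The prescribed probability of \<open>cylinder T a\<close>.\<close>

definition cyl_prob :: "real \<Rightarrow> (int ^ 'n::finite) set \<Rightarrow> (int ^ 'n \<Rightarrow> real) \<Rightarrow> real" where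
  "cyl_prob lam T a = (-1) ^ card {t \<in> T. a t = -1} / 2 ^ card T *
          (\<Sum>T'\<in>Pow T. limit_corr lam T' * (\<Prod>t\<in>T - T'. a t))"

lemma sign_prod:
  fixes a :: "'v \<Rightarrow> real"
  assumes "finite T" "\<And>t. t \<in> T \<Longrightarrow> a t \<in> {-1, 1}"
  shows "(-1) ^ card {t \<in> T. a t = -1} = (\<Prod>t\<in>T. a t)"
proof -
  have "(\<Prod>t\<in>T. a t) = (\<Prod>t\<in>T. if a t = -1 then -1 else 1)"
    by (rule prod.cong) (use assms(2) in auto)
  also have "\<dots> = (-1) ^ card {t \<in> T. a t = -1}"
    using assms(1) by (simp add: prod.If_cases Int_def)
  finally show ?thesis by simp
qed

lemma cylinder_subset: "cylinder T a \<subseteq> Omega"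
  by (auto simp: cylinder_def)

text \<open>The indicator is \<open>\<Prod>t\<in>T. (1 + a t * \<omega> t) / 2\<close>; expanding the product gives the sum over subsets.\<close>

lemma indicator_cylinder:
  fixes T :: "(int ^ 'n::finite) set"
  assumes T: "finite T" and a: "a \<in> T \<rightarrow> {-1, 1}" and w: "\<omega> \<in> Omega"
  shows "indicator (cylinder T a) \<omega> = (-1) ^ card {t \<in> T. a t = -1} / 2 ^ card T *
          (\<Sum>T'\<in>Pow T. spin_prod T' \<omega> * (\<Prod>t\<in>T - T'. a t))" (is "_ = ?R")
proof -
  have av: "a t \<in> {-1, 1}" if "t \<in> T" for t using a that by auto
  have aa: "(\<Prod>t\<in>T. a t) * (\<Prod>t\<in>T - T'. a t) = (\<Prod>t\<in>T'. a t)" if "T' \<subseteq> T" for T'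
  proof -
    have "(\<Prod>t\<in>T. a t) = (\<Prod>t\<in>T'. a t) * (\<Prod>t\<in>T - T'. a t)"
      using T that by (metis prod.subset_diff mult.commute)
    moreover have "(\<Prod>t\<in>T - T'. a t) * (\<Prod>t\<in>T - T'. a t) = 1"
      unfolding prod.distrib [symmetric] by (rule prod.neutral) (use av in fastforce)
    ultimately show ?thesis by (simp add: mult.assoc)
  qed
  have "?R = (\<Sum>T'\<in>Pow T. spin_prod T' \<omega> * (\<Prod>t\<in>T'. a t)) / 2 ^ card T"
    using aa by (simp add: sign_prod [OF T av] sum_distrib_left sum_divide_distrib)
      (auto intro!: sum.cong simp: mult_ac)
  moreover have "complex_of_real (\<Sum>T'\<in>Pow T. spin_prod T' \<omega> * (\<Prod>t\<in>T'. a t)) = (\<Sum>T'\<in>Pow T. chi T' \<omega> * chi T' a)"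
    by (simp add: spin_prod_chi chi_eq_of_real)
  moreover have "\<dots> = (if \<forall>s\<in>T. \<omega> s = a s then 2 ^ card T else 0)"
    by (rule walsh_kernel [OF T]) (use w av in \<open>auto simp: Omega_def\<close>)
  moreover have "\<dots> = complex_of_real (if \<forall>s\<in>T. \<omega> s = a s then 2 ^ card T else 0)" by simp
  ultimately have "?R = (if \<forall>s\<in>T. \<omega> s = a s then 2 ^ card T else 0) / 2 ^ card T"
    by (metis (no_types, lifting) of_real_eq_iff)
  then show ?thesis using w by (simp add: cylinder_def indicator_def)
qed

text \<open>This identifies the prescribed cylinder probabilities as limits of probabilities. Positivity and
  consistency are inherited from the finite volume measures.\<close>

lemma cyl_prob_tendsto:
  fixes T :: "(int ^ 'n::finite) set"
  assumes lam: "\<bar>lam\<bar> \<le> rad0 TYPE('n)" and T: "finite T" and a: "a \<in> T \<rightarrow> {-1, 1}"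
  shows "(\<lambda>N. measure (gibbs lam N) (cylinder T a)) \<longlonglongrightarrow> cyl_prob lam T a"
proof -
  have "(\<lambda>N. (-1) ^ card {t \<in> T. a t = -1} / 2 ^ card T *
          (\<Sum>T'\<in>Pow T. (\<integral>\<omega>. spin_prod T' \<omega> \<partial>gibbs lam N) * (\<Prod>t\<in>T - T'. a t))) \<longlonglongrightarrow> cyl_prob lam T a"
    unfolding cyl_prob_def
    by (intro tendsto_intros limit_corr_tendsto(1) lam) (use T in \<open>auto intro: finite_subset\<close>)
  moreover have "eventually (\<lambda>N. (-1) ^ card {t \<in> T. a t = -1} / 2 ^ card T *
          (\<Sum>T'\<in>Pow T. (\<integral>\<omega>. spin_prod T' \<omega> \<partial>gibbs lam N) * (\<Prod>t\<in>T - T'. a t)) = measure (gibbs lam N) (cylinder T a)) sequentially"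
    using eventually_subset_cube [OF T]
  proof eventually_elim
    case (elim N)
    interpret prob_space "gibbs lam N :: 'n config measure" by (rule prob_space_gibbs)
    have int: "integrable (gibbs lam N) (spin_prod T')" if "T' \<in> Pow T" for T' :: "(int ^ 'n) set"
      using integral_local(2) [OF prob_space_gibbs space_gibbs cylinder_in_gibbs _ local_on_spin_prod, of T' N lam] that elim T
      by (auto intro: finite_subset)
    have "measure (gibbs lam N) (cylinder T a) = (\<integral>\<omega>. indicator (cylinder T a) \<omega> \<partial>gibbs lam N)"
      by (simp add: Int_absorb2 cylinder_subset)
    also have "\<dots> = (\<integral>\<omega>. (-1) ^ card {t \<in> T. a t = -1} / 2 ^ card T *
          (\<Sum>T'\<in>Pow T. spin_prod T' \<omega> * (\<Prod>t\<in>T - T'. a t)) \<partial>gibbs lam N)"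
      by (rule Bochner_Integration.integral_cong [OF refl]) (use indicator_cylinder [OF T a] in auto)
    also have "\<dots> = (-1) ^ card {t \<in> T. a t = -1} / 2 ^ card T *
          (\<Sum>T'\<in>Pow T. (\<integral>\<omega>. spin_prod T' \<omega> \<partial>gibbs lam N) * (\<Prod>t\<in>T - T'. a t))"
      using int by simp
    finally show ?case by simp
  qed
  ultimately show ?thesis by (rule Lim_transform_eventually)
qed

section \<open>The limiting measure\<close>

lemma cyl_prob_nonneg:
  fixes T :: "(int ^ 'n::finite) set"
  assumes "\<bar>lam\<bar> \<le> rad0 TYPE('n)" "finite T" "a \<in> T \<rightarrow> {-1, 1}"
  shows "0 \<le> cyl_prob lam T a"
  by (rule LIMSEQ_le_const [OF cyl_prob_tendsto [OF assms]]) auto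

lemma cyl_prob_cong:
  assumes "\<And>t. t \<in> T \<Longrightarrow> a t = b t"
  shows "cyl_prob lam T a = cyl_prob lam T b"
proof -
  have "{t \<in> T. a t = -1} = {t \<in> T. b t = -1}" using assms by auto
  moreover have "(\<Prod>t\<in>T - T'. a t) = (\<Prod>t\<in>T - T'. b t)" for T'
    by (rule prod.cong) (use assms in auto)
  ultimately show ?thesis by (simp add: cyl_prob_def)
qed

lemma cyl_prob_empty: "\<bar>lam\<bar> \<le> rad0 TYPE('n::finite) \<Longrightarrow> cyl_prob lam ({} :: (int ^ 'n) set) a = 1"
  using limit_corr_tendsto(2) [of lam "{} :: (int ^ 'n) set"] corr_lim_empty [where 'n = 'n, of lam]
  by (simp add: cyl_prob_def)

text \<open>In a large cube the cylinder over \<open>J\<close> is the disjoint union of the cylinders over \<open>H\<close> that refine it.\<close>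

lemma cyl_prob_marginal:
  fixes H :: "(int ^ 'n::finite) set"
  assumes lam: "\<bar>lam\<bar> \<le> rad0 TYPE('n)" and H: "finite H" "J \<subseteq> H" and a: "a \<in> J \<rightarrow>\<^sub>E {-1, 1}"
  shows "cyl_prob lam J a = (\<Sum>b | b \<in> H \<rightarrow>\<^sub>E {-1, 1} \<and> restrict b J = a. cyl_prob lam H b)"
proof (rule LIMSEQ_unique)
  let ?B = "{b. b \<in> H \<rightarrow>\<^sub>E {-1, 1} \<and> restrict b J = a}"
  have fB: "finite ?B" by (rule finite_subset [OF _ finite_sign_configs [OF H(1)]]) auto
  show "(\<lambda>N. measure (gibbs lam N) (cylinder J a)) \<longlonglongrightarrow> cyl_prob lam J a"
    by (rule cyl_prob_tendsto [OF lam]) (use H a finite_subset in auto)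
  have "(\<lambda>N. \<Sum>b\<in>?B. measure (gibbs lam N) (cylinder H b)) \<longlonglongrightarrow> (\<Sum>b\<in>?B. cyl_prob lam H b)"
    by (intro tendsto_sum cyl_prob_tendsto lam H) auto
  moreover have "eventually (\<lambda>N. (\<Sum>b\<in>?B. measure (gibbs lam N) (cylinder H b)) = measure (gibbs lam N) (cylinder J a)) sequentially"
    using eventually_subset_cube [OF H(1)]
  proof eventually_elim
    case (elim N)
    interpret prob_space "gibbs lam N :: 'n config measure" by (rule prob_space_gibbs)
    have "cylinder J a = (\<Union>b\<in>?B. cylinder H b)"
    proof (intro set_eqI iffI)
      fix \<omega> assume w: "\<omega> \<in> cylinder J a"
      then have "restrict \<omega> H \<in> ?B" using H(2) a
        by (auto simp: cylinder_def Omega_def fun_eq_iff PiE_def extensional_def restrict_def)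
      moreover have "\<omega> \<in> cylinder H (restrict \<omega> H)" using w by (simp add: cylinder_def)
      ultimately show "\<omega> \<in> (\<Union>b\<in>?B. cylinder H b)" by blast
    next
      fix \<omega> assume "\<omega> \<in> (\<Union>b\<in>?B. cylinder H b)"
      then obtain b where b: "restrict b J = a" "\<omega> \<in> cylinder H b" by auto
      then show "\<omega> \<in> cylinder J a" using H(2) by (auto simp: cylinder_def)
    qed
    moreover have "disjoint_family_on (\<lambda>b. cylinder H b) ?B"
      unfolding disjoint_family_on_def
    proof (intro ballI impI)
      fix b b' assume b: "b \<in> ?B" "b' \<in> ?B" "b \<noteq> b'"
      then obtain t where "t \<in> H" "b t \<noteq> b' t" by (auto simp: PiE_def extensional_def fun_eq_iff) metis
      then show "cylinder H b \<inter> cylinder H b' = {}" by (auto simp: cylinder_def)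
    qed
    ultimately show ?case
      using finite_measure_finite_Union [OF fB, of "\<lambda>b. cylinder H b"] cylinder_in_gibbs [OF elim]
      by (simp add: image_subset_iff)
  qed
  ultimately show "(\<lambda>N. measure (gibbs lam N) (cylinder J a)) \<longlonglongrightarrow> (\<Sum>b\<in>?B. cyl_prob lam H b)"
    by (rule Lim_transform_eventually)
qed

text \<open>The law of the spins in \<open>J\<close>, as a Borel measure on real valued functions; in this form it is a
  projective family of Borel measures on powers of a Polish space.\<close>

definition marginal :: "real \<Rightarrow> (int ^ 'n::finite) set \<Rightarrow> (int ^ 'n \<Rightarrow> real) measure" where
  "marginal lam J = distr (point_measure (J \<rightarrow>\<^sub>E {-1, 1}) (\<lambda>a. ennreal (cyl_prob lam J a))) (PiM J (\<lambda>_. borel)) (\<lambda>a. a)"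

lemma sets_marginal: "sets (marginal lam J) = sets (PiM J (\<lambda>_. borel))"
  and space_marginal: "space (marginal lam J) = space (PiM J (\<lambda>_. borel))"
  by (simp_all add: marginal_def)

lemma emeasure_marginal:
  assumes J: "finite J" and A: "A \<in> sets (PiM J (\<lambda>_. borel))"
  shows "emeasure (marginal lam J) A = (\<Sum>a | a \<in> J \<rightarrow>\<^sub>E {-1, 1} \<and> a \<in> A. ennreal (cyl_prob lam J a))"
proof -
  have m: "(\<lambda>a. a) \<in> measurable (point_measure (J \<rightarrow>\<^sub>E {-1, 1}) (\<lambda>a. ennreal (cyl_prob lam J a))) (PiM J (\<lambda>_. borel))"
    by (auto simp: measurable_def space_point_measure sets_point_measure space_PiM PiE_def)
  have "emeasure (marginal lam J) A = emeasure (point_measure (J \<rightarrow>\<^sub>E {-1, 1}) (\<lambda>a. ennreal (cyl_prob lam J a))) {a. a \<in> J \<rightarrow>\<^sub>E {-1, 1} \<and> a \<in> A}"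
    unfolding marginal_def using emeasure_distr [OF m A]
    by (simp add: space_point_measure) (auto intro!: arg_cong2 [of _ _ _ _ emeasure])
  also have "\<dots> = (\<Sum>a | a \<in> J \<rightarrow>\<^sub>E {-1, 1} \<and> a \<in> A. ennreal (cyl_prob lam J a))"
    by (rule emeasure_point_measure_finite) (use J in auto)
  finally show ?thesis .
qed

lemma marginal_projective:
  assumes lam: "\<bar>lam\<bar> \<le> rad0 TYPE('n::finite)"
  shows "polish_projective (UNIV :: (int ^ 'n) set) (marginal lam)"
proof (intro polish_projective.intro projective_family.intro)
  fix J H :: "(int ^ 'n) set" assume JH: "J \<subseteq> H" "finite H"
  have fJ: "finite J" using JH finite_subset by auto
  have m: "(\<lambda>f. restrict f J) \<in> measurable (marginal lam H) (PiM J (\<lambda>_. borel))"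
    using measurable_restrict_subset [OF JH(1)] by (simp add: measurable_cong_sets [OF sets_marginal refl])
  show "marginal lam J = distr (marginal lam H) (PiM J (\<lambda>_. borel)) (\<lambda>f. restrict f J)"
  proof (rule measure_eqI)
    fix A assume "A \<in> sets (marginal lam J)"
    then have A: "A \<in> sets (PiM J (\<lambda>_. borel))" by (simp add: sets_marginal)
    let ?S = "{b. b \<in> H \<rightarrow>\<^sub>E {-1, 1} \<and> restrict b J \<in> A}"
    let ?T = "{a. a \<in> J \<rightarrow>\<^sub>E {-1, 1} \<and> a \<in> A}"
    have fS: "finite ?S" by (rule finite_subset [OF _ finite_sign_configs [OF JH(2)]]) auto
    have fT: "finite ?T" by (rule finite_subset [OF _ finite_sign_configs [OF fJ]]) auto
    have "emeasure (distr (marginal lam H) (PiM J (\<lambda>_. borel)) (\<lambda>f. restrict f J)) A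
        = emeasure (marginal lam H) ((\<lambda>f. restrict f J) -` A \<inter> space (PiM H (\<lambda>_. borel)))"
      using emeasure_distr [OF m A] by (simp add: space_marginal)
    also have "\<dots> = (\<Sum>b | b \<in> H \<rightarrow>\<^sub>E {-1, 1} \<and> b \<in> (\<lambda>f. restrict f J) -` A \<inter> space (PiM H (\<lambda>_. borel)). ennreal (cyl_prob lam H b))"
      using measurable_sets [OF m A] by (intro emeasure_marginal JH) (simp add: sets_marginal space_marginal)
    also have "\<dots> = (\<Sum>b\<in>?S. ennreal (cyl_prob lam H b))"
      by (rule sum.cong) (auto simp: space_PiM PiE_def)
    also have "\<dots> = (\<Sum>a\<in>?T. \<Sum>b | b \<in> ?S \<and> restrict b J = a. ennreal (cyl_prob lam H b))"
      by (rule sum.group [symmetric, OF fS fT]) (use JH in auto)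
    also have "\<dots> = (\<Sum>a\<in>?T. ennreal (cyl_prob lam J a))"
    proof (rule sum.cong [OF refl])
      fix a assume a: "a \<in> ?T"
      have "(\<Sum>b | b \<in> ?S \<and> restrict b J = a. ennreal (cyl_prob lam H b)) = (\<Sum>b | b \<in> H \<rightarrow>\<^sub>E {-1, 1} \<and> restrict b J = a. ennreal (cyl_prob lam H b))"
        by (rule sum.cong) (use a in auto)
      also have "\<dots> = ennreal (\<Sum>b | b \<in> H \<rightarrow>\<^sub>E {-1, 1} \<and> restrict b J = a. cyl_prob lam H b)"
        by (rule sum_ennreal) (use JH lam in \<open>auto intro!: cyl_prob_nonneg\<close>)
      also have "\<dots> = ennreal (cyl_prob lam J a)"
        using cyl_prob_marginal [OF lam JH(2,1), of a] a by simp
      finally show "(\<Sum>b | b \<in> ?S \<and> restrict b J = a. ennreal (cyl_prob lam H b)) = ennreal (cyl_prob lam J a)" .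
    qed
    also have "\<dots> = emeasure (marginal lam J) A" by (rule emeasure_marginal [symmetric, OF fJ A])
    finally show "emeasure (marginal lam J) A = emeasure (distr (marginal lam H) (PiM J (\<lambda>_. borel)) (\<lambda>f. restrict f J)) A" ..
  qed (simp add: sets_marginal)
next
  fix J :: "(int ^ 'n) set" assume J: "finite J"
  show "prob_space (marginal lam J)"
  proof (rule prob_spaceI)
    have "emeasure (marginal lam J) (space (marginal lam J)) = (\<Sum>a | a \<in> J \<rightarrow>\<^sub>E {-1, 1} \<and> a \<in> space (PiM J (\<lambda>_. borel)). ennreal (cyl_prob lam J a))"
      unfolding space_marginal by (rule emeasure_marginal [OF J]) simp
    also have "\<dots> = (\<Sum>a | a \<in> J \<rightarrow>\<^sub>E {-1, 1} \<and> restrict a {} = (\<lambda>_. undefined). ennreal (cyl_prob lam J a))"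
      by (rule sum.cong) (auto simp: space_PiM PiE_def)
    also have "\<dots> = ennreal (\<Sum>a | a \<in> J \<rightarrow>\<^sub>E {-1, 1} \<and> restrict a {} = (\<lambda>_. undefined). cyl_prob lam J a)"
      by (rule sum_ennreal) (use J lam in \<open>auto intro!: cyl_prob_nonneg\<close>)
    also have "\<dots> = 1"
      using cyl_prob_marginal [OF lam J empty_subsetI, of "\<lambda>_. undefined"] cyl_prob_empty [OF lam] by simp
    finally show "emeasure (marginal lam J) (space (marginal lam J)) = 1" .
  qed
qed

abbreviation cylinders :: "('n::finite) config set set" where
  "cylinders \<equiv> {cylinder T a | T a. finite T \<and> a \<in> T \<rightarrow> {-1, 1}}"

lemma cylinders_subset: "cylinders \<subseteq> Pow Omega"
  by (auto simp: cylinder_def)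

text \<open>Kolmogorov's theorem gives a measure on all real valued functions. It is transported to \<open>Omega\<close> by a map
  that rounds every value other than 1 to \<open>-1\<close>, which changes nothing almost surely.\<close>

lemma limit_measure_exists:
  assumes lam: "\<bar>lam\<bar> \<le> rad0 TYPE('n::finite)"
  shows "\<exists>P :: 'n config measure. prob_space P \<and> space P = Omega \<and> sets P = sigma_sets Omega cylinders \<and>
     (\<forall>T a. finite T \<longrightarrow> a \<in> T \<rightarrow> {-1, 1} \<longrightarrow> measure P (cylinder T a) = cyl_prob lam T a)"
proof -
  interpret polish_projective "UNIV :: (int ^ 'n) set" "marginal lam" by (rule marginal_projective [OF lam])
  \<comment> \<open>the rounding map to \<open>Omega\<close>\<close>
  define pr where "pr = (\<lambda>(\<omega> :: int ^ 'n \<Rightarrow> real) t. if \<omega> t = 1 then 1 else - 1 :: real)"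
  have pre: "pr -` cylinder T a \<inter> space lim = emb UNIV T {f \<in> T \<rightarrow>\<^sub>E (UNIV :: real set). \<forall>t\<in>T. (f t = 1) = (a t = 1)}"
    if "a \<in> T \<rightarrow> {-1, 1}" for T a
  proof -
    have "(if x = 1 then 1 else -1) = a t \<longleftrightarrow> (x = 1) = (a t = 1)" if "t \<in> T" for t and x :: real
    proof -
      have "a t \<in> {-1, 1}" using that \<open>a \<in> T \<rightarrow> {-1, 1}\<close> by auto
      then show ?thesis by auto
    qed
    then show ?thesis
      by (auto simp: prod_emb_def space_lim space_PiM cylinder_def pr_def Omega_def)
  qed
  have S: "{f \<in> T \<rightarrow>\<^sub>E (UNIV :: real set). \<forall>t\<in>T. (f t = 1) = (a t = 1)} \<in> sets (PiM T (\<lambda>_. borel))"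
    if "finite T" for T and a :: "int ^ 'n \<Rightarrow> real"
  proof -
    have "{f \<in> T \<rightarrow>\<^sub>E (UNIV :: real set). \<forall>t\<in>T. (f t = 1) = (a t = 1)} = Pi\<^sub>E T (\<lambda>t. if a t = 1 then {1} else - {1::real})"
    proof -
      have "x \<in> (if a t = 1 then {1} else - {1}) \<longleftrightarrow> (x = 1) = (a t = 1)" for t and x :: real by auto
      then show ?thesis by (auto simp: PiE_def Pi_def)
    qed
    also have "\<dots> \<in> sets (PiM T (\<lambda>_. borel))"
      by (rule sets_PiM_I_finite [OF that]) auto
    finally show ?thesis .
  qed
  have mpr: "pr \<in> measurable lim (sigma Omega cylinders)"
  proof (rule measurable_measure_of [OF cylinders_subset])
    show "pr \<in> space lim \<rightarrow> Omega" by (auto simp: pr_def Omega_def)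
    fix y :: "'n config set" assume "y \<in> cylinders"
    then obtain T a where y: "y = cylinder T a" "finite T" "a \<in> T \<rightarrow> {-1, 1}" by auto
    show "pr -` y \<inter> space lim \<in> sets lim"
      unfolding y(1) pre [OF y(3)] sets_lim by (rule measurable_prod_emb [OF subset_UNIV S [OF y(2)]])
  qed
  define P where "P = distr lim (sigma Omega cylinders) pr"
  have "measure P (cylinder T a) = cyl_prob lam T a" if T: "finite T" and a: "a \<in> T \<rightarrow> {-1, 1}" for T a
  proof -
    have in_sets: "cylinder T a \<in> sets (sigma Omega cylinders)"
      using T a cylinders_subset by (auto simp: sets_measure_of)
    let ?X = "{f \<in> T \<rightarrow>\<^sub>E (UNIV :: real set). \<forall>t\<in>T. (f t = 1) = (a t = 1)}"
    have "measure P (cylinder T a) = measure lim (emb UNIV T ?X)"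
      unfolding P_def measure_distr [OF mpr in_sets] pre [OF a] ..
    also have "\<dots> = measure (marginal lam T) ?X"
      by (rule measure_lim_emb [OF _ T S [OF T]]) simp
    also have "emeasure (marginal lam T) ?X = ennreal (cyl_prob lam T a)"
    proof -
      have "{b. b \<in> T \<rightarrow>\<^sub>E {-1, 1} \<and> b \<in> ?X} = {restrict a T}"
      proof (intro set_eqI iffI)
        fix b assume b: "b \<in> {b. b \<in> T \<rightarrow>\<^sub>E {-1, 1} \<and> b \<in> ?X}"
        have "b t = restrict a T t" for t
        proof (cases "t \<in> T")
          case True
          then have "b t \<in> {-1, 1}" "a t \<in> {-1, 1}" "(b t = 1) = (a t = 1)" using a b by auto
          then show ?thesis using True by auto
        qed (use b in \<open>auto simp: PiE_def extensional_def\<close>)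
        then show "b \<in> {restrict a T}" by auto
      qed (use a in auto)
      then show ?thesis
        using emeasure_marginal [OF T S [OF T]] by (simp add: cyl_prob_cong [of T "restrict a T" a])
    qed
    then have "measure (marginal lam T) ?X = cyl_prob lam T a"
      using cyl_prob_nonneg [OF lam T a] by (simp add: measure_def)
    finally show ?thesis .
  qed
  moreover have "prob_space P" unfolding P_def by (rule P.prob_space_distr [OF mpr])
  moreover have "space P = Omega" "sets P = sigma_sets Omega cylinders"
    by (simp_all add: P_def sets_measure_of [OF cylinders_subset] space_measure_of [OF cylinders_subset])
  ultimately show ?thesis by blast
qed

text \<open>Up to the empty set the cylinders are closed under intersection: two cylinders with a common point
  \<open>\<omega>\<close> meet in the cylinder of \<open>\<omega>\<close> over the union of their base sets.\<close>

lemma limit_measure_unique: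
  fixes P Q :: "('n::finite) config measure"
  assumes P: "prob_space P" "space P = Omega" "sets P = sigma_sets Omega cylinders"
      "\<And>T a. finite T \<Longrightarrow> a \<in> T \<rightarrow> {-1, 1} \<Longrightarrow> measure P (cylinder T a) = p T a"
    and Q: "prob_space Q" "space Q = Omega" "sets Q = sigma_sets Omega cylinders"
      "\<And>T a. finite T \<Longrightarrow> a \<in> T \<rightarrow> {-1, 1} \<Longrightarrow> measure Q (cylinder T a) = p T a"
  shows "P = Q"
proof -
  interpret P: prob_space P by fact
  interpret Q: prob_space Q by fact
  let ?E = "insert {} cylinders :: 'n config set set"
  have sig: "sigma_sets Omega ?E = sigma_sets Omega cylinders"
  proof (rule sigma_sets_eqI)
    show "a \<in> sigma_sets Omega cylinders" if "a \<in> ?E" for a using that by (auto intro: sigma_sets.intros)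
  qed (auto intro: sigma_sets.intros)
  have univ: "cylinder {} (\<lambda>_. 1) = (Omega :: 'n config set)" by (simp add: cylinder_def)
  show ?thesis
  proof (rule measure_eqI_generator_eq [where E = ?E and \<Omega> = Omega and A = "\<lambda>_. Omega"])
    show "Int_stable ?E"
    proof (rule Int_stableI)
      fix A B :: "'n config set" assume AB: "A \<in> ?E" "B \<in> ?E"
      show "A \<inter> B \<in> ?E"
      proof (cases "A \<inter> B = {}")
        case False
        then have "A \<in> cylinders" "B \<in> cylinders" using AB by auto
        then obtain T a T' a' where A: "A = cylinder T a" "finite T" "a \<in> T \<rightarrow> {-1, 1}"
          and B: "B = cylinder T' a'" "finite T'" "a' \<in> T' \<rightarrow> {-1, 1}" by blast
        obtain \<omega> where w: "\<omega> \<in> A" "\<omega> \<in> B" using False by auto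
        have "A \<inter> B = cylinder (T \<union> T') \<omega>" using w A B by (auto simp: cylinder_def)
        moreover have "\<omega> \<in> T \<union> T' \<rightarrow> {-1, 1}" using w A by (auto simp: cylinder_def Omega_def)
        ultimately show ?thesis using A B by blast
      qed simp
    qed
    show "?E \<subseteq> Pow Omega" using cylinders_subset by auto
    show "emeasure P X = emeasure Q X" if "X \<in> ?E" for X
      using that P(4) Q(4) by (auto simp: P.emeasure_eq_measure Q.emeasure_eq_measure)
    show "sets P = sigma_sets Omega ?E" "sets Q = sigma_sets Omega ?E" using P Q sig by simp_all
    have "Omega \<in> (cylinders :: 'n config set set)"
      unfolding univ [symmetric] by (rule CollectI, rule exI [of _ "{}"]) auto
    then show "range (\<lambda>_. Omega) \<subseteq> ?E" by auto
    show "(\<Union>i::nat. Omega) = Omega" by auto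
    show "emeasure P Omega \<noteq> \<infinity>" for i :: nat by simp
  qed
qed

lemma limit_measure:
  assumes lam: "\<bar>lam\<bar> \<le> rad0 TYPE('n::finite)"
  shows "prob_space (limit_measure lam :: 'n config measure)"
    and "space (limit_measure lam :: 'n config measure) = Omega"
    and "sets (limit_measure lam :: 'n config measure) = sigma_sets Omega cylinders"
    and "\<And>(T :: (int ^ 'n) set) a. finite T \<Longrightarrow> a \<in> T \<rightarrow> {-1, 1} \<Longrightarrow> measure (limit_measure lam) (cylinder T a) = cyl_prob lam T a"
proof -
  let ?Q = "\<lambda>P :: 'n config measure. prob_space P \<and> space P = Omega \<and> sets P = sigma_sets Omega cylinders \<and>
     (\<forall>T a. finite T \<longrightarrow> a \<in> T \<rightarrow> {-1, 1} \<longrightarrow> measure P (cylinder T a) = cyl_prob lam T a)"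
  obtain P where P: "?Q P" using limit_measure_exists [OF lam] by blast
  have uq: "Q = P" if Q: "?Q Q" for Q
  proof (rule limit_measure_unique [where p = "cyl_prob lam"])
    show "prob_space Q" "space Q = Omega" "sets Q = sigma_sets Omega cylinders"
      "prob_space P" "space P = Omega" "sets P = sigma_sets Omega cylinders" using P Q by simp_all
  qed (use P Q in simp_all)
  have "(THE P. ?Q P) = P" by (rule the_equality [of ?Q, OF P uq])
  moreover have "limit_measure lam = (THE P. ?Q P)"
    unfolding limit_measure_def cyl_prob_def ..
  ultimately have eq: "limit_measure lam = P" by (simp only:)
  have "?Q (limit_measure lam)" unfolding eq by (rule P)
  then show "prob_space (limit_measure lam :: 'n config measure)"
    "space (limit_measure lam :: 'n config measure) = Omega"
    "sets (limit_measure lam :: 'n config measure) = sigma_sets Omega cylinders"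
    "\<And>(T :: (int ^ 'n) set) a. finite T \<Longrightarrow> a \<in> T \<rightarrow> {-1, 1} \<Longrightarrow> measure (limit_measure lam) (cylinder T a) = cyl_prob lam T a"
    by blast+
qed

lemma cylinder_in_limit_measure:
  assumes lam: "\<bar>lam\<bar> \<le> rad0 TYPE('n::finite)" and T: "finite (T :: (int ^ 'n) set)"
  shows "cylinder T a \<in> sets (limit_measure lam)"
proof (cases "a \<in> T \<rightarrow> {-1, 1}")
  case True
  then show ?thesis using T unfolding limit_measure(3) [OF lam] by (intro sigma_sets.Basic) blast
next
  case False
  then obtain t where t: "t \<in> T" "a t \<notin> {-1, 1}" by auto
  then have "\<omega> \<notin> cylinder T a" for \<omega>
    unfolding cylinder_def Omega_def mem_Collect_eq by metis
  then have "cylinder T a = {}" by auto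
  then show ?thesis by simp
qed

text \<open>Expectations of local functions are finite combinations of cylinder probabilities, so they are limits of
  finite volume expectations.\<close>

lemma limit_measure_local:
  fixes f :: "('n::finite) config \<Rightarrow> 'b::{banach, second_countable_topology}"
  assumes lam: "\<bar>lam\<bar> \<le> rad0 TYPE('n)" and T: "finite T" and f: "local_on T f"
  shows "f \<in> borel_measurable (limit_measure lam)" "integrable (limit_measure lam) f"
    and "(\<lambda>N. \<integral>\<omega>. f \<omega> \<partial>gibbs lam N) \<longlonglongrightarrow> (\<integral>\<omega>. f \<omega> \<partial>limit_measure lam)"
proof -
  note * = integral_local [OF limit_measure(1,2) [OF lam] cylinder_in_limit_measure [OF lam T] T f]
  show "f \<in> borel_measurable (limit_measure lam)" "integrable (limit_measure lam) f" by (rule *)+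
  let ?e = "\<lambda>a. f (\<lambda>t. if t \<in> T then a t else 1)"
  have "(\<lambda>N. \<Sum>a\<in>T \<rightarrow>\<^sub>E {-1, 1}. measure (gibbs lam N) (cylinder T a) *\<^sub>R ?e a) \<longlonglongrightarrow> (\<Sum>a\<in>T \<rightarrow>\<^sub>E {-1, 1}. cyl_prob lam T a *\<^sub>R ?e a)"
    by (intro tendsto_intros cyl_prob_tendsto lam T) auto
  moreover have "(\<Sum>a\<in>T \<rightarrow>\<^sub>E {-1, 1}. cyl_prob lam T a *\<^sub>R ?e a) = (\<integral>\<omega>. f \<omega> \<partial>limit_measure lam)"
    unfolding *
  proof (rule sum.cong [OF refl])
    fix a assume "a \<in> T \<rightarrow>\<^sub>E {-1, 1::real}"
    then have "a \<in> T \<rightarrow> {-1, 1}" by auto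
    then show "cyl_prob lam T a *\<^sub>R ?e a = measure (limit_measure lam) (cylinder T a) *\<^sub>R ?e a"
      by (simp add: limit_measure(4) [OF lam T])
  qed
  moreover have "eventually (\<lambda>N. (\<Sum>a\<in>T \<rightarrow>\<^sub>E {-1, 1}. measure (gibbs lam N) (cylinder T a) *\<^sub>R ?e a) = (\<integral>\<omega>. f \<omega> \<partial>gibbs lam N)) sequentially"
    using eventually_subset_cube [OF T]
    by eventually_elim (rule integral_local(3) [symmetric, OF prob_space_gibbs space_gibbs cylinder_in_gibbs T f])
  ultimately show "(\<lambda>N. \<integral>\<omega>. f \<omega> \<partial>gibbs lam N) \<longlonglongrightarrow> (\<integral>\<omega>. f \<omega> \<partial>limit_measure lam)"
    by (simp add: Lim_transform_eventually)
qed

section \<open>Cumulants\<close>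

text \<open>A partition of \<open>insert a A\<close> arises from a unique partition of \<open>A\<close> by adding \<open>{a}\<close> as a new block or by
  adding \<open>a\<close> to one of the blocks.\<close>

lemma sum_partitions_insert:
  fixes f :: "'a set set \<Rightarrow> 'b::comm_monoid_add"
  assumes A: "finite A" "a \<notin> A"
  shows "(\<Sum>Q | partition_on (insert a A) Q. f Q)
    = (\<Sum>P | partition_on A P. f (insert {a} P) + (\<Sum>S\<in>P. f (insert (insert a S) (P - {S}))))"
proof -
  define g where "g = (\<lambda>(P, x). case x of None \<Rightarrow> insert {a} P | Some S \<Rightarrow> insert (insert a S) (P - {S}))"
  define blk where "blk Q = (THE B. B \<in> Q \<and> a \<in> B)" for Q :: "'a set set"
  \<comment> \<open>the inverse of \<open>g\<close>: remove \<open>a\<close> from its block\<close>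
  define k where "k Q = (if blk Q = {a} then (Q - {blk Q}, None)
      else (insert (blk Q - {a}) (Q - {blk Q}), Some (blk Q - {a})))" for Q :: "'a set set"
  let ?I = "SIGMA P : {P. partition_on A P}. insert None (Some ` P)"
  have finP: "finite P" if "partition_on A P" for P using that A(1) finite_elements by blast
  have gP: "partition_on (insert a A) (g i)" "k (g i) = i" if i: "i \<in> ?I" for i
  proof -
    obtain P x where ix: "i = (P, x)" "partition_on A P" "x \<in> insert None (Some ` P)" using i by auto
    have U: "\<Union>P = A" "{} \<notin> P" "disjoint P" using ix(2) by (auto simp: partition_on_def)
    have aP: "a \<notin> S" if "S \<in> P" for S using U A that by auto
    have "partition_on (insert a A) (g i) \<and> k (g i) = i"
    proof (cases x)
      case None
      have b: "blk (insert {a} P) = {a}" unfolding blk_def by (rule the_equality) (use aP in auto)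
      have "disjnt {a} (\<Union>P)" using U A by (simp add: disjnt_def)
      then have "partition_on (insert a A) (insert {a} P)"
        using ix(2) A by (simp add: partition_on_insert)
      moreover have "{a} \<notin> P" using aP by auto
      ultimately show ?thesis using None by (simp add: ix g_def k_def b)
    next
      case (Some S)
      then have S: "S \<in> P" using ix by auto
      then have nS: "S \<noteq> {}" "a \<notin> S" "S \<subseteq> A" using U aP by auto
      have P: "P = insert S (P - {S})" using S by auto
      have d: "disjnt S (\<Union>(P - {S}))"
        using U(3) S by (auto simp: disjnt_def disjoint_def)
      then have pS: "partition_on (A - S) (P - {S})"
        using ix(2) P partition_on_insert [of S "P - {S}" A] by simp
      have "disjnt (insert a S) (\<Union>(P - {S}))" using d aP by (auto simp: disjnt_def)
      moreover have "insert a A - insert a S = A - S" using A by auto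
      ultimately have 1: "partition_on (insert a A) (insert (insert a S) (P - {S}))"
        using pS nS by (simp add: partition_on_insert) auto
      have b: "blk (insert (insert a S) (P - {S})) = insert a S"
        unfolding blk_def by (rule the_equality) (use aP in auto)
      have "insert a S \<notin> P" using aP by auto
      then have "insert (insert a S) (P - {S}) - {insert a S} = P - {S}" by auto
      moreover have "insert a S \<noteq> {a}" "insert a S - {a} = S" using nS by auto
      ultimately have "k (insert (insert a S) (P - {S})) = (P, Some S)" using S by (auto simp: k_def b)
      with 1 show ?thesis using Some by (simp add: ix g_def)
    qed
    then show "partition_on (insert a A) (g i)" "k (g i) = i" by auto
  qed
  have kQ: "k Q \<in> ?I" "g (k Q) = Q" if Q: "partition_on (insert a A) Q" for Q
  proof -
    have U: "\<Union>Q = insert a A" "{} \<notin> Q" "disjoint Q" using Q by (auto simp: partition_on_def)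
    then obtain B where B: "B \<in> Q" "a \<in> B" by auto
    have b: "blk Q = B" unfolding blk_def
      by (rule the_equality) (use B U(3) in \<open>auto simp: disjoint_def\<close>)
    have QB: "Q = insert B (Q - {B})" using B by auto
    have d: "disjnt B (\<Union>(Q - {B}))" using U(3) B by (auto simp: disjnt_def disjoint_def)
    then have pB: "partition_on (insert a A - B) (Q - {B})"
      using Q QB partition_on_insert [of B "Q - {B}" "insert a A"] by simp
    have "k Q \<in> ?I \<and> g (k Q) = Q"
    proof (cases "B = {a}")
      case True
      then show ?thesis using pB A B by (auto simp: k_def b g_def)
    next
      case False
      let ?S = "B - {a}"
      have S: "?S \<noteq> {}" "?S \<subseteq> A" using False B U by auto
      have "disjnt ?S (\<Union>(Q - {B}))" using d by (auto simp: disjnt_def)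
      moreover have "A - ?S = insert a A - B" using A B by auto
      ultimately have 1: "partition_on A (insert ?S (Q - {B}))"
        using pB S by (simp add: partition_on_insert)
      have "?S \<notin> Q - {B}"
      proof
        assume "?S \<in> Q - {B}"
        then have "?S \<subseteq> \<Union>(Q - {B})" by blast
        then show False using d S by (auto simp: disjnt_def)
      qed
      then have "insert ?S (Q - {B}) - {?S} = Q - {B}" by auto
      moreover have "insert a ?S = B" using B by auto
      ultimately show ?thesis using 1 False B by (auto simp: k_def b g_def)
    qed
    then show "k Q \<in> ?I" "g (k Q) = Q" by auto
  qed
  have "(\<Sum>Q | partition_on (insert a A) Q. f Q) = (\<Sum>i\<in>?I. f (g i))"
    by (rule sum.reindex_bij_witness [of _ g k]) (simp_all only: mem_Collect_eq gP kQ)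
  also have "\<dots> = (\<Sum>P | partition_on A P. \<Sum>x\<in>insert None (Some ` P). f (g (P, x)))"
    by (subst sum.Sigma) (auto intro: finitely_many_partition_on A finP)
  also have "\<dots> = (\<Sum>P | partition_on A P. f (insert {a} P) + (\<Sum>S\<in>P. f (insert (insert a S) (P - {S}))))"
  proof (rule sum.cong [OF refl])
    fix P assume "P \<in> {P. partition_on A P}"
    then have "finite P" using finP by auto
    then show "(\<Sum>x\<in>insert None (Some ` P). f (g (P, x))) = f (insert {a} P) + (\<Sum>S\<in>P. f (insert (insert a S) (P - {S})))"
      by (simp add: sum.reindex g_def)
  qed
  finally show ?thesis .
qed

text \<open>The formula of the semi-invariants for an arbitrary functional \<open>E\<close> in place of the expectation. It is
  applied to complex Gibbs averages and to perturbed functionals, which are not integrals.\<close>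

definition cumulant :: "(('w \<Rightarrow> complex) \<Rightarrow> complex) \<Rightarrow> ('w \<Rightarrow> complex) list \<Rightarrow> complex" where
  "cumulant E Xs = (\<Sum>P | partition_on {..<length Xs} P.
      (-1) ^ (card P - 1) * fact (card P - 1) * (\<Prod>S\<in>P. E (\<lambda>\<omega>. \<Prod>i\<in>S. (Xs ! i) \<omega>)))"

text \<open>Sort the partitions by the block of the last variable. If \<open>P\<close> has \<open>j\<close> blocks, adding a singleton
  block multiplies the coefficient by \<open>- j\<close>, and \<open>- j\<close> copies of \<open>E Y * (\<Prod>S\<in>P. E (X S))\<close> distribute over
  the \<open>j\<close> terms in which \<open>Y\<close> joins a block.\<close>

lemma cumulant_append:
  assumes Xs: "Xs \<noteq> []"
  defines "X \<equiv> \<lambda>S \<omega>. \<Prod>i\<in>S. (Xs ! i) \<omega>"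
  shows "cumulant E (Xs @ [Y]) = (\<Sum>P | partition_on {..<length Xs} P.
      (-1) ^ (card P - 1) * fact (card P - 1) *
      (\<Sum>S\<in>P. (E (\<lambda>\<omega>. X S \<omega> * Y \<omega>) - E (X S) * E Y) * (\<Prod>S'\<in>P - {S}. E (X S'))))"
proof -
  let ?m = "length Xs"
  let ?c = "\<lambda>n. (-1) ^ (n - 1) * fact (n - 1) :: complex"
  let ?Z = "\<lambda>S \<omega>. \<Prod>i\<in>S. ((Xs @ [Y]) ! i) \<omega>"
  let ?f = "\<lambda>P. ?c (card P) * (\<Prod>S\<in>P. E (?Z S))"
  have Z: "?Z S = X S" if "S \<subseteq> {..<?m}" for S
    unfolding X_def by (intro ext prod.cong) (use that in \<open>auto simp: nth_append\<close>)
  have "cumulant E (Xs @ [Y]) = (\<Sum>Q | partition_on (insert ?m {..<?m}) Q. ?f Q)"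
    by (simp add: cumulant_def lessThan_Suc)
  also have "\<dots> = (\<Sum>P | partition_on {..<?m} P. ?f (insert {?m} P) + (\<Sum>S\<in>P. ?f (insert (insert ?m S) (P - {S}))))"
    by (rule sum_partitions_insert) auto
  also have "\<dots> = (\<Sum>P | partition_on {..<?m} P. ?c (card P) *
      (\<Sum>S\<in>P. (E (\<lambda>\<omega>. X S \<omega> * Y \<omega>) - E (X S) * E Y) * (\<Prod>S'\<in>P - {S}. E (X S'))))"
  proof (rule sum.cong [OF refl])
    fix P assume "P \<in> {P. partition_on {..<?m} P}"
    then have P: "partition_on {..<?m} P" by simp
    then have finP: "finite P" using finite_elements by blast
    have sub: "S \<subseteq> {..<?m}" if "S \<in> P" for S using P that by (auto simp: partition_on_def)
    have "P \<noteq> {}" using P Xs by (auto simp: partition_on_def lessThan_empty_iff)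
    then have card: "card P \<noteq> 0" using finP by simp
    then obtain n where n: "card P = Suc n" using not0_implies_Suc by blast
    have mP: "?m \<notin> S" if "S \<in> P" for S using sub [OF that] by auto
    have EZ: "(\<Prod>S\<in>R. E (?Z S)) = (\<Prod>S\<in>R. E (X S))" if "R \<subseteq> P" for R
      by (rule prod.cong) (use that Z sub in auto)
    have "{?m} \<notin> P" using mP by auto
    then have "?f (insert {?m} P) = - of_nat (card P) * ?c (card P) * E Y * (\<Prod>S\<in>P. E (X S))"
      using finP by (simp add: EZ n fact_Suc algebra_simps)
    also have "\<dots> = (\<Sum>S\<in>P. - ?c (card P) * E Y * (\<Prod>S\<in>P. E (X S)))" by simp
    also have "\<dots> = (\<Sum>S\<in>P. - ?c (card P) * E Y * (E (X S) * (\<Prod>S'\<in>P - {S}. E (X S'))))"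
      by (rule sum.cong) (use finP in \<open>simp_all add: prod.remove\<close>)
    finally have 1: "?f (insert {?m} P) = (\<Sum>S\<in>P. - ?c (card P) * E Y * (E (X S) * (\<Prod>S'\<in>P - {S}. E (X S'))))" .
    have 2: "?f (insert (insert ?m S) (P - {S})) = ?c (card P) * (E (\<lambda>\<omega>. X S \<omega> * Y \<omega>) * (\<Prod>S'\<in>P - {S}. E (X S')))"
      if S: "S \<in> P" for S
    proof -
      have nin: "insert ?m S \<notin> P - {S}" using mP by auto
      have fS: "finite S" using sub [OF S] finite_subset by blast
      have "?Z (insert ?m S) = (\<lambda>\<omega>. X S \<omega> * Y \<omega>)"
        using fS mP [OF S] Z [OF sub [OF S]] by (auto simp: fun_eq_iff mult.commute)
      moreover have "card (insert (insert ?m S) (P - {S})) = card P"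
        using nin finP S by (simp add: n)
      ultimately show ?thesis using nin finP by (simp add: EZ)
    qed
    show "?f (insert {?m} P) + (\<Sum>S\<in>P. ?f (insert (insert ?m S) (P - {S}))) = ?c (card P) *
      (\<Sum>S\<in>P. (E (\<lambda>\<omega>. X S \<omega> * Y \<omega>) - E (X S) * E Y) * (\<Prod>S'\<in>P - {S}. E (X S')))"
      unfolding 1 sum_distrib_left sum.distrib [symmetric]
      by (rule sum.cong [OF refl], subst 2) (auto simp: algebra_simps)
  qed
  finally show ?thesis .
qed

text \<open>The right hand side of \<open>cumulant_append\<close> is the product rule for a functional whose derivative is
  \<open>E (X * Y) - E X * E Y\<close>. Gibbs averages have this derivative with respect to the coupling.\<close>

lemma has_field_derivative_cumulant:
  assumes E: "\<And>X. ((\<lambda>z. E z X) has_field_derivative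
        (\<Sum>A\<in>B. E z0 (\<lambda>\<omega>. X \<omega> * \<Phi> A \<omega>) - E z0 X * E z0 (\<Phi> A))) (at z0)"
    and Xs: "Xs \<noteq> []"
  shows "((\<lambda>z. cumulant (E z) Xs) has_field_derivative (\<Sum>A\<in>B. cumulant (E z0) (Xs @ [\<Phi> A]))) (at z0)"
proof -
  define X where "X S \<omega> = (\<Prod>i\<in>S. (Xs ! i) \<omega>)" for S \<omega>
  let ?c = "\<lambda>P :: nat set set. (-1) ^ (card P - 1) * fact (card P - 1) :: complex"
  let ?D = "\<lambda>X. \<Sum>A\<in>B. E z0 (\<lambda>\<omega>. X \<omega> * \<Phi> A \<omega>) - E z0 X * E z0 (\<Phi> A)"
  have "((\<lambda>z. \<Sum>P | partition_on {..<length Xs} P. ?c P * (\<Prod>S\<in>P. E z (X S))) has_field_derivative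
     (\<Sum>P | partition_on {..<length Xs} P. ?c P * (\<Sum>S\<in>P. ?D (X S) * (\<Prod>S'\<in>P - {S}. E z0 (X S'))))) (at z0)"
    by (intro DERIV_sum DERIV_cmult has_field_derivative_prod E)
  moreover have "(\<Sum>P | partition_on {..<length Xs} P. ?c P * (\<Sum>S\<in>P. ?D (X S) * (\<Prod>S'\<in>P - {S}. E z0 (X S'))))
      = (\<Sum>A\<in>B. cumulant (E z0) (Xs @ [\<Phi> A]))"
  proof -
    let ?F = "\<lambda>P A. \<Sum>S\<in>P. (E z0 (\<lambda>\<omega>. X S \<omega> * \<Phi> A \<omega>) - E z0 (X S) * E z0 (\<Phi> A)) * (\<Prod>S'\<in>P - {S}. E z0 (X S'))"
    have "(\<Sum>S\<in>P. ?D (X S) * (\<Prod>S'\<in>P - {S}. E z0 (X S'))) = (\<Sum>A\<in>B. ?F P A)" for P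
      unfolding sum_distrib_right by (rule sum.swap)
    then have "(\<Sum>P | partition_on {..<length Xs} P. ?c P * (\<Sum>S\<in>P. ?D (X S) * (\<Prod>S'\<in>P - {S}. E z0 (X S'))))
        = (\<Sum>P | partition_on {..<length Xs} P. \<Sum>A\<in>B. ?c P * ?F P A)"
      by (simp add: sum_distrib_left)
    also have "\<dots> = (\<Sum>A\<in>B. \<Sum>P | partition_on {..<length Xs} P. ?c P * ?F P A)" by (rule sum.swap)
    finally show ?thesis by (simp add: cumulant_append [OF Xs] X_def [abs_def])
  qed
  ultimately show ?thesis by (simp add: cumulant_def X_def [abs_def])
qed

lemma cumulant_cong:
  assumes "\<And>S. S \<subseteq> {..<length Xs} \<Longrightarrow> S \<noteq> {} \<Longrightarrow> E (\<lambda>\<omega>. \<Prod>i\<in>S. (Xs ! i) \<omega>) = E' (\<lambda>\<omega>. \<Prod>i\<in>S. (Xs ! i) \<omega>)"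
  shows "cumulant E Xs = cumulant E' Xs"
  unfolding cumulant_def
  by (intro sum.cong refl arg_cong2 [of _ _ _ _ "(*)"] prod.cong assms) (auto simp: partition_on_def)

lemma partition_on_permute:
  assumes P: "partition_on {..<n} P" and p: "p permutes {..<n}"
  shows "partition_on {..<n} ((`) p ` P)"
proof -
  have "partition_on (p ` {..<n}) ((`) p ` P - {{}})"
    using P permutes_inj_on [OF p] by (rule partition_on_inj_image)
  moreover have "{} \<notin> (`) p ` P" using P by (auto simp: partition_on_def)
  ultimately show ?thesis by (simp add: permutes_image [OF p])
qed

text \<open>A permutation of the indices acts on partitions and preserves the number of blocks.\<close>

lemma cumulant_permute:
  assumes "mset Xs = mset Ys"
  shows "cumulant E Xs = cumulant E Ys"
proof -
  obtain p where p: "p permutes {..<length Ys}" "permute_list p Ys = Xs"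
    using mset_eq_permutation [OF assms] .
  let ?n = "length Ys" and ?q = "inv_into UNIV p"
  have len: "length Xs = ?n" using p(2) by auto
  have inj: "inj p" using p(1) by (rule permutes_inj)
  have q: "?q permutes {..<?n}" using p(1) by (rule permutes_inv)
  have pq: "p ` ?q ` S = S" "?q ` p ` S = S" for S
    using p(1) by (simp_all add: image_image permutes_inverses)
  show ?thesis
    unfolding cumulant_def len
  proof (rule sum.reindex_bij_witness [of _ "(`) ((`) ?q)" "(`) ((`) p)"])
    fix P assume "P \<in> {P. partition_on {..<?n} P}"
    then have P: "partition_on {..<?n} P" by simp
    show "(`) ?q ` (`) p ` P = P" by (simp only: image_image [of "(`) ?q" "(`) p"] pq image_ident)
    show "(`) p ` P \<in> {P. partition_on {..<?n} P}" using partition_on_permute [OF P p(1)] by simp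
    have injP: "inj_on ((`) p) P" using inj by (auto simp: inj_on_def inj_image_eq_iff)
    have "(\<lambda>\<omega>. \<Prod>i\<in>p ` S. (Ys ! i) \<omega>) = (\<lambda>\<omega>. \<Prod>i\<in>S. (Xs ! i) \<omega>)" if "S \<in> P" for S
    proof
      fix \<omega>
      have "(\<Prod>i\<in>p ` S. (Ys ! i) \<omega>) = (\<Prod>i\<in>S. (Ys ! p i) \<omega>)"
        by (rule prod.reindex_cong [of p]) (use inj in \<open>auto simp: inj_on_def\<close>)
      also have "\<dots> = (\<Prod>i\<in>S. (Xs ! i) \<omega>)"
      proof (rule prod.cong [OF refl])
        fix i assume "i \<in> S"
        then have "i \<in> \<Union>P" using that by blast
        then have "i < ?n" using P by (metis lessThan_iff partition_onD1)
        then show "(Ys ! p i) \<omega> = (Xs ! i) \<omega>" using permute_list_nth [OF p(1)] p(2) by force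
      qed
      finally show "(\<Prod>i\<in>p ` S. (Ys ! i) \<omega>) = (\<Prod>i\<in>S. (Xs ! i) \<omega>)" .
    qed
    then have "(\<Prod>S\<in>(`) p ` P. E (\<lambda>\<omega>. \<Prod>i\<in>S. (Ys ! i) \<omega>)) = (\<Prod>S\<in>P. E (\<lambda>\<omega>. \<Prod>i\<in>S. (Xs ! i) \<omega>))"
      by (simp add: prod.reindex [OF injP])
    then show "(- 1) ^ (card ((`) p ` P) - 1) * fact (card ((`) p ` P) - 1) * (\<Prod>S\<in>(`) p ` P. E (\<lambda>\<omega>. \<Prod>i\<in>S. (Ys ! i) \<omega>))
        = (- 1) ^ (card P - 1) * fact (card P - 1) * (\<Prod>S\<in>P. E (\<lambda>\<omega>. \<Prod>i\<in>S. (Xs ! i) \<omega>))"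
      by (simp add: card_image [OF injP])
  next
    fix P assume "P \<in> {P. partition_on {..<?n} P}"
    then have P: "partition_on {..<?n} P" by simp
    show "(`) p ` (`) ?q ` P = P" by (simp only: image_image [of "(`) p" "(`) ?q"] pq image_ident)
    show "(`) ?q ` P \<in> {P. partition_on {..<?n} P}" using partition_on_permute [OF P q] by simp
  qed
qed

definition linear_expectation :: "(('w \<Rightarrow> complex) \<Rightarrow> complex) \<Rightarrow> bool" where
  "linear_expectation E \<longleftrightarrow> E (\<lambda>_. 1) = 1 \<and> (\<forall>X Y. E (\<lambda>\<omega>. X \<omega> + Y \<omega>) = E X + E Y) \<and> (\<forall>c X. E (\<lambda>\<omega>. c * X \<omega>) = c * E X)"

text \<open>Cumulants of variables that fall into two independent groups vanish. Induct on the list: the cumulant of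
  \<open>ts\<close> with \<open>Y\<close> appended is the derivative at \<open>u = 0\<close> of the cumulant of \<open>ts\<close> under the functional
  \<open>X \<mapsto> E (X * (1 + u * Y)) / E (1 + u * Y)\<close>. This functional keeps the two groups independent and leaves
  the group without \<open>Y\<close> untouched. So the cumulant of \<open>ts\<close> is 0 for all small \<open>u\<close> if both groups occur
  in \<open>ts\<close>, and it is constant in \<open>u\<close> if only the group without \<open>Y\<close> occurs.\<close>

lemma cumulant_independent:
  fixes \<X> :: "bool \<Rightarrow> ('w \<Rightarrow> complex) set"
  assumes one: "\<And>b. (\<lambda>_. 1) \<in> \<X> b"
    and mult: "\<And>b X Y. X \<in> \<X> b \<Longrightarrow> Y \<in> \<X> b \<Longrightarrow> (\<lambda>\<omega>. X \<omega> * Y \<omega>) \<in> \<X> b"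
  shows "linear_expectation E \<Longrightarrow> (\<And>b X Y. X \<in> \<X> b \<Longrightarrow> Y \<in> \<X> (\<not> b) \<Longrightarrow> E (\<lambda>\<omega>. X \<omega> * Y \<omega>) = E X * E Y) \<Longrightarrow>
    (\<And>b X. (b, X) \<in> set ts \<Longrightarrow> X \<in> \<X> b) \<Longrightarrow> True \<in> fst ` set ts \<Longrightarrow> False \<in> fst ` set ts \<Longrightarrow>
    cumulant E (map snd ts) = 0"
proof (induction ts arbitrary: E rule: rev_induct)
  case Nil
  then show ?case by simp
next
  case (snoc t ts)
  obtain b Y where t: "t = (b, Y)" by (cases t)
  note lin = snoc.prems(1) and fac = snoc.prems(2)
  have tags: "X \<in> \<X> b'" if "(b', X) \<in> set ts" for b' X using snoc.prems(3) that by auto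
  have Y: "Y \<in> \<X> b" using snoc.prems(3) t by auto
  have nb: "(\<not> b) \<in> fst ` set ts" using snoc.prems(4,5) t by (cases b) auto
  then have ne: "map snd ts \<noteq> []" by auto
  have E1: "E (\<lambda>_. 1) = 1" and Eadd: "\<And>X Y. E (\<lambda>\<omega>. X \<omega> + Y \<omega>) = E X + E Y"
    and Esc: "\<And>c X. E (\<lambda>\<omega>. c * X \<omega>) = c * E X" using lin by (auto simp: linear_expectation_def)
  \<comment> \<open>the functional perturbed in the direction \<open>Y\<close>, with the linearity of \<open>E\<close> already used\<close>
  define F where "F u X = (E X + u * E (\<lambda>\<omega>. X \<omega> * Y \<omega>)) / (1 + u * E Y)" for u X
  have F0: "F 0 = E" by (simp add: F_def fun_eq_iff)
  have dF: "((\<lambda>u. F u X) has_field_derivative (\<Sum>A\<in>{()}. F 0 (\<lambda>\<omega>. X \<omega> * Y \<omega>) - F 0 X * F 0 Y)) (at 0)" for X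
    unfolding F_def by (rule derivative_eq_intros refl | simp)+
  have der: "((\<lambda>u. cumulant (F u) (map snd ts)) has_field_derivative cumulant E (map snd ts @ [Y])) (at 0)"
    using has_field_derivative_cumulant [where E = F and B = "{()}" and \<Phi> = "\<lambda>_. Y", OF dF ne] by (simp add: F0)
  have FnotB: "F u X = E X" if "X \<in> \<X> (\<not> b)" "1 + u * E Y \<noteq> 0" for u X
  proof -
    have "E (\<lambda>\<omega>. Y \<omega> * X \<omega>) = E Y * E X" using fac [OF Y that(1)] .
    then have "E X + u * E (\<lambda>\<omega>. X \<omega> * Y \<omega>) = E X * (1 + u * E Y)" by (simp add: mult.commute algebra_simps)
    then show ?thesis using that(2) by (simp add: F_def)
  qed
  have const: "cumulant (F u) (map snd ts) = (if b \<in> fst ` set ts then 0 else cumulant E (map snd ts))"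
    if u: "1 + u * E Y \<noteq> 0" for u
  proof (cases "b \<in> fst ` set ts")
    case True
    have "cumulant (F u) (map snd ts) = 0"
    proof (rule snoc.IH)
      show "linear_expectation (F u)"
        unfolding linear_expectation_def F_def using u
        by (auto simp: E1 Eadd Esc distrib_right mult.assoc add_divide_distrib [symmetric] algebra_simps)
      show "True \<in> fst ` set ts" "False \<in> fst ` set ts" using True nb by (cases b; simp)+
      have 1: "F u (\<lambda>\<omega>. X \<omega> * X' \<omega>) = F u X * F u X'" if X: "X \<in> \<X> b" "X' \<in> \<X> (\<not> b)" for X X'
      proof -
        have "E (\<lambda>\<omega>. X \<omega> * X' \<omega> * Y \<omega>) = E (\<lambda>\<omega>. (X \<omega> * Y \<omega>) * X' \<omega>)" by (simp add: mult_ac)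
        also have "\<dots> = E (\<lambda>\<omega>. X \<omega> * Y \<omega>) * E X'" by (rule fac [OF mult [OF X(1) Y] X(2)])
        finally have "F u (\<lambda>\<omega>. X \<omega> * X' \<omega>) = F u X * E X'"
          using fac [OF X] by (simp add: F_def field_simps)
        then show ?thesis using FnotB [OF X(2) u] by simp
      qed
      show "F u (\<lambda>\<omega>. X \<omega> * X' \<omega>) = F u X * F u X'" if "X \<in> \<X> b'" "X' \<in> \<X> (\<not> b')" for b' X X'
      proof (cases "b' = b")
        case True
        then show ?thesis using 1 that by simp
      next
        case False
        then have "X' \<in> \<X> b" "X \<in> \<X> (\<not> b)" using that by (cases b; cases b'; simp)+
        from 1 [OF this] show ?thesis by (simp add: mult.commute)
      qed
    qed (use tags in auto)
    then show ?thesis using True by simp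
  next
    case False
    have "(\<lambda>\<omega>. \<Prod>i\<in>S. (map snd ts ! i) \<omega>) \<in> \<X> (\<not> b)" if "S \<subseteq> {..<length (map snd ts)}" for S
    proof -
      have "finite S" using that finite_subset by blast
      then show ?thesis using that
      proof (induction S)
        case (insert i S)
        have "(fst (ts ! i), snd (ts ! i)) \<in> set ts" using insert.prems by simp
        moreover from this have "fst (ts ! i) = (\<not> b)" using False by (cases b; cases "fst (ts ! i)") force+
        ultimately have "map snd ts ! i \<in> \<X> (\<not> b)" using tags insert.prems by fastforce
        then show ?case using insert mult [of "map snd ts ! i" "\<not> b"] by simp
      qed (simp add: one)
    qed
    then have "cumulant (F u) (map snd ts) = cumulant E (map snd ts)"
      by (intro cumulant_cong FnotB u)
    then show ?thesis using False by simp
  qed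
  have "((\<lambda>u. 1 + u * E Y) \<longlongrightarrow> 1 + 0 * E Y) (at 0)" by (intro tendsto_intros)
  then have "eventually (\<lambda>u. 1 + u * E Y \<noteq> 0) (at 0)"
    by (rule tendsto_imp_eventually_ne) simp
  then have "eventually (\<lambda>u. 1 + u * E Y \<noteq> 0) (nhds 0)"
    by (rule eventually_nhds_conv_at [THEN iffD2, OF conjI]) simp
  then have ev: "eventually (\<lambda>u. cumulant (F u) (map snd ts) = (if b \<in> fst ` set ts then 0 else cumulant E (map snd ts))) (nhds 0)"
    by (rule eventually_mono) (rule const)
  have "((\<lambda>u :: complex. if b \<in> fst ` set ts then 0 else cumulant E (map snd ts)) has_field_derivative cumulant E (map snd ts @ [Y])) (at 0)"
    using der DERIV_cong_ev [OF refl ev refl] by blast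
  then have "cumulant E (map snd ts @ [Y]) = 0"
    using DERIV_const DERIV_unique by blast
  then show ?case by (simp add: t)
qed

section \<open>Derivatives of the pair correlation\<close>

text \<open>The average without field; wherever the partition function is nonzero it is a linear functional of \<open>X\<close> that
  depends analytically on \<open>lam\<close>.\<close>

definition gibbs_mean :: "complex \<Rightarrow> nat \<Rightarrow> ((int ^ 'n::finite \<Rightarrow> real) \<Rightarrow> complex) \<Rightarrow> complex" where
  "gibbs_mean lam N X = weight_sum lam (\<lambda>_. 0) N X / weight_sum lam (\<lambda>_ :: int ^ 'n. 0) N (\<lambda>_. 1)"

lemma corr_eq_gibbs_mean: "T \<subseteq> cube N \<Longrightarrow> corr lam (\<lambda>_. 0) N T = gibbs_mean lam N (chi T)"
  by (simp add: corr_def gibbs_mean_def)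

lemma gibbs_mean_cong:
  "(\<And>\<delta>. \<delta> \<in> cube_configs N \<Longrightarrow> X \<delta> = Y \<delta>) \<Longrightarrow> gibbs_mean lam N X = gibbs_mean lam N Y"
  by (simp add: gibbs_mean_def weight_sum_def)

lemma weight_sum_one_nonzero:
  "norm lam \<le> rad0 TYPE('n::finite) \<Longrightarrow> weight_sum lam (\<lambda>_ :: int ^ 'n. 0) N (\<lambda>_. 1) \<noteq> 0"
  by (rule weight_sum_dominated(1) [OF high_temp_zero_field])

lemma linear_expectation_gibbs_mean:
  assumes "norm lam \<le> rad0 TYPE('n::finite)"
  shows "linear_expectation (gibbs_mean lam N :: ((int ^ 'n \<Rightarrow> real) \<Rightarrow> complex) \<Rightarrow> complex)"
  using weight_sum_one_nonzero [OF assms, of N]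
  by (simp add: linear_expectation_def gibbs_mean_def weight_sum_def sum.distrib sum_distrib_left distrib_right add_divide_distrib mult.assoc)

lemma weight_sum_has_derivative:
  fixes X :: "(int ^ 'n::finite \<Rightarrow> real) \<Rightarrow> complex"
  shows "((\<lambda>z. weight_sum z (\<lambda>_. 0) N X) has_field_derivative (\<Sum>A\<in>cube_bonds N. weight_sum z0 (\<lambda>_. 0) N (\<lambda>\<delta>. X \<delta> * chi A \<delta>))) (at z0)"
proof -
  have "((\<lambda>z. weight_sum z (\<lambda>_. 0) N X) has_field_derivative (\<Sum>\<delta>\<in>cube_configs N. X \<delta> * (energy N \<delta> * spin_weight z0 (\<lambda>_. 0) N \<delta>))) (at z0)"
    unfolding weight_sum_def spin_weight_def by (auto intro!: derivative_eq_intros sum.cong)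
  moreover have "(\<Sum>\<delta>\<in>cube_configs N. X \<delta> * (energy N \<delta> * spin_weight z0 (\<lambda>_. 0) N \<delta>))
      = (\<Sum>A\<in>cube_bonds N. weight_sum z0 (\<lambda>_. 0) N (\<lambda>\<delta>. X \<delta> * chi A \<delta>))"
    unfolding weight_sum_def energy_def by (subst sum.swap) (simp add: sum_distrib_left sum_distrib_right mult_ac)
  ultimately show ?thesis by simp
qed

lemma gibbs_mean_has_derivative:
  fixes X :: "(int ^ 'n::finite \<Rightarrow> real) \<Rightarrow> complex"
  assumes z0: "norm z0 \<le> rad0 TYPE('n)"
  shows "((\<lambda>z. gibbs_mean z N X) has_field_derivative
      (\<Sum>A\<in>cube_bonds N. gibbs_mean z0 N (\<lambda>\<delta>. X \<delta> * chi A \<delta>) - gibbs_mean z0 N X * gibbs_mean z0 N (chi A))) (at z0)"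
proof -
  let ?Z = "weight_sum z0 (\<lambda>_ :: int ^ 'n. 0) N (\<lambda>_. 1)"
  have Z: "?Z \<noteq> 0" by (rule weight_sum_one_nonzero [OF z0])
  have "((\<lambda>z. gibbs_mean z N X) has_field_derivative
      ((\<Sum>A\<in>cube_bonds N. weight_sum z0 (\<lambda>_. 0) N (\<lambda>\<delta>. X \<delta> * chi A \<delta>)) * ?Z
        - weight_sum z0 (\<lambda>_. 0) N X * (\<Sum>A\<in>cube_bonds N. weight_sum z0 (\<lambda>_. 0) N (\<lambda>\<delta> :: int ^ 'n \<Rightarrow> real. 1 * chi A \<delta>))) / (?Z * ?Z)) (at z0)"
    unfolding gibbs_mean_def by (rule DERIV_divide [OF weight_sum_has_derivative weight_sum_has_derivative Z])
  moreover have "((\<Sum>A\<in>cube_bonds N. weight_sum z0 (\<lambda>_. 0) N (\<lambda>\<delta>. X \<delta> * chi A \<delta>)) * ?Z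
        - weight_sum z0 (\<lambda>_. 0) N X * (\<Sum>A\<in>cube_bonds N. weight_sum z0 (\<lambda>_. 0) N (\<lambda>\<delta> :: int ^ 'n \<Rightarrow> real. 1 * chi A \<delta>))) / (?Z * ?Z)
      = (\<Sum>A\<in>cube_bonds N. gibbs_mean z0 N (\<lambda>\<delta>. X \<delta> * chi A \<delta>) - gibbs_mean z0 N X * gibbs_mean z0 N (chi A))"
    using Z unfolding gibbs_mean_def
    by (simp add: sum_distrib_left sum_distrib_right sum_subtractf [symmetric] sum_divide_distrib diff_divide_distrib)
  ultimately show ?thesis by simp
qed

lemma cumulant_pair: "cumulant E [X, Y] = E (\<lambda>\<omega>. X \<omega> * Y \<omega>) - E X * E Y"
  using cumulant_append [of "[X]" E Y] by (simp add: partition_on_singleton)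

text \<open>The means of single spins vanish.\<close>

lemma corr_pair_cumulant:
  fixes t :: "int ^ 'n::finite"
  assumes t: "t \<noteq> 0" "t \<in> cube N"
  shows "corr lam (\<lambda>_. 0) N {0, t} = cumulant (gibbs_mean lam N) (map chi [{0}, {t}])"
proof -
  have "gibbs_mean lam N (chi {t}) = 0" using corr_single [of lam N t] t by (simp add: corr_eq_gibbs_mean)
  moreover have "gibbs_mean lam N (\<lambda>\<delta>. chi {0} \<delta> * chi {t} \<delta>) = gibbs_mean lam N (chi {0, t})"
    using t by (simp add: chi_def [abs_def])
  ultimately show ?thesis using t by (simp add: cumulant_pair corr_eq_gibbs_mean)
qed

text \<open>Each differentiation appends one more bond variable, and the sum runs over all bonds of the cube.\<close>

lemma cumulant_higher_deriv:
  fixes Ts :: "(int ^ 'n::finite) set list"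
  assumes Ts: "Ts \<noteq> []"
  shows "z \<in> ball 0 (rad0 TYPE('n)) \<Longrightarrow> (deriv ^^ n) (\<lambda>z. cumulant (gibbs_mean z N) (map chi Ts)) z
    = (\<Sum>As | set As \<subseteq> cube_bonds N \<and> length As = n. cumulant (gibbs_mean z N) (map chi (Ts @ As)))"
proof (induction n arbitrary: z)
  case 0
  have "{As :: (int ^ 'n) set list. set As \<subseteq> cube_bonds N \<and> length As = 0} = {[]}" by auto
  then show ?case by simp
next
  case (Suc n)
  let ?f = "\<lambda>z. cumulant (gibbs_mean z N) (map chi Ts)"
  let ?L = "\<lambda>n. {As :: (int ^ 'n) set list. set As \<subseteq> cube_bonds N \<and> length As = n}"
  have "((\<lambda>z. \<Sum>As\<in>?L n. cumulant (gibbs_mean z N) (map chi (Ts @ As))) has_field_derivative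
     (\<Sum>As\<in>?L n. \<Sum>A\<in>cube_bonds N. cumulant (gibbs_mean z N) (map chi (Ts @ As) @ [chi A]))) (at z)"
    by (intro DERIV_sum has_field_derivative_cumulant gibbs_mean_has_derivative)
      (use Suc.prems Ts in \<open>auto simp: dist_norm\<close>)
  then have "((deriv ^^ n) ?f has_field_derivative
     (\<Sum>As\<in>?L n. \<Sum>A\<in>cube_bonds N. cumulant (gibbs_mean z N) (map chi (Ts @ As) @ [chi A]))) (at z)"
    by (rule has_field_derivative_transform_within_open [OF _ open_ball Suc.prems]) (simp add: Suc.IH)
  then have "(deriv ^^ Suc n) ?f z = (\<Sum>As\<in>?L n. \<Sum>A\<in>cube_bonds N. cumulant (gibbs_mean z N) (map chi (Ts @ As) @ [chi A]))"
    by (simp add: DERIV_imp_deriv)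
  also have "\<dots> = (\<Sum>(As, A)\<in>?L n \<times> cube_bonds N. cumulant (gibbs_mean z N) (map chi (Ts @ As @ [A])))"
    by (simp add: sum.cartesian_product)
  also have "\<dots> = (\<Sum>As\<in>?L (Suc n). cumulant (gibbs_mean z N) (map chi (Ts @ As)))"
    by (rule sum.reindex_bij_witness [of _ "\<lambda>As. (butlast As, last As)" "\<lambda>(As, A). As @ [A]"])
      (auto dest: in_set_butlastD simp: length_Suc_conv_rev)
  finally show ?case .
qed

lemma mset_family_seq [simp]: "mset (family_seq \<gamma>) = \<gamma>"
  unfolding family_seq_def by (rule someI_ex) (rule ex_mset)

lemma finite_families: "finite B \<Longrightarrow> finite {\<gamma>. set_mset \<gamma> \<subseteq> B \<and> size \<gamma> = n}"
proof -
  assume B: "finite B"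
  have "{\<gamma>. set_mset \<gamma> \<subseteq> B \<and> size \<gamma> = n} \<subseteq> mset ` {xs. set xs \<subseteq> B \<and> length xs = n}"
  proof
    fix \<gamma> assume g: "\<gamma> \<in> {\<gamma>. set_mset \<gamma> \<subseteq> B \<and> size \<gamma> = n}"
    obtain xs where "mset xs = \<gamma>" using ex_mset by blast
    then show "\<gamma> \<in> mset ` {xs. set xs \<subseteq> B \<and> length xs = n}" using g by auto
  qed
  then show ?thesis using finite_lists_length_eq [OF B, of n] finite_surj by blast
qed

text \<open>A family of size \<open>n\<close> is represented by \<open>n! / family_fact \<gamma>\<close> lists.\<close>

lemma sum_lists_by_family:
  fixes F :: "'a list \<Rightarrow> complex"
  assumes B: "finite B" and F: "\<And>xs ys. mset xs = mset ys \<Longrightarrow> F xs = F ys"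
  shows "(\<Sum>xs | set xs \<subseteq> B \<and> length xs = n. F xs) / fact n
    = (\<Sum>\<gamma> | set_mset \<gamma> \<subseteq> B \<and> size \<gamma> = n. 1 / of_nat (family_fact \<gamma>) * F (family_seq \<gamma>))"
proof -
  let ?L = "{xs. set xs \<subseteq> B \<and> length xs = n}" and ?G = "{\<gamma>. set_mset \<gamma> \<subseteq> B \<and> size \<gamma> = n}"
  have "(\<Sum>xs\<in>?L. F xs) = (\<Sum>\<gamma>\<in>?G. \<Sum>xs | xs \<in> ?L \<and> mset xs = \<gamma>. F xs)"
    by (rule sum.group [symmetric]) (auto simp: finite_lists_length_eq B finite_families)
  also have "\<dots> = (\<Sum>\<gamma>\<in>?G. fact n / of_nat (family_fact \<gamma>) * F (family_seq \<gamma>))"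
  proof (rule sum.cong [OF refl])
    fix \<gamma> assume g: "\<gamma> \<in> ?G"
    have eq: "{xs. xs \<in> ?L \<and> mset xs = \<gamma>} = permutations_of_multiset \<gamma>"
      using g by (auto simp: permutations_of_multiset_def)
    have "(\<Sum>xs | xs \<in> ?L \<and> mset xs = \<gamma>. F xs) = (\<Sum>xs\<in>permutations_of_multiset \<gamma>. F (family_seq \<gamma>))"
      unfolding eq by (rule sum.cong [OF refl], rule F) (simp add: permutations_of_multiset_def)
    also have "\<dots> = of_nat (card (permutations_of_multiset \<gamma>)) * F (family_seq \<gamma>)" by simp
    also have "of_nat (card (permutations_of_multiset \<gamma>)) = fact n / (of_nat (family_fact \<gamma>) :: complex)"
    proof -
      have "card (permutations_of_multiset \<gamma>) * family_fact \<gamma> = fact n"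
        using card_permutations_of_multiset_aux [of \<gamma>] g by (simp add: family_fact_def)
      then have "(of_nat (card (permutations_of_multiset \<gamma>)) * of_nat (family_fact \<gamma>) :: complex) = fact n"
        by (metis of_nat_fact of_nat_mult)
      moreover have "family_fact \<gamma> \<noteq> 0" by (simp add: family_fact_def)
      ultimately show ?thesis by (simp add: field_simps)
    qed
    finally show "(\<Sum>xs | xs \<in> ?L \<and> mset xs = \<gamma>. F xs) = fact n / of_nat (family_fact \<gamma>) * F (family_seq \<gamma>)" .
  qed
  finally show ?thesis by (simp add: sum_divide_distrib)
qed

text \<open>Points that occur an even number of times cancel.\<close>

lemma prod_chi:
  assumes "finite I" "\<And>i. i \<in> I \<Longrightarrow> finite (f i) \<and> f i \<subseteq> C"
  shows "\<exists>T. finite T \<and> T \<subseteq> C \<and> (\<forall>\<omega>. (\<forall>t\<in>C. \<omega> t \<in> {-1, 1}) \<longrightarrow> (\<Prod>i\<in>I. chi (f i) \<omega>) = chi T \<omega>)"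
  using assms
proof induction
  case empty
  then show ?case by (intro exI [of _ "{}"]) simp
next
  case (insert i I)
  then obtain T where T: "finite T" "T \<subseteq> C" "\<forall>\<omega>. (\<forall>t\<in>C. \<omega> t \<in> {-1, 1}) \<longrightarrow> (\<Prod>i\<in>I. chi (f i) \<omega>) = chi T \<omega>" by auto
  have fi: "finite (f i)" "f i \<subseteq> C" using insert by auto
  have "(\<Prod>i\<in>insert i I. chi (f i) \<omega>) = chi (symdiff (f i) T) \<omega>" if w: "\<forall>t\<in>C. \<omega> t \<in> {-1, 1}" for \<omega>
  proof -
    have "(\<Prod>i\<in>insert i I. chi (f i) \<omega>) = chi (f i) \<omega> * chi T \<omega>" using insert T w by simp
    also have "\<dots> = chi (symdiff (f i) T) \<omega>" by (rule chi_symdiff) (use fi T w in auto)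
    finally show ?thesis .
  qed
  then show ?case using fi T by (intro exI [of _ "symdiff (f i) T"]) (auto intro!: symdiff_subset finite_symdiff simp: subset_iff symdiff_def)
qed

lemma gibbs_mean_zero_chi: "T \<subseteq> cube N \<Longrightarrow> gibbs_mean 0 N (chi T) = (if T = {} then 1 else 0 :: complex)"
proof -
  assume T: "T \<subseteq> cube N"
  have "norm (0::complex) \<le> rad0 TYPE('a)" using rad0_pos [where 'n = 'a] by simp
  then show ?thesis
    using corr_zero [OF _ T] corr_empty [OF high_temp_zero_field, of 0 N] T by (auto simp: corr_eq_gibbs_mean [symmetric])
qed

lemma semi_inv_gibbs:
  fixes Ts :: "(int ^ 'n::finite) set list"
  assumes Ts: "\<And>T. T \<in> set Ts \<Longrightarrow> T \<subseteq> cube N"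
  shows "complex_of_real (semi_inv (gibbs lam N) (map spin_prod Ts)) = cumulant (gibbs_mean (of_real lam) N) (map chi Ts)"
proof -
  have E: "complex_of_real (\<integral>\<omega>. (\<Prod>i\<in>S. (map spin_prod Ts ! i) \<omega>) \<partial>gibbs lam N) = gibbs_mean (of_real lam) N (\<lambda>\<delta>. \<Prod>i\<in>S. (map chi Ts ! i) \<delta>)"
    if S: "S \<subseteq> {..<length Ts}" for S
  proof -
    have sub: "Ts ! i \<subseteq> cube N" if "i \<in> S" for i using S that by (intro Ts) auto
    let ?f = "\<lambda>\<omega> :: 'n config. \<Prod>i\<in>S. chi (Ts ! i) \<omega>"
    have "complex_of_real (\<integral>\<omega>. (\<Prod>i\<in>S. (map spin_prod Ts ! i) \<omega>) \<partial>gibbs lam N) = (\<integral>\<omega>. complex_of_real (\<Prod>i\<in>S. (map spin_prod Ts ! i) \<omega>) \<partial>gibbs lam N)"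
      by (rule integral_complex_of_real [symmetric])
    also have "\<dots> = (\<integral>\<omega>. ?f \<omega> \<partial>gibbs lam N)"
      by (rule Bochner_Integration.integral_cong [OF refl]) (use S in \<open>auto simp: spin_prod_chi [symmetric] intro!: prod.cong\<close>)
    also have "\<dots> = weight_sum (of_real lam) (\<lambda>_. 0) N (\<lambda>\<delta>. ?f (extend_config N \<delta>)) / weight_sum (of_real lam) (\<lambda>_ :: int ^ 'n. 0) N (\<lambda>_. 1)"
      by (rule integral_gibbs_weight_sum) (use sub in \<open>auto simp: local_on_def intro!: prod.cong chi_cong\<close>)
    also have "(\<lambda>\<delta>. ?f (extend_config N \<delta>)) = ?f"
      by (intro ext prod.cong refl chi_cong) (use sub in \<open>auto simp: extend_config_def\<close>)
    also have "?f = (\<lambda>\<delta>. \<Prod>i\<in>S. (map chi Ts ! i) \<delta>)"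
      by (intro ext prod.cong) (use S in auto)
    finally show ?thesis by (simp add: gibbs_mean_def)
  qed
  show ?thesis
    unfolding semi_inv_def cumulant_def of_real_sum
  proof (intro sum.cong)
    fix P assume "P \<in> {P. partition_on {..<length (map chi Ts)} P}"
    then have "S \<subseteq> {..<length Ts}" if "S \<in> P" for S using that by (auto simp: partition_on_def)
    then have "(\<Prod>S\<in>P. complex_of_real (\<integral>\<omega>. (\<Prod>i\<in>S. (map spin_prod Ts ! i) \<omega>) \<partial>gibbs lam N)) = (\<Prod>S\<in>P. gibbs_mean (of_real lam) N (\<lambda>\<delta>. \<Prod>i\<in>S. (map chi Ts ! i) \<delta>))"
      by (intro prod.cong E) auto
    then show "complex_of_real ((- 1) ^ (card P - 1) * fact (card P - 1) * (\<Prod>S\<in>P. \<integral>\<omega>. (\<Prod>i\<in>S. (map spin_prod Ts ! i) \<omega>) \<partial>gibbs lam N))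
       = (- 1) ^ (card P - 1) * fact (card P - 1) * (\<Prod>S\<in>P. gibbs_mean (of_real lam) N (\<lambda>\<omega>. \<Prod>i\<in>S. (map chi Ts ! i) \<omega>))"
      by simp
  qed simp
qed

text \<open>Products of the variables are characters, and without coupling the mean of a character does not
  depend on the cube. So the semi-invariants are constant for large cubes.\<close>

lemma semi_inv0_eq:
  fixes Ts :: "(int ^ 'n::finite) set list"
  assumes Ts: "\<And>T. T \<in> set Ts \<Longrightarrow> T \<subseteq> cube N"
  shows "complex_of_real (semi_inv0 (map spin_prod Ts)) = cumulant (gibbs_mean 0 N) (map chi Ts)"
proof -
  have eqc: "cumulant (gibbs_mean 0 M) (map chi Ts) = cumulant (gibbs_mean 0 N) (map chi Ts)" if M: "N \<le> M" for M
  proof (rule cumulant_cong)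
    fix S assume S: "S \<subseteq> {..<length (map chi Ts)}"
    have fS: "finite S" using S finite_subset by blast
    have "\<exists>T. finite T \<and> T \<subseteq> cube N \<and> (\<forall>\<omega>. (\<forall>t\<in>cube N. \<omega> t \<in> {-1, 1}) \<longrightarrow> (\<Prod>i\<in>S. chi (Ts ! i) \<omega>) = chi T \<omega>)"
    proof (rule prod_chi [OF fS])
      fix i assume "i \<in> S"
      then have "Ts ! i \<subseteq> cube N" using S by (intro Ts) auto
      then show "finite (Ts ! i) \<and> Ts ! i \<subseteq> cube N" by (auto intro: finite_subset)
    qed
    then obtain T where T: "T \<subseteq> cube N" "\<And>\<omega>. (\<forall>t\<in>cube N. \<omega> t \<in> {-1, 1}) \<Longrightarrow> (\<Prod>i\<in>S. chi (Ts ! i) \<omega>) = chi T \<omega>" by blast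
    have "gibbs_mean 0 K (\<lambda>\<omega>. \<Prod>i\<in>S. (map chi Ts ! i) \<omega>) = (if T = {} then 1 else 0)" if K: "N \<le> K" for K
    proof -
      have "gibbs_mean 0 K (\<lambda>\<omega>. \<Prod>i\<in>S. (map chi Ts ! i) \<omega>) = gibbs_mean 0 K (chi T)"
      proof (rule gibbs_mean_cong)
        fix \<delta> :: "int ^ 'n \<Rightarrow> real" assume d: "\<delta> \<in> cube_configs K"
        have "(\<Prod>i\<in>S. (map chi Ts ! i) \<delta>) = (\<Prod>i\<in>S. chi (Ts ! i) \<delta>)"
          by (rule prod.cong) (use S in auto)
        also have "\<dots> = chi T \<delta>"
          using cube_config_values [OF d] cube_mono [OF K] by (intro T(2)) blast
        finally show "(\<Prod>i\<in>S. (map chi Ts ! i) \<delta>) = chi T \<delta>" .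
      qed
      also have "\<dots> = (if T = {} then 1 else 0)" by (rule gibbs_mean_zero_chi) (use T(1) cube_mono [OF K] in auto)
      finally show ?thesis .
    qed
    from this [OF M] this [of N] show "gibbs_mean 0 M (\<lambda>\<omega>. \<Prod>i\<in>S. (map chi Ts ! i) \<omega>) = gibbs_mean 0 N (\<lambda>\<omega>. \<Prod>i\<in>S. (map chi Ts ! i) \<omega>)" by simp
  qed
  define c where "c = semi_inv (gibbs 0 N) (map spin_prod Ts)"
  have cN: "complex_of_real c = cumulant (gibbs_mean 0 N) (map chi Ts)"
    unfolding c_def using semi_inv_gibbs [OF Ts, of _ 0] by simp
  have "semi_inv (gibbs 0 M) (map spin_prod Ts) = c" if M: "N \<le> M" for M
  proof -
    have "complex_of_real (semi_inv (gibbs 0 M) (map spin_prod Ts)) = cumulant (gibbs_mean 0 M) (map chi Ts)"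
      using semi_inv_gibbs [of Ts M 0] Ts cube_mono [OF M] by (simp, blast)
    also have "\<dots> = complex_of_real c" using eqc [OF M] cN by simp
    finally show ?thesis by simp
  qed
  then have ev: "eventually (\<lambda>M. semi_inv (gibbs 0 M) (map spin_prod Ts) = c) sequentially"
    by (rule eventually_sequentiallyI)
  have "semi_inv0 (map spin_prod Ts) = c"
    unfolding semi_inv0_def
  proof (rule the_equality, rule ev)
    fix c' assume "eventually (\<lambda>M. semi_inv (gibbs 0 M) (map spin_prod Ts) = c') sequentially"
    with ev have "eventually (\<lambda>M::nat. c' = c) sequentially" by eventually_elim simp
    then show "c' = c" by simp
  qed
  then show ?thesis using cN by simp
qed

section \<open>Connected families of bonds\<close>

lemma bond_dist: "{x, y} \<in> bonds \<Longrightarrow> ldist x y = 1"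
  by (auto simp: bonds_def doubleton_eq_iff ldist_commute)

text \<open>A path from \<open>0\<close> to \<open>y\<close> changes the distance to \<open>0\<close> by at most one per step, so for every \<open>j\<close> below the
  distance of \<open>y\<close> it uses a bond from level \<open>j\<close> to level \<open>j + 1\<close>. Bonds for different \<open>j\<close> are different, as
  the minimum of the distance on a bond recovers \<open>j\<close>.\<close>

lemma connected_levels:
  fixes y :: "int ^ 'n::finite"
  assumes "(0, y) \<in> {(x, y). {x, y} \<in> set_mset \<gamma>}\<^sup>*" "\<gamma> \<in> bond_families"
  shows "{..<nat (ldist y 0)} \<subseteq> (\<lambda>A. nat (Min ((\<lambda>x. ldist x 0) ` A))) ` set_mset \<gamma>"
  using assms(1)
proof induction
  case base
  then show ?case by simp
next
  case (step y z)
  let ?lev = "\<lambda>A. nat (Min ((\<lambda>x. ldist x 0) ` A))"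
  have yz: "{y, z} \<in> set_mset \<gamma>" using step by simp
  then have d: "ldist y z = 1" using assms(2) by (auto simp: bond_families_def intro: bond_dist)
  show ?case
  proof (cases "ldist z 0 \<le> ldist y 0")
    case True
    then have "{..<nat (ldist z 0)} \<subseteq> {..<nat (ldist y 0)}" by auto
    then show ?thesis using step.IH by (rule order_trans)
  next
    case False
    then have z: "ldist z 0 = ldist y 0 + 1"
      using ldist_triangle [of z 0 y] d ldist_commute [of y z] by linarith
    then have "{..<nat (ldist z 0)} = insert (nat (ldist y 0)) {..<nat (ldist y 0)}"
      using ldist_nonneg [of y 0] by auto
    moreover have "?lev {y, z} = nat (ldist y 0)" using z by simp
    ultimately show ?thesis using step.IH yz by (auto intro: rev_image_eqI)
  qed
qed

text \<open>By \<open>connected_levels\<close> a connected family that reaches distance \<open>d\<close> from the origin has at least \<open>d\<close> bonds.\<close>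

lemma connected_support_in_cube:
  fixes \<gamma> :: "(int ^ 'n::finite) set multiset"
  assumes g: "\<gamma> \<in> bond_families" "connects \<gamma> (0 # b)"
  shows "family_support \<gamma> \<subseteq> cube (size \<gamma>)"
proof
  fix v assume v: "v \<in> family_support \<gamma>"
  then have "(0, v) \<in> {(x, y). {x, y} \<in> set_mset \<gamma>}\<^sup>*"
    using g(2) unfolding connects_def graph_connected_def by auto
  then have "{..<nat (ldist v 0)} \<subseteq> (\<lambda>A. nat (Min ((\<lambda>x. ldist x 0) ` A))) ` set_mset \<gamma>"
    using g(1) by (rule connected_levels)
  then have "nat (ldist v 0) \<le> card (set_mset \<gamma>)"
    using card_mono [OF finite_imageI [OF finite_set_mset]] card_image_le [OF finite_set_mset] by (metis card_lessThan order_trans)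
  also have "card (set_mset \<gamma>) \<le> size \<gamma>"
    by (simp add: size_multiset_overloaded_eq) (metis card_eq_sum count_greater_eq_one_iff sum_mono)
  finally have "ldist v 0 \<le> int (size \<gamma>)" by simp
  then show "v \<in> cube (size \<gamma>)" using ldist_cube [of 0 0 v "size \<gamma>"] by simp
qed

lemma connected_cube_bonds:
  fixes \<gamma> :: "(int ^ 'n::finite) set multiset"
  assumes "\<gamma> \<in> bond_families" "connects \<gamma> (0 # b)" "size \<gamma> \<le> N"
  shows "set_mset \<gamma> \<subseteq> cube_bonds N"
  using connected_support_in_cube [OF assms(1,2)] cube_mono [OF assms(3)] assms(1)
  by (auto simp: cube_bonds_def bond_families_def family_support_def)

lemma connects_pair:
  fixes t :: "int ^ 'n::finite"
  assumes g: "\<gamma> \<in> bond_families" and t: "t \<noteq> 0"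
  shows "connects \<gamma> [0, t] \<longleftrightarrow> connects \<gamma> [0] \<and> t \<in> family_support \<gamma>"
proof
  assume c: "connects \<gamma> [0, t]"
  then have "(0, t) \<in> {(x, y). {x, y} \<in> set_mset \<gamma>}\<^sup>*"
    unfolding connects_def graph_connected_def by auto
  then obtain y where "{y, t} \<in> set_mset \<gamma>" using t by (auto elim: rtranclE)
  then have "t \<in> family_support \<gamma>" unfolding family_support_def by blast
  then show "connects \<gamma> [0] \<and> t \<in> family_support \<gamma>"
    using c unfolding connects_def graph_connected_def by auto
next
  assume "connects \<gamma> [0] \<and> t \<in> family_support \<gamma>"
  then show "connects \<gamma> [0, t]" unfolding connects_def by (simp add: insert_absorb insert_commute)
qed

lemma finite_cube_families:
  "finite {\<gamma> :: (int ^ 'n::finite) set multiset. set_mset \<gamma> \<subseteq> cube_bonds N \<and> size \<gamma> = n}"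
  by (rule finite_families) simp

text \<open>The contribution of the point \<open>t\<close> to \<open>var_coeff\<close>. It turns out to be a Taylor coefficient of the pair
  correlation of \<open>0\<close> and \<open>t\<close>.\<close>

definition pair_coeff :: "int ^ 'n::finite \<Rightarrow> nat \<Rightarrow> real" where
  "pair_coeff t n = (\<Sum>\<gamma> | \<gamma> \<in> bond_families \<and> size \<gamma> = n \<and> connects \<gamma> [0, t].
     1 / real (family_fact \<gamma>) * semi_inv0 ([spin 0, spin t] @ map spin_prod (family_seq \<gamma>)))"

text \<open>Exchange the two finite sums; a connected family of size \<open>n\<close> only sees points of \<open>cube n\<close>.\<close>

lemma var_coeff_eq_sum_pair_coeff:
  assumes M: "n \<le> M"
  shows "var_coeff TYPE('n::finite) n = (\<Sum>t\<in>cube M - {0 :: int ^ 'n}. pair_coeff t n)"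
proof -
  let ?G = "{\<gamma> :: (int ^ 'n) set multiset. \<gamma> \<in> bond_families \<and> size \<gamma> = n \<and> connects \<gamma> [0]}"
  let ?F = "\<lambda>\<gamma> t. 1 / real (family_fact \<gamma>) * semi_inv0 ([spin 0, spin t] @ map spin_prod (family_seq \<gamma>))"
  have fG: "finite ?G"
    by (rule finite_subset [OF _ finite_cube_families [of n n]]) (auto dest: connected_cube_bonds)
  have "(\<Sum>\<gamma>\<in>?G. \<Sum>t | t \<in> family_support \<gamma> \<and> t \<noteq> 0 \<and> connects \<gamma> [0, t]. ?F \<gamma> t)
      = (\<Sum>\<gamma>\<in>?G. \<Sum>t | t \<in> cube M - {0} \<and> connects \<gamma> [0, t]. ?F \<gamma> t)"
  proof (intro sum.cong refl)
    fix \<gamma> :: "(int ^ 'n) set multiset" assume g: "\<gamma> \<in> ?G"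
    then have "family_support \<gamma> \<subseteq> cube M"
      using connected_support_in_cube [of \<gamma> "[]"] cube_mono [OF M] by auto
    then show "{t. t \<in> family_support \<gamma> \<and> t \<noteq> 0 \<and> connects \<gamma> [0, t]} = {t. t \<in> cube M - {0} \<and> connects \<gamma> [0, t]}"
      using g by (auto simp: connects_pair)
  qed
  also have "\<dots> = (\<Sum>t\<in>cube M - {0}. \<Sum>\<gamma> | \<gamma> \<in> ?G \<and> connects \<gamma> [0, t]. ?F \<gamma> t)"
    by (rule sum.swap_restrict [OF fG]) simp
  also have "\<dots> = (\<Sum>t\<in>cube M - {0 :: int ^ 'n}. pair_coeff t n)"
  proof (rule sum.cong [OF refl])
    fix t :: "int ^ 'n" assume "t \<in> cube M - {0}"
    then have "{\<gamma>. \<gamma> \<in> ?G \<and> connects \<gamma> [0, t]} = {\<gamma>. \<gamma> \<in> bond_families \<and> size \<gamma> = n \<and> connects \<gamma> [0, t]}"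
      by (auto simp: connects_pair)
    then show "(\<Sum>\<gamma> | \<gamma> \<in> ?G \<and> connects \<gamma> [0, t]. ?F \<gamma> t) = pair_coeff t n"
      by (simp add: pair_coeff_def)
  qed
  finally show ?thesis by (simp add: var_coeff_def)
qed

text \<open>Let \<open>U\<close> be the component of a vertex \<open>u\<close> that is not linked to all others. Every bond lies inside \<open>U\<close> or
  misses it, so the variables fall into functions of the spins in \<open>U\<close> and functions of the spins
  outside, and both kinds occur. These two groups are independent for \<open>lam = 0\<close>.\<close>

lemma cumulant_disconnected:
  fixes t :: "int ^ 'n::finite"
  assumes g: "set_mset \<gamma> \<subseteq> cube_bonds N" and t: "t \<in> cube N" and nc: "\<not> connects \<gamma> [0, t]"
  shows "cumulant (gibbs_mean 0 N) (map chi ([{0}, {t}] @ family_seq \<gamma>)) = 0"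
proof -
  let ?r = "{(x, y). {x, y} \<in> set_mset \<gamma>}"
  let ?V = "{0, t} \<union> family_support \<gamma>"
  obtain u v where uv: "u \<in> ?V" "v \<in> ?V" "(u, v) \<notin> ?r\<^sup>*"
    using nc by (auto simp: connects_def graph_connected_def)
  \<comment> \<open>the component of \<open>u\<close>\<close>
  define U where "U = {x. (u, x) \<in> ?r\<^sup>*}"
  have uU: "u \<in> U" "v \<notin> U" using uv by (auto simp: U_def)
  define Ts where "Ts = [{0}, {t}] @ family_seq \<gamma>"
  have setTs: "set Ts = {{0}, {t}} \<union> set_mset \<gamma>"
    unfolding Ts_def using set_mset_mset [of "family_seq \<gamma>"] by auto
  have cubeTs: "T \<subseteq> cube N" if "T \<in> set Ts" for T using that g t by (auto simp: setTs cube_bonds_def)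
  have split: "T \<subseteq> U \<or> T \<inter> U = {}" if T: "T \<in> set Ts" for T
  proof (cases "T \<in> set_mset \<gamma>")
    case True
    then obtain x y where xy: "T = {x, y}" using g by (auto simp: cube_bonds_def bonds_def)
    then have "(x, y) \<in> ?r" "(y, x) \<in> ?r" using True by (auto simp: insert_commute)
    then have "x \<in> U \<longleftrightarrow> y \<in> U" unfolding U_def by (auto intro: rtrancl_into_rtrancl)
    then show ?thesis using xy by auto
  qed (use T in \<open>auto simp: setTs\<close>)
  \<comment> \<open>the tag \<open>True\<close> marks functions of the spins in \<open>U\<close>\<close>
  define side where "side b = (if b then U else - U)" for b
  define \<X> where "\<X> b = {X. \<exists>T \<subseteq> side b \<inter> cube N. \<forall>\<delta>\<in>cube_configs N. X \<delta> = chi T \<delta>}" for b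
  have val: "gibbs_mean 0 N X = (if T = {} then 1 else 0)" if "T \<subseteq> cube N" "\<forall>\<delta>\<in>cube_configs N. X \<delta> = chi T \<delta>" for X and T :: "(int ^ 'n) set"
  proof -
    have "gibbs_mean 0 N X = gibbs_mean 0 N (chi T)" by (rule gibbs_mean_cong) (use that in auto)
    then show ?thesis using gibbs_mean_zero_chi [OF that(1)] by simp
  qed
  have prodc: "\<forall>\<delta>\<in>cube_configs N. X \<delta> * Y \<delta> = chi (symdiff S T) \<delta>"
    if "S \<subseteq> cube N" "T \<subseteq> cube N" "\<forall>\<delta>\<in>cube_configs N. X \<delta> = chi S \<delta>" "\<forall>\<delta>\<in>cube_configs N. Y \<delta> = chi T \<delta>" for X Y and S T :: "(int ^ 'n) set"
  proof
    fix \<delta> :: "int ^ 'n \<Rightarrow> real" assume d: "\<delta> \<in> cube_configs N"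
    have "chi S \<delta> * chi T \<delta> = chi (symdiff S T) \<delta>"
      using that(1,2) by (intro chi_symdiff cube_config_values [OF d]) (auto intro: finite_subset)
    then show "X \<delta> * Y \<delta> = chi (symdiff S T) \<delta>" using that d by simp
  qed
  let ?ts = "map (\<lambda>T. (T \<subseteq> U, chi T)) Ts"
  have "cumulant (gibbs_mean 0 N) (map snd ?ts) = 0"
  proof (rule cumulant_independent [where \<X> = \<X>])
    show "(\<lambda>_. 1) \<in> \<X> b" for b
      unfolding \<X>_def by (intro CollectI exI [of _ "{}"]) auto
    show "(\<lambda>\<omega>. X \<omega> * Y \<omega>) \<in> \<X> b" if XY: "X \<in> \<X> b" "Y \<in> \<X> b" for b X Y
    proof -
      obtain S T where S: "S \<subseteq> side b \<inter> cube N" "\<forall>\<delta>\<in>cube_configs N. X \<delta> = chi S \<delta>"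
        and T: "T \<subseteq> side b \<inter> cube N" "\<forall>\<delta>\<in>cube_configs N. Y \<delta> = chi T \<delta>" using XY by (auto simp: \<X>_def)
      have "\<forall>\<delta>\<in>cube_configs N. X \<delta> * Y \<delta> = chi (symdiff S T) \<delta>" using S T by (intro prodc) auto
      moreover have "symdiff S T \<subseteq> side b \<inter> cube N" using S T by (intro symdiff_subset) auto
      ultimately show ?thesis unfolding \<X>_def by blast
    qed
    show "linear_expectation (gibbs_mean 0 N :: ((int ^ 'n \<Rightarrow> real) \<Rightarrow> complex) \<Rightarrow> complex)"
      using rad0_pos [where 'n = 'n] by (intro linear_expectation_gibbs_mean) simp
    show "gibbs_mean 0 N (\<lambda>\<omega>. X \<omega> * Y \<omega>) = gibbs_mean 0 N X * gibbs_mean 0 N Y" if XY: "X \<in> \<X> b" "Y \<in> \<X> (\<not> b)" for b X Y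
    proof -
      obtain S T where S: "S \<subseteq> side b \<inter> cube N" "\<forall>\<delta>\<in>cube_configs N. X \<delta> = chi S \<delta>"
        and T: "T \<subseteq> side (\<not> b) \<inter> cube N" "\<forall>\<delta>\<in>cube_configs N. Y \<delta> = chi T \<delta>" using XY by (auto simp: \<X>_def)
      have "S \<inter> T = {}" using S T by (auto simp: side_def split: if_splits)
      then have e: "symdiff S T = {} \<longleftrightarrow> S = {} \<and> T = {}" by (auto simp: symdiff_def)
      have "gibbs_mean 0 N (\<lambda>\<omega>. X \<omega> * Y \<omega>) = (if symdiff S T = {} then 1 else 0)"
      proof (rule val)
        show "symdiff S T \<subseteq> cube N" using S T by (intro symdiff_subset) auto
        show "\<forall>\<delta>\<in>cube_configs N. X \<delta> * Y \<delta> = chi (symdiff S T) \<delta>" using S T by (intro prodc) auto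
      qed
      moreover have "gibbs_mean 0 N X = (if S = {} then 1 else 0)" by (rule val) (use S in auto)
      moreover have "gibbs_mean 0 N Y = (if T = {} then 1 else 0)" by (rule val) (use T in auto)
      ultimately show ?thesis using e by auto
    qed
    show "X \<in> \<X> b" if bX: "(b, X) \<in> set ?ts" for b X
    proof -
      obtain T where T: "T \<in> set Ts" "b = (T \<subseteq> U)" "X = chi T" using bX by auto
      then have "T \<subseteq> side b \<inter> cube N" using split [OF T(1)] cubeTs [OF T(1)] by (auto simp: side_def)
      then show ?thesis using T unfolding \<X>_def by blast
    qed
    have mem: "\<exists>T\<in>set Ts. x \<in> T" if "x \<in> ?V" for x
      using that by (auto simp: setTs family_support_def)
    have fsts: "fst ` set ?ts = (\<lambda>T. T \<subseteq> U) ` set Ts" by (simp add: image_image)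
    obtain T where "T \<in> set Ts" "u \<in> T" using mem [OF uv(1)] by auto
    then have "T \<subseteq> U" using split [of T] uU by auto
    with \<open>T \<in> set Ts\<close> show "True \<in> fst ` set ?ts"
      unfolding fsts by (intro image_eqI [of _ _ T]) simp_all
    obtain T where T: "T \<in> set Ts" "v \<in> T" using mem [OF uv(2)] by auto
    then have "\<not> T \<subseteq> U" using uU by auto
    with T show "False \<in> fst ` set ?ts"
      unfolding fsts by (intro image_eqI [of _ _ T]) simp_all
  qed
  moreover have "map snd ?ts = map chi Ts" by simp
  ultimately have "cumulant (gibbs_mean 0 N) (map chi Ts) = 0" by (simp only:)
  then show ?thesis unfolding Ts_def .
qed

text \<open>The coefficient does not depend on \<open>N\<close> once \<open>n \<le> N\<close>, because the families that contribute lie in \<open>cube n\<close>.\<close>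

lemma pair_coeff_eq_deriv:
  fixes t :: "int ^ 'n::finite"
  assumes t: "t \<noteq> 0" "t \<in> cube N" and n: "n \<le> N"
  shows "(deriv ^^ n) (\<lambda>z. corr z (\<lambda>_. 0) N {0, t}) 0 / fact n = of_real (pair_coeff t n)"
proof -
  let ?K = "\<lambda>As. cumulant (gibbs_mean 0 N) (map chi ([{0}, {t}] @ As))"
  let ?C = "{\<gamma> :: (int ^ 'n) set multiset. set_mset \<gamma> \<subseteq> cube_bonds N \<and> size \<gamma> = n}"
  let ?G = "{\<gamma> :: (int ^ 'n) set multiset. \<gamma> \<in> bond_families \<and> size \<gamma> = n \<and> connects \<gamma> [0, t]}"
  have "(\<lambda>z. corr z (\<lambda>_. 0) N {0, t}) = (\<lambda>z. cumulant (gibbs_mean z N) (map chi [{0}, {t}]))"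
    using corr_pair_cumulant [OF t] by auto
  then have "(deriv ^^ n) (\<lambda>z. corr z (\<lambda>_. 0) N {0, t}) 0 = (\<Sum>As | set As \<subseteq> cube_bonds N \<and> length As = n. ?K As)"
    using cumulant_higher_deriv [of "[{0}, {t}]" 0 n N] rad0_pos [where 'n = 'n] by simp
  then have "(deriv ^^ n) (\<lambda>z. corr z (\<lambda>_. 0) N {0, t}) 0 / fact n = (\<Sum>\<gamma>\<in>?C. 1 / of_nat (family_fact \<gamma>) * ?K (family_seq \<gamma>))"
    by (simp only: sum_lists_by_family [OF finite_cube_bonds cumulant_permute] mset_map mset_append)
  also have "\<dots> = (\<Sum>\<gamma>\<in>?G. 1 / of_nat (family_fact \<gamma>) * ?K (family_seq \<gamma>))"
  proof (rule sum.mono_neutral_right [OF finite_cube_families])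
    show "?G \<subseteq> ?C" using connected_cube_bonds [of _ "[t]" N] n by auto
    show "\<forall>\<gamma>\<in>?C - ?G. 1 / of_nat (family_fact \<gamma>) * ?K (family_seq \<gamma>) = 0"
    proof
      fix \<gamma> assume "\<gamma> \<in> ?C - ?G"
      then have "set_mset \<gamma> \<subseteq> cube_bonds N" "\<not> connects \<gamma> [0, t]"
        by (auto simp: bond_families_def cube_bonds_def)
      then show "1 / of_nat (family_fact \<gamma>) * ?K (family_seq \<gamma>) = 0"
        using cumulant_disconnected [OF _ t(2)] by simp
    qed
  qed
  also have "\<dots> = (\<Sum>\<gamma>\<in>?G. of_real (1 / real (family_fact \<gamma>) * semi_inv0 ([spin 0, spin t] @ map spin_prod (family_seq \<gamma>))))"
  proof (rule sum.cong [OF refl])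
    fix \<gamma> assume g: "\<gamma> \<in> ?G"
    then have sub: "set_mset \<gamma> \<subseteq> cube_bonds N" using connected_cube_bonds [of _ "[t]" N] n by auto
    have sp: "spin x = spin_prod {x}" for x :: "int ^ 'n" by (simp add: spin_prod_def fun_eq_iff)
    have "complex_of_real (semi_inv0 (map spin_prod ([{0}, {t}] @ family_seq \<gamma>))) = ?K (family_seq \<gamma>)"
    proof (rule semi_inv0_eq)
      fix T assume "T \<in> set ([{0}, {t}] @ family_seq \<gamma>)"
      then have "T \<in> {{0}, {t}} \<union> set_mset \<gamma>" using set_mset_mset [of "family_seq \<gamma>"] by auto
      then show "T \<subseteq> cube N" using sub t by (auto simp: cube_bonds_def)
    qed
    then show "1 / of_nat (family_fact \<gamma>) * ?K (family_seq \<gamma>) = of_real (1 / real (family_fact \<gamma>) * semi_inv0 ([spin 0, spin t] @ map spin_prod (family_seq \<gamma>)))"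
      by (simp add: sp)
  qed
  finally show ?thesis by (simp add: pair_coeff_def)
qed

section \<open>Translation invariance\<close>

lemma walsh_translate:
  fixes u :: "'v::ab_group_add"
  assumes F: "finite F" and S: "S \<subseteq> F" and f: "\<And>\<eta>. \<eta> \<in> (+) u ` F \<rightarrow>\<^sub>E {-1, 1} \<Longrightarrow> f' \<eta> = f (\<lambda>s\<in>F. \<eta> (u + s))"
  shows "walsh ((+) u ` F) f' ((+) u ` S) = walsh F f S"
proof -
  have "(\<Sum>\<eta>\<in>(+) u ` F \<rightarrow>\<^sub>E {-1, 1}. f' \<eta> * chi ((+) u ` S) \<eta>) = (\<Sum>\<eta>\<in>F \<rightarrow>\<^sub>E {-1, 1}. f \<eta> * chi S \<eta>)"
  proof (rule sum.reindex_bij_witness [of _ "\<lambda>\<zeta>. \<lambda>s\<in>(+) u ` F. \<zeta> (s - u)" "\<lambda>\<eta>. \<lambda>s\<in>F. \<eta> (u + s)"])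
    fix \<eta> assume e: "\<eta> \<in> (+) u ` F \<rightarrow>\<^sub>E {-1, 1::real}"
    show "(\<lambda>s\<in>(+) u ` F. (\<lambda>s\<in>F. \<eta> (u + s)) (s - u)) = \<eta>"
      using e by (auto simp: fun_eq_iff PiE_def extensional_def restrict_def)
    show "(\<lambda>s\<in>F. \<eta> (u + s)) \<in> F \<rightarrow>\<^sub>E {-1, 1}" using e by auto
    have "chi ((+) u ` S) \<eta> = (\<Prod>s\<in>S. complex_of_real (\<eta> (u + s)))"
      unfolding chi_def by (subst prod.reindex) auto
    also have "\<dots> = chi S (\<lambda>s\<in>F. \<eta> (u + s))"
      unfolding chi_def by (rule prod.cong) (use S in auto)
    finally show "f (\<lambda>s\<in>F. \<eta> (u + s)) * chi S (\<lambda>s\<in>F. \<eta> (u + s)) = f' \<eta> * chi ((+) u ` S) \<eta>"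
      using f [OF e] by simp
  next
    fix \<zeta> assume z: "\<zeta> \<in> F \<rightarrow>\<^sub>E {-1, 1::real}"
    show "(\<lambda>s\<in>F. (\<lambda>s\<in>(+) u ` F. \<zeta> (s - u)) (u + s)) = \<zeta>"
      using z by (auto simp: fun_eq_iff PiE_def extensional_def restrict_def)
    show "(\<lambda>s\<in>(+) u ` F. \<zeta> (s - u)) \<in> (+) u ` F \<rightarrow>\<^sub>E {-1, 1}" using z by auto
  qed
  moreover have "card ((+) u ` F) = card F" by (rule card_image) simp
  ultimately show ?thesis by (simp add: walsh_def)
qed

lemma ldist_translate: "ldist (u + s) (u + t) = ldist s t"
  by (simp add: ldist_def)

lemma callen_translate:
  fixes t u :: "int ^ 'n::finite"
  assumes int: "\<And>s. ldist s t \<le> 1 \<Longrightarrow> s \<in> cube N \<and> u + s \<in> cube N"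
  shows "nbrs N (u + t) = (+) u ` nbrs N t"
    and "S \<subseteq> nbrs N t \<Longrightarrow> callen_coeff lam (\<lambda>_. 0) N (u + t) ((+) u ` S) = callen_coeff lam (\<lambda>_. 0) N t S"
proof -
  show nbrs: "nbrs N (u + t) = (+) u ` nbrs N t"
  proof (intro set_eqI iffI)
    fix s assume "s \<in> nbrs N (u + t)"
    then have "ldist (s - u) t = 1" using ldist_translate [of u "s - u" t] by (simp add: nbrs_def)
    then have "s - u \<in> nbrs N t" using int [of "s - u"] by (simp add: nbrs_def)
    then show "s \<in> (+) u ` nbrs N t" by (rule rev_image_eqI) simp
  next
    fix s assume "s \<in> (+) u ` nbrs N t"
    then show "s \<in> nbrs N (u + t)" using int by (auto simp: nbrs_def ldist_translate)
  qed
  assume S: "S \<subseteq> nbrs N t"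
  have "t \<in> cube N" "u + t \<in> cube N" using int [of t] by auto
  moreover have "walsh ((+) u ` nbrs N t) (\<lambda>\<eta>. tanh (lam * (\<Sum>s\<in>(+) u ` nbrs N t. complex_of_real (\<eta> s)) + 0)) ((+) u ` S)
      = walsh (nbrs N t) (\<lambda>\<eta>. tanh (lam * (\<Sum>s\<in>nbrs N t. complex_of_real (\<eta> s)) + 0)) S"
  proof (rule walsh_translate [OF finite_nbrs S])
    fix \<eta> :: "int ^ 'n \<Rightarrow> real"
    have "(\<Sum>s\<in>(+) u ` nbrs N t. complex_of_real (\<eta> s)) = (\<Sum>s\<in>nbrs N t. complex_of_real (\<eta> (u + s)))"
      by (subst sum.reindex) auto
    also have "\<dots> = (\<Sum>s\<in>nbrs N t. complex_of_real ((\<lambda>s\<in>nbrs N t. \<eta> (u + s)) s))"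
      by (rule sum.cong) auto
    finally show "tanh (lam * (\<Sum>s\<in>(+) u ` nbrs N t. complex_of_real (\<eta> s)) + 0)
        = tanh (lam * (\<Sum>s\<in>nbrs N t. complex_of_real ((\<lambda>s\<in>nbrs N t. \<eta> (u + s)) s)) + 0)" by simp
  qed
  ultimately show "callen_coeff lam (\<lambda>_. 0) N (u + t) ((+) u ` S) = callen_coeff lam (\<lambda>_. 0) N t S"
    by (simp add: callen_coeff_def nbrs)
qed

lemma callen_at_translate:
  fixes t u :: "int ^ 'n::finite"
  assumes lam: "norm lam \<le> rad0 TYPE('n)" and int: "\<And>s. ldist s t \<le> 1 \<Longrightarrow> s \<in> cube N \<and> u + s \<in> cube N"
  shows "callen_at (nbrs N) (callen_coeff lam (\<lambda>_. 0) N) (\<lambda>T. corr lam (\<lambda>_. 0) N ((+) u ` T)) t"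
  unfolding callen_at_def
proof (intro allI impI)
  fix T :: "(int ^ 'n) set" assume T: "finite T" "t \<in> T"
  have inj: "inj_on ((`) ((+) u)) (Pow (nbrs N t))" by (auto simp: inj_on_def inj_image_eq_iff)
  have "corr lam (\<lambda>_. 0) N ((+) u ` T) = (\<Sum>S\<in>Pow (nbrs N (u + t)). callen_coeff lam (\<lambda>_. 0) N (u + t) S * corr lam (\<lambda>_. 0) N (symdiff ((+) u ` T - {u + t}) S))"
    using callen_at_corr [OF high_temp_zero_field [OF lam], of N "u + t"] T by (simp add: callen_at_def)
  also have "Pow (nbrs N (u + t)) = (`) ((+) u) ` Pow (nbrs N t)"
    by (rule image_Pow_surj [symmetric], rule callen_translate(1) [symmetric], rule int)
  also have "(\<Sum>S\<in>(`) ((+) u) ` Pow (nbrs N t). callen_coeff lam (\<lambda>_. 0) N (u + t) S * corr lam (\<lambda>_. 0) N (symdiff ((+) u ` T - {u + t}) S))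
      = (\<Sum>S\<in>Pow (nbrs N t). callen_coeff lam (\<lambda>_. 0) N (u + t) ((+) u ` S) * corr lam (\<lambda>_. 0) N (symdiff ((+) u ` T - {u + t}) ((+) u ` S)))"
    by (simp add: sum.reindex [OF inj])
  also have "\<dots> = (\<Sum>S\<in>Pow (nbrs N t). callen_coeff lam (\<lambda>_. 0) N t S * corr lam (\<lambda>_. 0) N ((+) u ` symdiff (T - {t}) S))"
  proof (rule sum.cong [OF refl])
    fix S assume S: "S \<in> Pow (nbrs N t)"
    have "symdiff ((+) u ` T - {u + t}) ((+) u ` S) = (+) u ` symdiff (T - {t}) S" by (auto simp: symdiff_def)
    then show "callen_coeff lam (\<lambda>_. 0) N (u + t) ((+) u ` S) * corr lam (\<lambda>_. 0) N (symdiff ((+) u ` T - {u + t}) ((+) u ` S))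
        = callen_coeff lam (\<lambda>_. 0) N t S * corr lam (\<lambda>_. 0) N ((+) u ` symdiff (T - {t}) S)"
      using callen_translate(2) [OF int] S by simp
  qed
  finally show "corr lam (\<lambda>_. 0) N ((+) u ` T) = (\<Sum>S\<in>Pow (nbrs N t). callen_coeff lam (\<lambda>_. 0) N t S * corr lam (\<lambda>_. 0) N ((+) u ` symdiff (T - {t}) S))" .
qed

lemma cube_add: "s \<in> cube M \<Longrightarrow> u \<in> cube K \<Longrightarrow> u + s \<in> cube (K + M)"
  unfolding cube_def by (auto intro!: order_trans [OF abs_triangle_ineq add_mono])

text \<open>Translated correlations solve the same equation at sites far from the boundary, and \<open>corr_decay\<close> applies to
  the difference.\<close>

lemma corr_lim_translate:
  fixes u :: "int ^ 'n::finite"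
  assumes lam: "norm lam \<le> rad0 TYPE('n)" and T: "finite T"
  shows "corr_lim lam ((+) u ` T) = corr_lim lam T"
proof -
  note sm = high_temp_zero_field [OF lam]
  obtain M where M: "T \<subseteq> cube M" using finite_subset_cube [OF T] .
  obtain K where K: "{u} \<subseteq> cube K" using finite_subset_cube [of "{u}"] by auto
  have bound: "norm (corr lam (\<lambda>_. 0) N ((+) u ` T) - corr lam (\<lambda>_. 0) N T) \<le> 2 * kappa0 TYPE('n) ^ n"
    if N: "K + (M + n) \<le> N" for N n
  proof (rule corr_decay [OF sm, where D = "\<lambda>T. corr lam (\<lambda>_. 0) N ((+) u ` T) - corr lam (\<lambda>_. 0) N T" and N = N
      and U = "{t. \<forall>s. ldist s t \<le> 1 \<longrightarrow> s \<in> cube N \<and> u + s \<in> cube N}"])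
    show "norm (corr lam (\<lambda>_. 0) N ((+) u ` T) - corr lam (\<lambda>_. 0) N T) \<le> 2" for T
      using norm_triangle_ineq4 [of "corr lam (\<lambda>_. 0) N ((+) u ` T)" "corr lam (\<lambda>_. 0) N T"]
        norm_corr_le [OF sm, of N T] norm_corr_le [OF sm, of N "(+) u ` T"] by linarith
    show "callen_at (nbrs N) (callen_coeff lam (\<lambda>_. 0) N) (\<lambda>T. corr lam (\<lambda>_. 0) N ((+) u ` T) - corr lam (\<lambda>_. 0) N T) t"
      if "t \<in> {t. \<forall>s. ldist s t \<le> 1 \<longrightarrow> s \<in> cube N \<and> u + s \<in> cube N}" for t
      using that by (intro callen_at_diff callen_at_translate [OF lam] callen_at_corr [OF sm]) auto
    fix t s assume t: "t \<in> T" "ldist s t < int n"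
    show "s \<in> {t. \<forall>s. ldist s t \<le> 1 \<longrightarrow> s \<in> cube N \<and> u + s \<in> cube N}"
    proof (intro CollectI allI impI)
      fix x assume "ldist x s \<le> 1"
      then have "ldist x t \<le> int n" using ldist_triangle [of x t s] t by linarith
      then have x: "x \<in> cube (M + n)" using t M by (intro ldist_cube) auto
      moreover have "u + x \<in> cube (K + (M + n))" using x K by (intro cube_add) auto
      ultimately show "x \<in> cube N \<and> u + x \<in> cube N"
        using cube_mono [OF N] cube_mono [of "M + n" N] N by auto
    qed
  qed (use T in auto)
  have lim: "(\<lambda>N. corr lam (\<lambda>_. 0) N ((+) u ` T) - corr lam (\<lambda>_. 0) N T) \<longlonglongrightarrow> corr_lim lam ((+) u ` T) - corr_lim lam T"
    using T by (intro tendsto_diff corr_lim lam) auto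
  have "norm (corr_lim lam ((+) u ` T) - corr_lim lam T) \<le> 2 * kappa0 TYPE('n) ^ n" for n
    by (rule Lim_norm_ubound [OF _ lim]) (auto intro!: eventually_sequentiallyI bound)
  then have "norm (corr_lim lam ((+) u ` T) - corr_lim lam T) \<le> 0"
    by (intro LIMSEQ_le_const [OF kappa0_power_tendsto [where 'n = 'n, of 2]]) auto
  then show ?thesis by simp
qed

section \<open>The limiting variance and its power series\<close>

definition pair_corr :: "real \<Rightarrow> int ^ 'n::finite \<Rightarrow> real" where
  "pair_corr lam t = (if t = 0 then 1 else limit_corr lam {0, t})"

lemma limit_corr_pair:
  fixes s t :: "int ^ 'n::finite"
  assumes lam: "\<bar>lam\<bar> \<le> rad0 TYPE('n)" and st: "s \<noteq> t"
  shows "limit_corr lam {s, t} = pair_corr lam (t - s)"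
proof -
  have l: "norm (complex_of_real lam) \<le> rad0 TYPE('n)" using lam by simp
  have "corr_lim (of_real lam) ((+) s ` {0, t - s}) = corr_lim (of_real lam) {0, t - s}"
    by (rule corr_lim_translate [OF l]) simp
  then have "complex_of_real (limit_corr lam {s, t}) = of_real (limit_corr lam {0, t - s})"
    by (simp add: limit_corr_tendsto(2) [OF lam])
  then show ?thesis using st by (simp add: pair_corr_def)
qed

lemma abs_pair_corr_le:
  assumes lam: "\<bar>lam\<bar> \<le> rad0 TYPE('n::finite)"
  shows "\<bar>pair_corr lam (t :: int ^ 'n)\<bar> \<le> kappa0 TYPE('n) ^ nat (ldist t 0)"
proof (cases "t = 0")
  case False
  have "norm (complex_of_real (limit_corr lam {t, 0})) \<le> kappa0 TYPE('n) ^ nat (ldist t 0)"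
    unfolding limit_corr_tendsto(2) [OF lam, of "{t, 0}", simplified]
    by (rule corr_lim_pair_decay) (use lam False in auto)
  then show ?thesis using False by (simp add: pair_corr_def insert_commute)
qed (simp add: pair_corr_def)

lemma sum_geometric_interval:
  fixes q :: real
  assumes q: "0 \<le> q" "q < 1"
  shows "(\<Sum>j\<in>{- int M..int M}. q ^ nat \<bar>j\<bar>) \<le> 1 + 2 * q / (1 - q)"
proof -
  have "(\<Sum>j\<in>{- int M..int M}. q ^ nat \<bar>j\<bar>) = 1 + 2 * (q - q ^ Suc M) / (1 - q)"
  proof (induction M)
    case (Suc M)
    have "{- int (Suc M)..int (Suc M)} = insert (- int (Suc M)) (insert (int (Suc M)) {- int M..int M})" by auto
    then have "(\<Sum>j\<in>{- int (Suc M)..int (Suc M)}. q ^ nat \<bar>j\<bar>) = 2 * q ^ Suc M + (\<Sum>j\<in>{- int M..int M}. q ^ nat \<bar>j\<bar>)"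
      by (simp add: nat_add_distrib)
    then show ?case using Suc q by (simp add: field_simps)
  qed simp
  also have "\<dots> \<le> 1 + 2 * q / (1 - q)" using q by (simp add: divide_right_mono)
  finally show ?thesis .
qed

lemma nat_sum_abs: "nat (\<Sum>i\<in>A. \<bar>x i :: int\<bar>) = (\<Sum>i\<in>A. nat \<bar>x i\<bar>)"
proof -
  have "int (\<Sum>i\<in>A. nat \<bar>x i\<bar>) = (\<Sum>i\<in>A. \<bar>x i\<bar>)" by simp
  then show ?thesis by (metis nat_int)
qed

text \<open>The sum factorizes over the coordinates into geometric sums; for \<open>\<kappa> = 1 / (8 \<nu>)\<close> it is at most
  \<open>((1 + \<kappa>) / (1 - \<kappa>)) ^ \<nu> \<le> exp (2/7)\<close>.\<close>

lemma sum_cube_decay: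
  "(\<Sum>t\<in>cube M. kappa0 TYPE('n) ^ nat (ldist (t :: int ^ 'n::finite) 0)) \<le> exp (2/7)"
proof -
  let ?q = "kappa0 TYPE('n)"
  have q: "0 \<le> ?q" "?q < 1" "?q \<le> 1/8" using kappa0_bounds [where 'n = 'n] by auto
  have "(cube M :: (int ^ 'n) set) = vec_lambda ` (UNIV \<rightarrow>\<^sub>E {- int M..int M})"
    unfolding cube_eq_box using vec_box_eq [of "\<lambda>_. {- int M..int M}"] by simp
  then have "(\<Sum>t\<in>(cube M :: (int ^ 'n) set). ?q ^ nat (ldist t 0)) = (\<Sum>g\<in>UNIV \<rightarrow>\<^sub>E {- int M..int M}. ?q ^ nat (ldist (vec_lambda g :: int ^ 'n) 0))"
    by (simp add: sum.reindex inj_vec_lambda)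
  also have "\<dots> = (\<Sum>g\<in>UNIV \<rightarrow>\<^sub>E {- int M..int M}. \<Prod>i\<in>(UNIV :: 'n set). ?q ^ nat \<bar>g i\<bar>)"
    by (rule sum.cong) (simp_all add: ldist_def nat_sum_abs power_sum)
  also have "\<dots> = (\<Prod>i\<in>(UNIV :: 'n set). \<Sum>j\<in>{- int M..int M}. ?q ^ nat \<bar>j\<bar>)"
    by (rule prod_sum_PiE [symmetric]) auto
  also have "\<dots> = (\<Sum>j\<in>{- int M..int M}. ?q ^ nat \<bar>j\<bar>) ^ CARD('n)" by simp
  also have "\<dots> \<le> (1 + 2 * ?q / (1 - ?q)) ^ CARD('n)"
    using q by (intro power_mono sum_geometric_interval sum_nonneg) auto
  also have "\<dots> \<le> exp (2 * ?q / (1 - ?q)) ^ CARD('n)"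
    using q by (intro power_mono exp_ge_add_one_self) auto
  also have "\<dots> = exp (real CARD('n) * (2 * ?q / (1 - ?q)))" by (rule exp_of_nat_mult [symmetric])
  also have "real CARD('n) * (2 * ?q / (1 - ?q)) = (1/4) / (1 - ?q)"
    by (simp add: kappa0_def)
  also have "(1/4) / (1 - ?q) \<le> 2/7" using q by (simp add: field_simps)
  finally show ?thesis by simp
qed

lemma exp_two_sevenths: "exp (2/7 :: real) < 2"
  using exp_bound [of "2/7 :: real"] by (simp add: power2_eq_square)

lemma integrable_decay:
  "integrable (count_space UNIV) (\<lambda>t :: int ^ 'n::finite. kappa0 TYPE('n) ^ nat (ldist t 0))"
proof -
  let ?f = "\<lambda>t :: int ^ 'n. kappa0 TYPE('n) ^ nat (ldist t 0)"
  have k: "0 \<le> kappa0 TYPE('n)" using kappa0_bounds(1) [where 'n = 'n] by simp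
  have "sum ?f F \<le> exp (2/7)" if fF: "finite F" for F :: "(int ^ 'n) set"
  proof -
    obtain M where "F \<subseteq> cube M" using finite_subset_cube [OF fF] .
    then have "sum ?f F \<le> sum ?f (cube M)" using k by (intro sum_mono2) auto
    also have "\<dots> \<le> exp (2/7)" by (rule sum_cube_decay)
    finally show ?thesis .
  qed
  then have "(\<lambda>t. norm (?f t)) summable_on UNIV"
    using k by (intro nonneg_bdd_above_summable_on bdd_aboveI [of _ "exp (2/7)"]) auto
  then have "Infinite_Set_Sum.abs_summable_on ?f UNIV" by (simp only: abs_summable_equivalent)
  then show ?thesis by (simp only: abs_summable_on_def)
qed

lemma integral_count_space_finite_sum:
  fixes f :: "'a \<Rightarrow> real"
  assumes "finite F" "\<And>t. t \<notin> F \<Longrightarrow> f t = 0"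
  shows "(\<integral>t. f t \<partial>count_space UNIV) = sum f F"
proof -
  have "finite {t. f t \<noteq> 0}" by (rule finite_subset [OF _ assms(1)]) (use assms(2) in auto)
  then have "(\<integral>t. f t \<partial>count_space UNIV) = (\<Sum>t | f t \<noteq> 0. f t)"
    by (subst lebesgue_integral_count_space_finite_support) auto
  also have "\<dots> = sum f F" by (rule sum.mono_neutral_left [OF assms(1)]) (use assms(2) in auto)
  finally show ?thesis .
qed

text \<open>The sum of the pair correlations over the lattice, as an integral for the counting measure, so that
  dominated convergence is available.\<close>

definition limit_variance :: "'n::finite itself \<Rightarrow> real \<Rightarrow> real" where
  "limit_variance _ lam = (\<integral>t. pair_corr lam (t :: int ^ 'n) \<partial>count_space UNIV)"

lemma limit_variance_cubes:
  assumes lam: "\<bar>lam\<bar> \<le> rad0 TYPE('n::finite)"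
  shows "(\<lambda>M. \<Sum>t\<in>cube M. pair_corr lam (t :: int ^ 'n)) \<longlonglongrightarrow> limit_variance TYPE('n) lam"
proof -
  have "(\<lambda>M. \<integral>t. indicator (cube M) t * pair_corr lam (t :: int ^ 'n) \<partial>count_space UNIV) \<longlonglongrightarrow> limit_variance TYPE('n) lam"
    unfolding limit_variance_def
  proof (rule integral_dominated_convergence [where w = "\<lambda>t. kappa0 TYPE('n) ^ nat (ldist t 0)"])
    show "AE t in count_space UNIV. (\<lambda>M. indicator (cube M) t * pair_corr lam (t :: int ^ 'n)) \<longlonglongrightarrow> pair_corr lam t"
    proof (rule AE_I2)
      fix t :: "int ^ 'n"
      have "eventually (\<lambda>M. indicator (cube M) t * pair_corr lam t = pair_corr lam t) sequentially"
        using eventually_subset_cube [of "{t}", simplified] by eventually_elim simp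
      then show "(\<lambda>M. indicator (cube M) t * pair_corr lam t) \<longlonglongrightarrow> pair_corr lam t" by (rule tendsto_eventually)
    qed
    show "AE t in count_space UNIV. norm (indicator (cube M) t * pair_corr lam (t :: int ^ 'n)) \<le> kappa0 TYPE('n) ^ nat (ldist t 0)" for M
    proof (rule AE_I2)
      fix t :: "int ^ 'n"
      show "norm (indicator (cube M) t * pair_corr lam t) \<le> kappa0 TYPE('n) ^ nat (ldist t 0)"
        using abs_pair_corr_le [OF lam, of t] order_trans [OF abs_ge_zero abs_pair_corr_le [OF lam, of t]]
        by (simp add: abs_mult indicator_def)
    qed
  qed (auto simp: integrable_decay)
  moreover have "(\<integral>t. indicator (cube M) t * pair_corr lam (t :: int ^ 'n) \<partial>count_space UNIV) = (\<Sum>t\<in>(cube M :: (int ^ 'n) set). pair_corr lam t)" for M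
  proof -
    have "(\<integral>t. indicator (cube M) t * pair_corr lam (t :: int ^ 'n) \<partial>count_space UNIV) = (\<Sum>t\<in>(cube M :: (int ^ 'n) set). indicator (cube M) t * pair_corr lam t)"
      by (rule integral_count_space_finite_sum) auto
    then show ?thesis by simp
  qed
  ultimately show ?thesis by simp
qed

lemma sum_cube_pair_decay:
  "(\<Sum>t\<in>cube M - {0}. kappa0 TYPE('n) ^ nat (ldist (t :: int ^ 'n::finite) 0)) \<le> exp (2/7) - 1"
proof -
  have "(\<Sum>t\<in>cube M. kappa0 TYPE('n) ^ nat (ldist (t :: int ^ 'n) 0)) = 1 + (\<Sum>t\<in>cube M - {0}. kappa0 TYPE('n) ^ nat (ldist (t :: int ^ 'n) 0))"
    by (subst sum.remove [of _ 0]) auto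
  then show ?thesis using sum_cube_decay [where 'n = 'n, of M] by linarith
qed

lemma limit_variance_pos:
  assumes lam: "\<bar>lam\<bar> \<le> rad0 TYPE('n::finite)"
  shows "0 < limit_variance TYPE('n) lam"
proof -
  have "2 - exp (2/7) \<le> (\<Sum>t\<in>cube M. pair_corr lam (t :: int ^ 'n))" for M
  proof -
    have "\<bar>\<Sum>t\<in>cube M - {0}. pair_corr lam (t :: int ^ 'n)\<bar> \<le> (\<Sum>t\<in>cube M - {0}. \<bar>pair_corr lam (t :: int ^ 'n)\<bar>)" by (rule sum_abs)
    also have "\<dots> \<le> (\<Sum>t\<in>cube M - {0}. kappa0 TYPE('n) ^ nat (ldist (t :: int ^ 'n) 0))"
      by (intro sum_mono abs_pair_corr_le lam)
    also have "\<dots> \<le> exp (2/7) - 1" by (rule sum_cube_pair_decay)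
    finally have "\<bar>\<Sum>t\<in>cube M - {0}. pair_corr lam (t :: int ^ 'n)\<bar> \<le> exp (2/7) - 1" .
    moreover have "(\<Sum>t\<in>cube M. pair_corr lam (t :: int ^ 'n)) = 1 + (\<Sum>t\<in>cube M - {0}. pair_corr lam (t :: int ^ 'n))"
      by (subst sum.remove [of _ 0]) (auto simp: pair_corr_def)
    ultimately show ?thesis by linarith
  qed
  then have "2 - exp (2/7) \<le> limit_variance TYPE('n) lam"
    by (intro LIMSEQ_le_const [OF limit_variance_cubes [OF lam]]) auto
  then show ?thesis using exp_two_sevenths by simp
qed

text \<open>In a cube the pair correlation is analytic and bounded by \<open>kappa0 ^ |t|\<close> on the disc of radius \<open>rad0\<close>. The
  Cauchy estimates bound the Taylor coefficients uniformly in the cube, the coefficients stabilize as the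
  cube grows, and Tannery's theorem gives the series of the limit.\<close>

lemma pair_expansion:
  fixes t :: "int ^ 'n::finite"
  assumes lam: "\<bar>lam\<bar> < rad0 TYPE('n)" and t: "t \<noteq> 0"
  shows "(\<lambda>n. pair_coeff t n * lam ^ n) sums limit_corr lam {0, t}"
    and "\<bar>pair_coeff t n\<bar> \<le> kappa0 TYPE('n) ^ nat (ldist t 0) / rad0 TYPE('n) ^ n"
proof -
  let ?r = "rad0 TYPE('n)" and ?k = "kappa0 TYPE('n) ^ nat (ldist t 0)"
  define g where "g N z = corr z (\<lambda>_. 0) N {0, t}" for N z
  define a where "a n N = (deriv ^^ n) (g N) 0 / fact n" for n N
  have r: "0 < ?r" by (rule rad0_pos)
  have ev_t: "eventually (\<lambda>N. t \<in> cube N) sequentially" using eventually_subset_cube [of "{t}"] by simp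
  have gd: "g N field_differentiable at z" if "norm z \<le> ?r" "t \<in> cube N" for N z
    using gibbs_mean_has_derivative [OF that(1), of N "chi {0, t}"] that(2)
    by (auto simp: g_def [abs_def] corr_eq_gibbs_mean field_differentiable_def)
  have gb: "norm (g N z) \<le> ?k" if "norm z \<le> ?r" for N z
    using corr_pair_decay [OF that, of t 0 N] t by (simp add: g_def insert_commute)
  have hol: "g N holomorphic_on ball 0 ?r" if "t \<in> cube N" for N
    unfolding holomorphic_on_def
  proof
    fix z :: complex assume "z \<in> ball 0 ?r"
    then have "g N field_differentiable at z" using gd [OF _ that] by simp
    then show "g N field_differentiable at z within ball 0 ?r" by (rule field_differentiable_at_within)
  qed
  have cont: "continuous_on (cball 0 ?r) (g N)" if "t \<in> cube N" for N
  proof (intro continuous_at_imp_continuous_on ballI)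
    fix z :: complex assume "z \<in> cball 0 ?r"
    then have "g N field_differentiable at z" using gd [OF _ that] by simp
    then show "isCont (g N) z" by (rule field_differentiable_imp_continuous_at)
  qed
  have ab: "norm (a n N) \<le> ?k / ?r ^ n" if "t \<in> cube N" for n N
  proof -
    have "norm ((deriv ^^ n) (g N) 0) \<le> fact n * ?k / ?r ^ n"
      by (rule Cauchy_inequality [OF hol [OF that] cont [OF that] r]) (simp add: gb)
    then show ?thesis by (simp add: a_def norm_divide field_simps)
  qed
  have ac: "eventually (\<lambda>N. a n N = of_real (pair_coeff t n)) sequentially" for n
    using ev_t eventually_ge_at_top [of n]
    by eventually_elim (simp add: a_def g_def [abs_def] pair_coeff_eq_deriv t)
  show "\<bar>pair_coeff t n\<bar> \<le> ?k / ?r ^ n" for n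
  proof -
    have "eventually (\<lambda>N. norm (complex_of_real (pair_coeff t n)) \<le> ?k / ?r ^ n) sequentially"
      using ev_t ac [of n] by eventually_elim (use ab in metis)
    then have "norm (complex_of_real (pair_coeff t n)) \<le> ?k / ?r ^ n" by simp
    then show ?thesis by simp
  qed
  let ?l = "complex_of_real lam"
  have summ: "summable (\<lambda>n. ?k * (\<bar>lam\<bar> / ?r) ^ n)"
    using lam r by (intro summable_mult summable_geometric) auto
  have kn: "0 \<le> ?k" using kappa0_bounds(1) [where 'n = 'n] by simp
  have tan: "eventually (\<lambda>N. summable (\<lambda>n. norm (a n N * ?l ^ n))) sequentially \<and>
      summable (\<lambda>n. norm (complex_of_real (pair_coeff t n) * ?l ^ n)) \<and>
      ((\<lambda>N. suminf (\<lambda>n. a n N * ?l ^ n)) \<longlongrightarrow> suminf (\<lambda>n. complex_of_real (pair_coeff t n) * ?l ^ n)) sequentially"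
  proof (rule tannerys_theorem [OF _ _ summ])
    show "(\<lambda>N. a n N * ?l ^ n) \<longlonglongrightarrow> complex_of_real (pair_coeff t n) * ?l ^ n" for n
      by (intro tendsto_mult_right tendsto_eventually ac)
    have "eventually (\<lambda>N. \<forall>n. norm (a n N * ?l ^ n) \<le> ?k * (\<bar>lam\<bar> / ?r) ^ n) sequentially"
      using ev_t
    proof eventually_elim
      case (elim N)
      show ?case
      proof
        fix n
        have "norm (a n N * ?l ^ n) = norm (a n N) * \<bar>lam\<bar> ^ n" by (simp add: norm_mult norm_power)
        also have "\<dots> \<le> ?k / ?r ^ n * \<bar>lam\<bar> ^ n" by (intro mult_right_mono ab elim) simp
        finally show "norm (a n N * ?l ^ n) \<le> ?k * (\<bar>lam\<bar> / ?r) ^ n" by (simp add: power_divide)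
      qed
    qed
    then show "eventually (\<lambda>(n, N). norm (a n N * ?l ^ n) \<le> ?k * (\<bar>lam\<bar> / ?r) ^ n) (at_top \<times>\<^sub>F sequentially)"
      unfolding eventually_prod_filter
      by (intro exI [of _ "\<lambda>_. True"] exI [of _ "\<lambda>N. \<forall>n. norm (a n N * ?l ^ n) \<le> ?k * (\<bar>lam\<bar> / ?r) ^ n"]) auto
  qed simp
  have "eventually (\<lambda>N. suminf (\<lambda>n. a n N * ?l ^ n) = corr ?l (\<lambda>_. 0) N {0, t}) sequentially"
    using ev_t
  proof eventually_elim
    case (elim N)
    have "((\<lambda>n. (deriv ^^ n) (g N) 0 / fact n * (?l - 0) ^ n) sums g N ?l)"
      by (rule holomorphic_power_series [OF hol [OF elim]]) (use lam in simp)
    then show ?case by (simp add: a_def g_def sums_iff)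
  qed
  with tan [THEN conjunct2, THEN conjunct2]
  have "(\<lambda>N. corr ?l (\<lambda>_. 0) N {0, t}) \<longlonglongrightarrow> suminf (\<lambda>n. complex_of_real (pair_coeff t n) * ?l ^ n)"
    by (rule Lim_transform_eventually)
  moreover have "(\<lambda>N. corr ?l (\<lambda>_. 0) N {0, t}) \<longlonglongrightarrow> corr_lim ?l {0, t}"
    by (rule corr_lim) (use lam in auto)
  ultimately have "suminf (\<lambda>n. complex_of_real (pair_coeff t n) * ?l ^ n) = corr_lim ?l {0, t}"
    by (rule LIMSEQ_unique)
  moreover have "corr_lim ?l {0, t} = of_real (limit_corr lam {0, t})"
    by (rule limit_corr_tendsto(2) [symmetric]) (use lam in auto)
  ultimately have "(\<lambda>n. complex_of_real (pair_coeff t n) * ?l ^ n) sums of_real (limit_corr lam {0, t})"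
    using summable_norm_cancel [OF tan [THEN conjunct2, THEN conjunct1]] by (simp add: sums_iff)
  then have "(\<lambda>n. complex_of_real (pair_coeff t n * lam ^ n)) sums of_real (limit_corr lam {0, t})" by simp
  then show "(\<lambda>n. pair_coeff t n * lam ^ n) sums limit_corr lam {0, t}" by (simp only: sums_of_real_iff)
qed

lemma pair_coeff_zero:
  fixes t :: "int ^ 'n::finite"
  shows "t \<noteq> 0 \<Longrightarrow> pair_coeff t 0 = 0"
proof -
  assume t: "t \<noteq> 0"
  have "\<not> connects {#} [0, t]"
    using t by (auto simp: connects_def graph_connected_def)
  then show ?thesis by (auto simp: pair_coeff_def intro!: sum.neutral)
qed

text \<open>Sum the series of the pair correlations over \<open>t\<close> in a cube. The bounds of \<open>pair_expansion\<close> are summable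
  over \<open>t\<close>, so Tannery's theorem applies once more as the cube grows.\<close>

lemma limit_variance_series:
  assumes lam: "\<bar>lam\<bar> < rad0 TYPE('n::finite)"
  shows "(\<lambda>n. lam ^ Suc n * var_coeff TYPE('n) (Suc n)) sums (limit_variance TYPE('n) lam - 1)"
proof -
  let ?r = "rad0 TYPE('n)"
  have r: "0 < ?r" by (rule rad0_pos)
  define b where "b n M = (\<Sum>t\<in>cube M - {0 :: int ^ 'n}. pair_coeff t n) * lam ^ n" for n M
  have bs: "(\<lambda>n. b n M) sums (\<Sum>t\<in>cube M - {0 :: int ^ 'n}. pair_corr lam t)" for M
  proof -
    have "(\<lambda>n. \<Sum>t\<in>cube M - {0 :: int ^ 'n}. pair_coeff t n * lam ^ n) sums (\<Sum>t\<in>cube M - {0 :: int ^ 'n}. limit_corr lam {0, t})"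
      by (rule sums_sum) (use pair_expansion(1) [OF lam] in auto)
    then show ?thesis by (simp add: b_def sum_distrib_right pair_corr_def)
  qed
  have summ: "summable (\<lambda>n. (exp (2/7) - 1) * (\<bar>lam\<bar> / ?r) ^ n)"
    using lam r by (intro summable_mult summable_geometric) auto
  have bb: "norm (b n M) \<le> (exp (2/7) - 1) * (\<bar>lam\<bar> / ?r) ^ n" for n M
  proof -
    have "\<bar>\<Sum>t\<in>cube M - {0 :: int ^ 'n}. pair_coeff t n\<bar> \<le> (\<Sum>t\<in>cube M - {0 :: int ^ 'n}. kappa0 TYPE('n) ^ nat (ldist t 0) / ?r ^ n)"
      by (rule order_trans [OF sum_abs sum_mono]) (use pair_expansion(2) [OF lam] in auto)
    also have "\<dots> \<le> (exp (2/7) - 1) / ?r ^ n"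
      unfolding sum_divide_distrib [symmetric] using r by (intro divide_right_mono sum_cube_pair_decay) auto
    finally have "\<bar>\<Sum>t\<in>cube M - {0 :: int ^ 'n}. pair_coeff t n\<bar> * \<bar>lam\<bar> ^ n \<le> (exp (2/7) - 1) / ?r ^ n * \<bar>lam\<bar> ^ n"
      by (rule mult_right_mono) simp
    then show ?thesis by (simp add: b_def abs_mult power_abs power_divide)
  qed
  have tan: "eventually (\<lambda>M. summable (\<lambda>n. norm (b n M))) sequentially \<and>
      summable (\<lambda>n. norm (var_coeff TYPE('n) n * lam ^ n)) \<and>
      ((\<lambda>M. suminf (\<lambda>n. b n M)) \<longlongrightarrow> suminf (\<lambda>n. var_coeff TYPE('n) n * lam ^ n)) sequentially"
  proof (rule tannerys_theorem [OF _ _ summ])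
    show "(\<lambda>M. b n M) \<longlonglongrightarrow> var_coeff TYPE('n) n * lam ^ n" for n
    proof (rule tendsto_eventually)
      show "eventually (\<lambda>M. b n M = var_coeff TYPE('n) n * lam ^ n) sequentially"
        using eventually_ge_at_top [of n] by eventually_elim (simp add: b_def var_coeff_eq_sum_pair_coeff)
    qed
    show "eventually (\<lambda>(n, M). norm (b n M) \<le> (exp (2/7) - 1) * (\<bar>lam\<bar> / ?r) ^ n) (at_top \<times>\<^sub>F sequentially)"
      by (auto intro!: always_eventually bb simp del: real_norm_def)
  qed simp
  have "(\<lambda>M. suminf (\<lambda>n. b n M)) \<longlonglongrightarrow> limit_variance TYPE('n) lam - 1"
  proof -
    have "(\<lambda>M. (\<Sum>t\<in>cube M. pair_corr lam (t :: int ^ 'n)) - 1) \<longlonglongrightarrow> limit_variance TYPE('n) lam - 1"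
      by (intro tendsto_diff limit_variance_cubes tendsto_const) (use lam in auto)
    moreover have "(\<Sum>t\<in>cube M. pair_corr lam (t :: int ^ 'n)) - 1 = suminf (\<lambda>n. b n M)" for M
    proof -
      have "(\<Sum>t\<in>cube M. pair_corr lam (t :: int ^ 'n)) = 1 + (\<Sum>t\<in>cube M - {0}. pair_corr lam (t :: int ^ 'n))"
        by (subst sum.remove [of _ 0]) (auto simp: pair_corr_def)
      then show ?thesis using bs [of M] by (simp add: sums_iff)
    qed
    ultimately show ?thesis by simp
  qed
  with tan [THEN conjunct2, THEN conjunct2]
  have "suminf (\<lambda>n. var_coeff TYPE('n) n * lam ^ n) = limit_variance TYPE('n) lam - 1"
    by (rule LIMSEQ_unique)
  then have "(\<lambda>n. var_coeff TYPE('n) n * lam ^ n) sums (limit_variance TYPE('n) lam - 1)"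
    using summable_norm_cancel [OF tan [THEN conjunct2, THEN conjunct1]] by (simp add: sums_iff)
  moreover have "var_coeff TYPE('n) 0 = 0"
    using var_coeff_eq_sum_pair_coeff [of 0 0, where 'n = 'n] pair_coeff_zero by (auto intro!: sum.neutral)
  ultimately show ?thesis
    using sums_Suc_iff [of "\<lambda>n. var_coeff TYPE('n) n * lam ^ n" "limit_variance TYPE('n) lam - 1"]
    by (simp add: mult.commute)
qed

section \<open>The characteristic function of a linear combination of spins\<close>

text \<open>A moment generating function without zeros and with bounded logarithmic derivative is close to Gaussian:
  its logarithm is analytic, the bound on the first derivative controls the third one through the Cauchy
  estimates, and Taylor's formula of second order applies.\<close>

lemma near_gaussian:
  fixes W :: "complex \<Rightarrow> complex"
  assumes R: "0 < R" and hol: "W holomorphic_on ball 0 R" and nz: "\<And>z. z \<in> ball 0 R \<Longrightarrow> W z \<noteq> 0"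
    and W0: "W 0 = 1" and W1: "deriv W 0 = 0"
    and A: "\<And>z. z \<in> ball 0 R \<Longrightarrow> norm (deriv W z) \<le> A * norm (W z)"
    and z: "norm z < R / 2" and small: "16 * A * norm z ^ 3 / R\<^sup>2 \<le> 1 / 2"
  shows "norm (W z * exp (- (deriv (deriv W) 0 * z\<^sup>2 / 2)) - 1) \<le> 24 * A * norm z ^ 3 / R\<^sup>2"
proof -
  obtain g where g: "g holomorphic_on ball 0 R" "\<And>x. x \<in> ball 0 R \<Longrightarrow> exp (g x) = W x"
    by (rule holomorphic_logarithm_exists [OF convex_ball open_ball hol nz, of 0]) (use R in auto)
  define l where "l x = g x - g 0" for x
  define m where "m x = deriv W x / W x" for x
  have o: "open (ball 0 R :: complex set)" by simp
  have el: "exp (l x) = W x" if "x \<in> ball 0 R" for x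
    using g(2) [OF that] g(2) [of 0] R W0 by (simp add: l_def exp_diff)
  have dW: "(W has_field_derivative deriv W x) (at x)" if "x \<in> ball 0 R" for x
    by (rule holomorphic_derivI [OF hol o that])
  have dl: "(l has_field_derivative m x) (at x)" if x: "x \<in> ball 0 R" for x
  proof -
    have dg: "(g has_field_derivative deriv g x) (at x)" by (rule holomorphic_derivI [OF g(1) o x])
    have "((\<lambda>x. exp (g x)) has_field_derivative exp (g x) * deriv g x) (at x)"
      by (rule DERIV_fun_exp [OF dg])
    then have "(W has_field_derivative exp (g x) * deriv g x) (at x)"
      by (rule has_field_derivative_transform_within_open [OF _ o x]) (simp add: g(2))
    then have "deriv W x = W x * deriv g x" using dW [OF x] DERIV_unique g(2) [OF x] by fastforce
    then have "deriv g x = m x" using nz [OF x] by (simp add: m_def)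
    then show ?thesis using dg unfolding l_def [abs_def] by (auto intro!: derivative_eq_intros)
  qed
  have holm: "m holomorphic_on ball 0 R"
    unfolding m_def by (intro holomorphic_intros hol holomorphic_deriv o nz)
  have mA: "norm (m x) \<le> A" if "x \<in> ball 0 R" for x
    using A [OF that] nz [OF that] by (simp add: m_def norm_divide divide_le_eq)
  have m0: "m 0 = 0" using W1 by (simp add: m_def)
  have dm0: "deriv m 0 = deriv (deriv W) 0"
  proof -
    have z0: "0 \<in> ball 0 R" using R by simp
    have "(deriv W has_field_derivative deriv (deriv W) 0) (at 0)"
      by (rule holomorphic_derivI [OF holomorphic_deriv [OF hol o] o z0])
    then have "(m has_field_derivative (deriv (deriv W) 0 * W 0 - deriv W 0 * deriv W 0) / (W 0 * W 0)) (at 0)"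
      unfolding m_def by (intro DERIV_divide dW [OF z0]) (use W0 in auto)
    then show ?thesis using W0 W1 by (simp add: DERIV_imp_deriv)
  qed
  have A0: "0 \<le> A" using mA [of 0] R by (meson centre_in_ball norm_ge_zero order_trans)
  \<comment> \<open>Cauchy estimate on a disc of radius \<open>R / 4\<close>, which stays inside the disc of radius \<open>R\<close>\<close>
  have m2: "norm (deriv (deriv m) w) \<le> 32 * A / R\<^sup>2" if w: "w \<in> ball 0 (R / 2)" for w
  proof -
    have sub: "cball w (R / 4) \<subseteq> ball 0 R"
    proof
      fix x assume "x \<in> cball w (R / 4)"
      then have "norm x \<le> norm w + R / 4"
        using norm_triangle_ineq [of w "x - w"] by (simp add: dist_norm norm_minus_commute)
      then show "x \<in> ball 0 R" using w R by simp
    qed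
    have "norm ((deriv ^^ 2) m w) \<le> fact 2 * A / (R / 4) ^ 2"
    proof (rule Cauchy_inequality)
      show "m holomorphic_on ball w (R / 4)" using holm sub ball_subset_cball holomorphic_on_subset by blast
      show "continuous_on (cball w (R / 4)) m" using holm sub holomorphic_on_imp_continuous_on continuous_on_subset by blast
      fix x assume "norm (w - x) = R / 4"
      then have "x \<in> ball 0 R" using sub by (auto simp: dist_norm subset_iff)
      then show "norm (m x) \<le> A" by (rule mA)
    qed (use R in auto)
    then show ?thesis by (simp add: numeral_2_eq_2 power_divide field_simps)
  qed
  \<comment> \<open>the successive derivatives of \<open>l\<close>\<close>
  define f where "f i = (if i = 0 then l else (deriv ^^ (i - 1)) m)" for i :: nat
  have "norm (f 0 z - (\<Sum>i\<le>2. f i 0 * (z - 0) ^ i / fact i)) \<le> 32 * A / R\<^sup>2 * norm (z - 0) ^ Suc 2 / fact 2"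
  proof (rule complex_Taylor [of "ball 0 (R / 2)"])
    show "(f i has_field_derivative f (Suc i) x) (at x within ball 0 (R / 2))" if "x \<in> ball 0 (R / 2)" "i \<le> 2" for i x
    proof (cases "i = 0")
      case True
      have "x \<in> ball 0 R" using that R by simp
      then show ?thesis using True dl by (simp add: f_def has_field_derivative_at_within)
    next
      case False
      then obtain j where j: "i = Suc j" using not0_implies_Suc by blast
      have "x \<in> ball 0 R" using that R by simp
      then have "((deriv ^^ j) m has_field_derivative deriv ((deriv ^^ j) m) x) (at x)"
        by (intro holomorphic_derivI [OF holomorphic_higher_deriv [OF holm o] o])
      then show ?thesis using j by (simp add: f_def has_field_derivative_at_within)
    qed
    show "norm (f (Suc 2) x) \<le> 32 * A / R\<^sup>2" if "x \<in> ball 0 (R / 2)" for x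
      using m2 [OF that] by (simp add: f_def numeral_2_eq_2)
  qed (use R z in auto)
  moreover have "l 0 = 0" by (simp add: l_def)
  ultimately have le: "norm (l z - deriv (deriv W) 0 * z\<^sup>2 / 2) \<le> 16 * A * norm z ^ 3 / R\<^sup>2"
    by (simp add: f_def numeral_2_eq_2 m0 dm0 [unfolded numeral_2_eq_2] eval_nat_numeral fact_Suc)
  have zR: "z \<in> ball 0 R" using z R by simp
  let ?e = "l z - deriv (deriv W) 0 * z\<^sup>2 / 2"
  have "W z * exp (- (deriv (deriv W) 0 * z\<^sup>2 / 2)) = exp ?e"
    unfolding el [OF zR, symmetric] by (simp add: mult_exp_exp)
  moreover have "norm (exp ?e - 1) \<le> 3 / 2 * norm ?e"
    by (rule norm_exp_bounds) (use le small in linarith)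
  moreover have "3 / 2 * norm ?e \<le> 24 * A * norm z ^ 3 / R\<^sup>2" using le by simp
  ultimately show ?thesis by simp
qed

text \<open>\<open>E exp (s X)\<close> is a quotient of partition functions, with field \<open>s * \<eta> t\<close> in the numerator. By
  \<open>weight_sum_dominated\<close> it has no zeros as long as the field is at most \<open>rad0\<close>, and its logarithmic
  derivative is the sum of the \<open>\<eta> t\<close> times the mean of the spin at \<open>t\<close> in this field, which is at most 1.\<close>

lemma gibbs_moment_generating:
  fixes \<eta> :: "int ^ 'n::finite \<Rightarrow> real"
  assumes lam: "\<bar>lam\<bar> \<le> rad0 TYPE('n)" and T: "T \<subseteq> cube N" and H: "0 < H" "\<And>t. \<bar>\<eta> t\<bar> \<le> H"
    and z: "norm z < rad0 TYPE('n) / H / 2"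
    and small: "16 * (H * card T) * norm z ^ 3 / (rad0 TYPE('n) / H)\<^sup>2 \<le> 1 / 2"
  defines "X \<equiv> \<lambda>\<delta>. \<Sum>t\<in>T. complex_of_real (\<eta> t * \<delta> t)"
  shows "norm (gibbs_mean (of_real lam) N (\<lambda>\<delta>. exp (z * X \<delta>)) * exp (- (gibbs_mean (of_real lam) N (\<lambda>\<delta>. (X \<delta>)\<^sup>2) * z\<^sup>2 / 2)) - 1)
    \<le> 24 * (H * card T) * norm z ^ 3 / (rad0 TYPE('n) / H)\<^sup>2"
proof -
  let ?l = "complex_of_real lam"
  let ?R = "rad0 TYPE('n) / H"
  let ?Z = "weight_sum ?l (\<lambda>_ :: int ^ 'n. 0) N (\<lambda>_. 1)"
  define W where "W s = gibbs_mean ?l N (\<lambda>\<delta>. exp (s * X \<delta>))" for s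
  \<comment> \<open>the field that produces the factor \<open>exp (s * X)\<close>\<close>
  define hs where "hs s t = (if t \<in> T then s * of_real (\<eta> t) else 0)" for s :: complex and t
  have nl: "norm ?l \<le> rad0 TYPE('n)" using lam by simp
  have Z: "?Z \<noteq> 0" by (rule weight_sum_one_nonzero [OF nl])
  have r: "0 < rad0 TYPE('n)" by (rule rad0_pos)
  have R: "0 < ?R" using r H by simp
  have fT: "finite T" using T by (rule finite_subset) simp
  have sm: "high_temp ?l (hs s)" if "s \<in> ball 0 ?R" for s
  proof -
    have "norm s * H \<le> rad0 TYPE('n)" using that H by (simp add: field_simps)
    then have "norm s * \<bar>\<eta> t\<bar> \<le> rad0 TYPE('n)" for t
      using mult_left_mono [OF H(2) [of t], of "norm s"] by simp
    then show ?thesis using nl r by (simp add: high_temp_def hs_def norm_mult)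
  qed
  have cw: "exp (s * X \<delta>) * spin_weight ?l (\<lambda>_. 0) N \<delta> = spin_weight ?l (hs s) N \<delta>" for s \<delta>
  proof -
    have "(\<Sum>t\<in>cube N. hs s t * of_real (\<delta> t)) = (\<Sum>t\<in>T. hs s t * of_real (\<delta> t))"
      by (rule sum.mono_neutral_right) (use T in \<open>auto simp: hs_def\<close>)
    also have "\<dots> = s * X \<delta>" unfolding X_def sum_distrib_left by (rule sum.cong) (auto simp: hs_def)
    finally show ?thesis by (simp add: spin_weight_def exp_add mult.commute)
  qed
  have W: "W s = weight_sum ?l (hs s) N (\<lambda>_. 1) / ?Z" for s
    by (simp add: W_def gibbs_mean_def weight_sum_def cw)
  have gd: "((\<lambda>s. gibbs_mean ?l N (\<lambda>\<delta>. Y \<delta> * exp (s * X \<delta>))) has_field_derivative gibbs_mean ?l N (\<lambda>\<delta>. (Y \<delta> * X \<delta>) * exp (s * X \<delta>))) (at s)" for Y s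
  proof -
    have "((\<lambda>s. weight_sum ?l (\<lambda>_. 0) N (\<lambda>\<delta>. Y \<delta> * exp (s * X \<delta>))) has_field_derivative weight_sum ?l (\<lambda>_. 0) N (\<lambda>\<delta>. (Y \<delta> * X \<delta>) * exp (s * X \<delta>))) (at s)"
      unfolding weight_sum_def by (auto intro!: derivative_eq_intros sum.cong simp: mult_ac)
    then show ?thesis unfolding gibbs_mean_def by (rule DERIV_cdivide)
  qed
  have dW: "deriv W = (\<lambda>s. gibbs_mean ?l N (\<lambda>\<delta>. X \<delta> * exp (s * X \<delta>)))"
    using gd [of "\<lambda>_. 1"] by (auto simp: W_def [abs_def] fun_eq_iff intro!: DERIV_imp_deriv)
  have holW: "W holomorphic_on ball 0 ?R"
    by (rule holomorphic_on_subset [of _ UNIV])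
      (use gd [of "\<lambda>_. 1"] in \<open>auto simp: W_def [abs_def] holomorphic_on_def field_differentiable_def\<close>)
  have ddW: "deriv (deriv W) 0 = gibbs_mean ?l N (\<lambda>\<delta>. (X \<delta>)\<^sup>2)"
    unfolding dW using gd [of X 0] by (simp add: DERIV_imp_deriv power2_eq_square)
  have X1: "deriv W 0 = 0"
  proof -
    have "deriv W 0 = (\<Sum>t\<in>T. of_real (\<eta> t) * gibbs_mean ?l N (chi {t}))"
      unfolding dW gibbs_mean_def weight_sum_def X_def
      by (simp add: chi_def sum_distrib_right sum_distrib_left sum_divide_distrib mult_ac) (subst sum.swap, simp)
    also have "\<dots> = 0"
    proof (rule sum.neutral, rule ballI)
      fix t assume "t \<in> T"
      then have "gibbs_mean ?l N (chi {t}) = corr ?l (\<lambda>_. 0) N {t}"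
        using T by (intro corr_eq_gibbs_mean [symmetric]) auto
      then show "of_real (\<eta> t) * gibbs_mean ?l N (chi {t}) = 0" by (simp add: corr_single)
    qed
    finally show ?thesis .
  qed
  have bd: "norm (deriv W s) \<le> (H * card T) * norm (W s)" if s: "s \<in> ball 0 ?R" for s
  proof -
    have nzs: "weight_sum ?l (hs s) N (\<lambda>_. 1) \<noteq> 0" by (rule weight_sum_dominated(1) [OF sm [OF s]])
    have "deriv W s = (\<Sum>t\<in>T. of_real (\<eta> t) * weight_sum ?l (hs s) N (chi {t})) / ?Z"
    proof -
      have "X \<delta> * exp (s * X \<delta>) * spin_weight ?l (\<lambda>_. 0) N \<delta> = (\<Sum>t\<in>T. of_real (\<eta> t) * (chi {t} \<delta> * spin_weight ?l (hs s) N \<delta>))" for \<delta>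
        unfolding mult.assoc cw unfolding X_def sum_distrib_right by (rule sum.cong) (auto simp: chi_def mult_ac)
      then show ?thesis
        unfolding dW gibbs_mean_def weight_sum_def by (simp add: sum_distrib_left) (subst sum.swap, simp)
    qed
    also have "\<dots> = W s * (\<Sum>t\<in>T. of_real (\<eta> t) * corr ?l (hs s) N {t})"
      using nzs T by (auto simp: W corr_def sum_distrib_left sum_divide_distrib intro!: sum.cong)
    finally have "norm (deriv W s) = norm (W s) * norm (\<Sum>t\<in>T. of_real (\<eta> t) * corr ?l (hs s) N {t})"
      by (simp add: norm_mult)
    also have "\<dots> \<le> norm (W s) * (\<Sum>t\<in>T. H * 1)"
    proof (intro mult_left_mono sum_norm_le)
      fix t
      show "norm (of_real (\<eta> t) * corr ?l (hs s) N {t}) \<le> H * 1"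
        unfolding norm_mult using H by (intro mult_mono norm_corr_le [OF sm [OF s]]) auto
    qed simp
    finally show ?thesis by (simp add: mult_ac)
  qed
  have "norm (W z * exp (- (deriv (deriv W) 0 * z\<^sup>2 / 2)) - 1) \<le> 24 * (H * card T) * norm z ^ 3 / ?R\<^sup>2"
  proof (rule near_gaussian [OF R holW _ _ X1 bd])
    show "W s \<noteq> 0" if "s \<in> ball 0 ?R" for s
      using weight_sum_dominated(1) [OF sm [OF that], of N] Z by (simp add: W)
    show "W 0 = 1" using Z by (simp add: W_def gibbs_mean_def)
  qed (use z small in auto)
  then show ?thesis by (simp add: ddW W_def)
qed

lemma integral_gibbs_eq_mean:
  fixes f :: "('n::finite) config \<Rightarrow> complex"
  assumes f: "\<And>\<omega> \<omega>'. (\<And>t. t \<in> T \<Longrightarrow> \<omega> t = \<omega>' t) \<Longrightarrow> f \<omega> = f \<omega>'" and T: "T \<subseteq> cube N"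
  shows "(\<integral>\<omega>. f \<omega> \<partial>gibbs lam N) = gibbs_mean (of_real lam) N f"
proof -
  have l: "local_on (cube N) f" unfolding local_on_def
  proof (intro ballI impI)
    fix \<omega> \<omega>' :: "'n config" assume "\<forall>t\<in>cube N. \<omega> t = \<omega>' t"
    then show "f \<omega> = f \<omega>'" using T by (intro f) auto
  qed
  have "f (extend_config N \<delta>) = f \<delta>" for \<delta> by (rule f) (use T in \<open>auto simp: extend_config_def\<close>)
  then show ?thesis by (simp add: integral_gibbs_weight_sum [OF l] gibbs_mean_def)
qed

text \<open>The bounds of \<open>gibbs_moment_generating\<close> do not depend on the cube.\<close>

lemma limit_characteristic_function:
  fixes \<eta> :: "int ^ 'n::finite \<Rightarrow> real"
  assumes lam: "\<bar>lam\<bar> \<le> rad0 TYPE('n)" and T: "finite T" and H: "0 < H" "\<And>t. \<bar>\<eta> t\<bar> \<le> H"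
    and th: "0 \<le> \<theta>" "\<theta> < rad0 TYPE('n) / H / 2"
    and small: "16 * (H * card T) * \<theta> ^ 3 / (rad0 TYPE('n) / H)\<^sup>2 \<le> 1 / 2"
  defines "X \<equiv> \<lambda>\<omega> :: 'n config. \<Sum>t\<in>T. \<eta> t * \<omega> t"
  shows "norm ((\<integral>\<omega>. iexp (\<theta> * X \<omega>) \<partial>limit_measure lam) * exp (of_real (\<theta>\<^sup>2 * (\<integral>\<omega>. (X \<omega>)\<^sup>2 \<partial>limit_measure lam) / 2)) - 1)
    \<le> 24 * (H * card T) * \<theta> ^ 3 / (rad0 TYPE('n) / H)\<^sup>2"
proof -
  have Xc: "X \<omega> = X \<omega>'" if "\<And>t. t \<in> T \<Longrightarrow> \<omega> t = \<omega>' t" for \<omega> \<omega>'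
    unfolding X_def by (rule sum.cong) (use that in auto)
  have l1: "local_on T (\<lambda>\<omega>. iexp (\<theta> * X \<omega>))" and l2: "local_on T (\<lambda>\<omega>. complex_of_real ((X \<omega>)\<^sup>2))"
    unfolding local_on_def using Xc by metis+
  have lim: "(\<lambda>N. norm ((\<integral>\<omega>. iexp (\<theta> * X \<omega>) \<partial>gibbs lam N) * exp ((\<integral>\<omega>. complex_of_real ((X \<omega>)\<^sup>2) \<partial>gibbs lam N) * of_real (\<theta>\<^sup>2) / 2) - 1))
    \<longlonglongrightarrow> norm ((\<integral>\<omega>. iexp (\<theta> * X \<omega>) \<partial>limit_measure lam) * exp ((\<integral>\<omega>. complex_of_real ((X \<omega>)\<^sup>2) \<partial>limit_measure lam) * of_real (\<theta>\<^sup>2) / 2) - 1)"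
    by (intro tendsto_intros limit_measure_local(3) [OF lam T l1] limit_measure_local(3) [OF lam T l2]) auto
  have "eventually (\<lambda>N. norm ((\<integral>\<omega>. iexp (\<theta> * X \<omega>) \<partial>gibbs lam N) * exp ((\<integral>\<omega>. complex_of_real ((X \<omega>)\<^sup>2) \<partial>gibbs lam N) * of_real (\<theta>\<^sup>2) / 2) - 1)
    \<le> 24 * (H * card T) * \<theta> ^ 3 / (rad0 TYPE('n) / H)\<^sup>2) sequentially"
    using eventually_subset_cube [OF T]
  proof eventually_elim
    case (elim N)
    let ?X = "\<lambda>\<delta> :: int ^ 'n \<Rightarrow> real. \<Sum>t\<in>T. complex_of_real (\<eta> t * \<delta> t)"
    have e1: "(\<integral>\<omega>. iexp (\<theta> * X \<omega>) \<partial>gibbs lam N) = gibbs_mean (of_real lam) N (\<lambda>\<delta>. exp ((\<i> * of_real \<theta>) * ?X \<delta>))"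
    proof -
      have "(\<integral>\<omega>. iexp (\<theta> * X \<omega>) \<partial>gibbs lam N) = gibbs_mean (of_real lam) N (\<lambda>\<omega>. iexp (\<theta> * X \<omega>))"
        by (rule integral_gibbs_eq_mean [OF _ elim]) (use Xc in metis)
      then show ?thesis by (simp add: X_def mult.assoc)
    qed
    have e2: "(\<integral>\<omega>. complex_of_real ((X \<omega>)\<^sup>2) \<partial>gibbs lam N) = gibbs_mean (of_real lam) N (\<lambda>\<delta>. (?X \<delta>)\<^sup>2)"
    proof -
      have "(\<integral>\<omega>. complex_of_real ((X \<omega>)\<^sup>2) \<partial>gibbs lam N) = gibbs_mean (of_real lam) N (\<lambda>\<omega>. complex_of_real ((X \<omega>)\<^sup>2))"
        by (rule integral_gibbs_eq_mean [OF _ elim]) (use Xc in metis)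
      then show ?thesis by (simp add: X_def)
    qed
    have n: "norm (\<i> * complex_of_real \<theta>) = \<theta>" using th by (simp add: norm_mult)
    have s: "- (v * (\<i> * complex_of_real \<theta>)\<^sup>2 / 2) = v * of_real (\<theta>\<^sup>2) / 2" for v by (simp add: power_mult_distrib)
    show ?case
      using gibbs_moment_generating [OF lam elim H, of "\<i> * of_real \<theta>", unfolded n s] th small
      by (simp only: e1 e2)
  qed
  then have "norm ((\<integral>\<omega>. iexp (\<theta> * X \<omega>) \<partial>limit_measure lam) * exp ((\<integral>\<omega>. complex_of_real ((X \<omega>)\<^sup>2) \<partial>limit_measure lam) * of_real (\<theta>\<^sup>2) / 2) - 1)
    \<le> 24 * (H * card T) * \<theta> ^ 3 / (rad0 TYPE('n) / H)\<^sup>2"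
    by (rule tendsto_upperbound [OF lim]) simp
  moreover have "(\<integral>\<omega>. complex_of_real ((X \<omega>)\<^sup>2) \<partial>limit_measure lam) * of_real (\<theta>\<^sup>2) / 2 = of_real (\<theta>\<^sup>2 * (\<integral>\<omega>. (X \<omega>)\<^sup>2 \<partial>limit_measure lam) / 2)"
    unfolding integral_complex_of_real by (simp add: mult.commute)
  ultimately show ?thesis by (simp only:)
qed

section \<open>Covariances of blocks\<close>

definition block :: "nat \<Rightarrow> int ^ 'n \<Rightarrow> (int ^ 'n) set" where
  "block k \<tau> = {t. block_map k t = \<tau>}"

lemma card_vec_box:
  assumes "\<And>i. finite (F i)"
  shows "card {t :: 'a ^ 'n::finite. \<forall>i. t $ i \<in> F i} = (\<Prod>i\<in>UNIV. card (F i))"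
  unfolding vec_box_eq by (simp add: card_image inj_vec_lambda card_PiE)

lemma div_interval:
  fixes k x a :: int
  assumes "0 < k"
  shows "x div k = a \<longleftrightarrow> x \<in> {k * a..<k * (a + 1)}"
proof
  assume "x div k = a"
  then show "x \<in> {k * a..<k * (a + 1)}"
    using assms mult_div_mod_eq [of k x] pos_mod_bound [OF assms, of x] pos_mod_sign [OF assms, of x]
    by (auto simp: algebra_simps)
next
  assume x: "x \<in> {k * a..<k * (a + 1)}"
  show "x div k = a"
    by (rule int_div_pos_eq [of _ _ _ "x - k * a"]) (use x in \<open>auto simp: algebra_simps\<close>)
qed

lemma block_box:
  assumes "0 < k"
  shows "block k \<tau> = {t. \<forall>i. t $ i \<in> {int k * \<tau> $ i..<int k * (\<tau> $ i + 1)}}"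
proof -
  have "block_map k t $ i = t $ i div int k" for t :: "int ^ 'a" and i
    unfolding block_map_def by (simp, metis floor_divide_of_int_eq of_int_of_nat_eq)
  then show ?thesis using assms by (simp only: block_def vec_eq_iff div_interval of_nat_0_less_iff)
qed

lemma finite_block: "0 < k \<Longrightarrow> finite (block k (\<tau> :: int ^ 'n::finite))"
  unfolding block_box by (rule finite_vec_box) simp

lemma card_block: "0 < k \<Longrightarrow> card (block k (\<tau> :: int ^ 'n::finite)) = k ^ CARD('n)"
  unfolding block_box by (subst card_vec_box) (simp_all add: algebra_simps)

text \<open>In one dimension an interval loses at most \<open>|u|\<close> points to its complement when it is translated by \<open>u\<close>, and
  disjoint intervals meet in at most \<open>|u|\<close> points after such a translation.\<close>

lemma overlap_count:
  fixes a b u :: int and k :: nat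
  shows "\<bar>real (card ({int k * a..<int k * (a + 1)} \<inter> {int k * b - u..<int k * (b + 1) - u})) - (if a = b then real k else 0)\<bar> \<le> of_int \<bar>u\<bar>"
proof -
  let ?F = "{int k * a..<int k * (a + 1)} \<inter> {int k * b - u..<int k * (b + 1) - u}"
  consider "a = b" | "a < b" | "b < a" by linarith
  then show ?thesis
  proof cases
    case 1
    have "?F = {max (int k * a) (int k * a - u)..<min (int k * (a + 1)) (int k * (a + 1) - u)}" using 1 by auto
    then have c: "card ?F = nat (min (int k * (a + 1)) (int k * (a + 1) - u) - max (int k * a) (int k * a - u))" by simp
    have "int (card ?F) \<le> int k \<and> int k - \<bar>u\<bar> \<le> int (card ?F)"
      unfolding c by (auto simp: algebra_simps)
    then have "\<bar>int (card ?F) - int k\<bar> \<le> \<bar>u\<bar>" by linarith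
    then have "real_of_int \<bar>int (card ?F) - int k\<bar> \<le> real_of_int \<bar>u\<bar>" by (simp only: of_int_le_iff)
    then show ?thesis unfolding of_int_abs of_int_diff of_int_of_nat_eq using 1 by (simp only: simp_thms if_True)
  next
    case 2
    have "?F \<subseteq> {int k * b - u..<int k * b}"
    proof -
      have "int k * (a + 1) \<le> int k * b" using 2 by (intro mult_left_mono) auto
      then show ?thesis by auto
    qed
    then have "card ?F \<le> card {int k * b - u..<int k * b}" by (intro card_mono) auto
    then have "int (card ?F) \<le> \<bar>u\<bar>" by auto
    then have "real_of_int (int (card ?F)) \<le> real_of_int \<bar>u\<bar>" by (simp only: of_int_le_iff)
    moreover have "a \<noteq> b" using 2 by simp
    ultimately show ?thesis by (simp only: of_int_of_nat_eq if_False diff_0_right abs_of_nat)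
  next
    case 3
    have "?F \<subseteq> {int k * (b + 1)..<int k * (b + 1) - u}"
    proof -
      have "int k * (b + 1) \<le> int k * a" using 3 by (intro mult_left_mono) auto
      then show ?thesis by auto
    qed
    then have "card ?F \<le> card {int k * (b + 1)..<int k * (b + 1) - u}" by (intro card_mono) auto
    then have "int (card ?F) \<le> \<bar>u\<bar>" by auto
    then have "real_of_int (int (card ?F)) \<le> real_of_int \<bar>u\<bar>" by (simp only: of_int_le_iff)
    moreover have "a \<noteq> b" using 3 by simp
    ultimately show ?thesis by (simp only: of_int_of_nat_eq if_False diff_0_right abs_of_nat)
  qed
qed

text \<open>The proportion of sites of one block that the translation by \<open>u\<close> moves into another block.\<close>

definition overlap :: "nat \<Rightarrow> int ^ 'n::finite \<Rightarrow> int ^ 'n \<Rightarrow> int ^ 'n \<Rightarrow> real" where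
  "overlap k \<tau> \<tau>' u = real (card {s \<in> block k \<tau>. s + u \<in> block k \<tau>'}) / real k ^ CARD('n)"

text \<open>The overlap is a product over the coordinates of one-dimensional proportions.\<close>

lemma overlap_tendsto:
  fixes \<tau> \<tau>' u :: "int ^ 'n::finite"
  shows "(\<lambda>k. overlap k \<tau> \<tau>' u) \<longlonglongrightarrow> (if \<tau> = \<tau>' then 1 else 0)"
proof -
  let ?F = "\<lambda>k i. {int k * \<tau> $ i..<int k * (\<tau> $ i + 1)} \<inter> {int k * \<tau>' $ i - u $ i..<int k * (\<tau>' $ i + 1) - u $ i}"
  have one: "(\<lambda>k. real (card (?F k i)) / real k) \<longlonglongrightarrow> (if \<tau> $ i = \<tau>' $ i then 1 else 0)" for i
  proof (rule LIM_zero_cancel, rule Lim_null_comparison)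
    show "eventually (\<lambda>k. norm (real (card (?F k i)) / real k - (if \<tau> $ i = \<tau>' $ i then 1 else 0)) \<le> of_int \<bar>u $ i\<bar> * (1 / real k)) sequentially"
      using eventually_gt_at_top [of 0]
    proof eventually_elim
      case (elim k)
      have "real (card (?F k i)) / real k - (if \<tau> $ i = \<tau>' $ i then 1 else 0) = (real (card (?F k i)) - (if \<tau> $ i = \<tau>' $ i then real k else 0)) / real k"
        using elim by (simp add: diff_divide_distrib)
      then have "norm (real (card (?F k i)) / real k - (if \<tau> $ i = \<tau>' $ i then 1 else 0)) = \<bar>real (card (?F k i)) - (if \<tau> $ i = \<tau>' $ i then real k else 0)\<bar> / real k"
        by (simp add: abs_divide)
      also have "\<dots> \<le> of_int \<bar>u $ i\<bar> / real k" by (intro divide_right_mono overlap_count) simp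
      finally show ?case by simp
    qed
    have "(\<lambda>k. of_int \<bar>u $ i\<bar> * (1 / real k)) \<longlonglongrightarrow> of_int \<bar>u $ i\<bar> * 0"
      by (intro tendsto_intros lim_1_over_n)
    then show "(\<lambda>k. real_of_int \<bar>u $ i\<bar> * (1 / real k)) \<longlonglongrightarrow> 0" by simp
  qed
  have "(\<lambda>k. \<Prod>i\<in>UNIV. real (card (?F k i)) / real k) \<longlonglongrightarrow> (\<Prod>i\<in>(UNIV :: 'n set). if \<tau> $ i = \<tau>' $ i then 1 else 0)"
    by (intro tendsto_prod one)
  also have "(\<Prod>i\<in>(UNIV :: 'n set). if \<tau> $ i = \<tau>' $ i then 1 else 0 :: real) = (if \<tau> = \<tau>' then 1 else 0)"
    by (auto simp: vec_eq_iff)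
  finally show ?thesis
  proof (rule Lim_transform_eventually)
    show "eventually (\<lambda>k. (\<Prod>i\<in>(UNIV :: 'n set). real (card (?F k i)) / real k) = overlap k \<tau> \<tau>' u) sequentially"
      using eventually_gt_at_top [of 0]
    proof eventually_elim
      case (elim k)
      have eq: "{s \<in> block k \<tau>. s + u \<in> block k \<tau>'} = {s. \<forall>i. s $ i \<in> ?F k i}"
        unfolding block_box [OF elim] by (auto simp: algebra_simps)
      have "card {s \<in> block k \<tau>. s + u \<in> block k \<tau>'} = (\<Prod>i\<in>UNIV. card (?F k i))"
        unfolding eq by (rule card_vec_box) simp
      then show ?case unfolding overlap_def by (simp only: of_nat_prod prod_dividef prod_constant)
    qed
  qed
qed

lemma overlap_bounds: "0 \<le> overlap k \<tau> \<tau>' u" "overlap k \<tau> \<tau>' (u :: int ^ 'n::finite) \<le> 1"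
proof -
  show "0 \<le> overlap k \<tau> \<tau>' u" by (simp add: overlap_def)
  show "overlap k \<tau> \<tau>' u \<le> 1"
  proof (cases "0 < k")
    case True
    then have "card {s \<in> block k \<tau>. s + u \<in> block k \<tau>'} \<le> k ^ CARD('n)"
      using card_mono [OF finite_block, of k "{s \<in> block k \<tau>. s + u \<in> block k \<tau>'}" \<tau>] card_block [of k \<tau>] by auto
    then have "real (card {s \<in> block k \<tau>. s + u \<in> block k \<tau>'}) \<le> real (k ^ CARD('n))"
      by (rule of_nat_mono)
    then show ?thesis using True by (simp add: overlap_def)
  qed (simp add: overlap_def zero_power)
qed

text \<open>Grouping the pairs by \<open>u = t - s\<close> gives the sum of \<open>overlap k \<tau> \<tau>' u * pair_corr lam u\<close>. It converges by
  dominated convergence, since the pair correlations are summable and overlaps are at most 1.\<close>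

lemma block_covariance:
  assumes lam: "\<bar>lam\<bar> \<le> rad0 TYPE('n::finite)"
  shows "(\<lambda>k. (\<Sum>s\<in>block k \<tau>. \<Sum>t\<in>block k \<tau>'. pair_corr lam (t - s :: int ^ 'n)) / real k ^ CARD('n))
    \<longlonglongrightarrow> (if \<tau> = \<tau>' then limit_variance TYPE('n) lam else 0)"
proof -
  have "(\<lambda>k. \<integral>u. overlap k \<tau> \<tau>' u * pair_corr lam u \<partial>count_space UNIV) \<longlonglongrightarrow> (\<integral>u. (if \<tau> = \<tau>' then 1 else 0) * pair_corr lam (u :: int ^ 'n) \<partial>count_space UNIV)"
  proof (rule integral_dominated_convergence [where w = "\<lambda>t :: int ^ 'n. kappa0 TYPE('n) ^ nat (ldist t 0)"])
    show "AE u in count_space UNIV. (\<lambda>k. overlap k \<tau> \<tau>' u * pair_corr lam u) \<longlonglongrightarrow> (if \<tau> = \<tau>' then 1 else 0) * pair_corr lam u"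
      by (intro AE_I2 tendsto_mult_right overlap_tendsto)
    show "AE u in count_space UNIV. norm (overlap k \<tau> \<tau>' u * pair_corr lam u) \<le> kappa0 TYPE('n) ^ nat (ldist u 0)" for k
    proof (rule AE_I2)
      fix u
      have "norm (overlap k \<tau> \<tau>' u * pair_corr lam u) \<le> 1 * \<bar>pair_corr lam u\<bar>"
        unfolding real_norm_def abs_mult using overlap_bounds [of k \<tau> \<tau>' u] by (intro mult_right_mono) auto
      then show "norm (overlap k \<tau> \<tau>' u * pair_corr lam u) \<le> kappa0 TYPE('n) ^ nat (ldist u 0)"
        using abs_pair_corr_le [OF lam, of u] by linarith
    qed
  qed (auto simp: integrable_decay)
  moreover have "(\<integral>u. (if \<tau> = \<tau>' then 1 else 0) * pair_corr lam (u :: int ^ 'n) \<partial>count_space UNIV) = (if \<tau> = \<tau>' then limit_variance TYPE('n) lam else 0)"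
    by (simp add: limit_variance_def)
  moreover have "eventually (\<lambda>k. (\<integral>u. overlap k \<tau> \<tau>' u * pair_corr lam u \<partial>count_space UNIV)
      = (\<Sum>s\<in>block k \<tau>. \<Sum>t\<in>block k \<tau>'. pair_corr lam (t - s)) / real k ^ CARD('n)) sequentially"
    using eventually_gt_at_top [of 0]
  proof eventually_elim
    case (elim k)
    let ?B = "block k \<tau>" and ?B' = "block k \<tau>'"
    note fB = finite_block [OF elim, of \<tau>] and fB' = finite_block [OF elim, of \<tau>']
    define D where "D = (\<lambda>(s, t). t - s) ` (?B \<times> ?B')"
    have fD: "finite D" using fB fB' by (simp add: D_def)
    have D: "t - s \<in> D" if "s \<in> ?B" "t \<in> ?B'" for s t using that unfolding D_def by force
    have "(\<Sum>s\<in>?B. \<Sum>t\<in>?B'. pair_corr lam (t - s)) = (\<Sum>s\<in>?B. \<Sum>u | u \<in> D \<and> s + u \<in> ?B'. pair_corr lam u)"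
    proof (rule sum.cong [OF refl])
      fix s assume s: "s \<in> ?B"
      show "(\<Sum>t\<in>?B'. pair_corr lam (t - s)) = (\<Sum>u | u \<in> D \<and> s + u \<in> ?B'. pair_corr lam u)"
        by (rule sum.reindex_bij_witness [of _ "\<lambda>u. s + u" "\<lambda>t. t - s"]) (use D [OF s] in auto)
    qed
    also have "\<dots> = (\<Sum>u\<in>D. \<Sum>s | s \<in> ?B \<and> s + u \<in> ?B'. pair_corr lam u)"
      by (rule sum.swap_restrict [OF fB fD])
    also have "\<dots> = (\<Sum>u\<in>D. real (card {s \<in> ?B. s + u \<in> ?B'}) * pair_corr lam u)" by simp
    finally have e: "(\<Sum>s\<in>?B. \<Sum>t\<in>?B'. pair_corr lam (t - s)) / real k ^ CARD('n) = (\<Sum>u\<in>D. overlap k \<tau> \<tau>' u * pair_corr lam u)"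
      by (simp add: overlap_def sum_divide_distrib)
    have "overlap k \<tau> \<tau>' u = 0" if "u \<notin> D" for u
    proof -
      have eq: "{s \<in> ?B. s + u \<in> ?B'} = {}"
      proof -
        have False if "s \<in> ?B" "s + u \<in> ?B'" for s using D [OF that] \<open>u \<notin> D\<close> by simp
        then show ?thesis by blast
      qed
      show ?thesis unfolding overlap_def eq by simp
    qed
    then have "(\<integral>u. overlap k \<tau> \<tau>' u * pair_corr lam u \<partial>count_space UNIV) = (\<Sum>u\<in>D. overlap k \<tau> \<tau>' u * pair_corr lam u)"
      by (intro integral_count_space_finite_sum fD) auto
    then show ?case using e by simp
  qed
  ultimately show ?thesis by (simp add: Lim_transform_eventually)
qed

lemma spin_product_moment:
  fixes s t :: "int ^ 'n::finite"
  assumes lam: "\<bar>lam\<bar> \<le> rad0 TYPE('n)"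
  shows "integrable (limit_measure lam) (\<lambda>\<omega>. \<omega> s * \<omega> t)"
    and "(\<integral>\<omega>. \<omega> s * \<omega> t \<partial>limit_measure lam) = pair_corr lam (t - s)"
proof -
  have loc: "local_on {s, t} (\<lambda>\<omega>. \<omega> s * \<omega> t)" by (simp add: local_on_def)
  show "integrable (limit_measure lam) (\<lambda>\<omega>. \<omega> s * \<omega> t)" by (rule limit_measure_local(2) [OF lam _ loc]) simp
  interpret P: prob_space "limit_measure lam :: 'n config measure" by (rule limit_measure(1) [OF lam])
  show "(\<integral>\<omega>. \<omega> s * \<omega> t \<partial>limit_measure lam) = pair_corr lam (t - s)"
  proof (cases "s = t")
    case True
    have "(\<integral>\<omega>. \<omega> s * \<omega> t \<partial>limit_measure lam) = integral\<^sup>L (limit_measure lam) (\<lambda>\<omega> :: 'n config. 1)"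
    proof (rule Bochner_Integration.integral_cong [OF refl])
      fix \<omega> :: "'n config" assume "\<omega> \<in> space (limit_measure lam)"
      then have "\<omega> s \<in> {-1, 1}" by (auto simp: limit_measure(2) [OF lam] Omega_def)
      then show "\<omega> s * \<omega> t = 1" using True by auto
    qed
    then show ?thesis using True by (simp add: P.prob_space pair_corr_def)
  next
    case False
    have "(\<lambda>N. \<integral>\<omega>. \<omega> s * \<omega> t \<partial>gibbs lam N) \<longlonglongrightarrow> (\<integral>\<omega>. \<omega> s * \<omega> t \<partial>limit_measure lam)"
      by (rule limit_measure_local(3) [OF lam _ loc]) simp
    moreover have "(\<lambda>N. \<integral>\<omega>. \<omega> s * \<omega> t \<partial>gibbs lam N) \<longlonglongrightarrow> limit_corr lam {s, t}"
      using limit_corr_tendsto(1) [OF lam, of "{s, t}"] False by (simp add: spin_prod_def spin_def)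
    ultimately have "(\<integral>\<omega>. \<omega> s * \<omega> t \<partial>limit_measure lam) = limit_corr lam {s, t}" by (rule LIMSEQ_unique)
    then show ?thesis using limit_corr_pair [OF lam False] by simp
  qed
qed

section \<open>From characteristic functions to convergence in distribution\<close>

text \<open>Trigonometric sums, the functions whose expectations are determined by characteristic functions.\<close>

inductive_set trig_sums :: "'i set \<Rightarrow> (('i \<Rightarrow> real) \<Rightarrow> complex) set" for I where
  exp: "(\<lambda>y. c * iexp (\<Sum>i\<in>I. \<xi> i * y i)) \<in> trig_sums I"
| add: "f \<in> trig_sums I \<Longrightarrow> g \<in> trig_sums I \<Longrightarrow> (\<lambda>y. f y + g y) \<in> trig_sums I"

lemma trig_sums_const: "(\<lambda>_. c) \<in> trig_sums I"
  using trig_sums.exp [of c "\<lambda>_. 0" I] by simp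

lemma trig_sums_mult:
  assumes "f \<in> trig_sums I" "g \<in> trig_sums I"
  shows "(\<lambda>y. f y * g y) \<in> trig_sums I"
  using assms
proof (induction arbitrary: g)
  case (exp c \<xi>)
  from exp show ?case
  proof (induction)
    case (exp c' \<xi>')
    have "(\<lambda>y. (c * c') * iexp (\<Sum>i\<in>I. (\<xi> i + \<xi>' i) * y i)) \<in> trig_sums I" by (rule trig_sums.exp)
    then show ?case by (simp add: distrib_right sum.distrib exp_add [symmetric] algebra_simps mult_exp_exp)
  next
    case (add f g)
    then show ?case using trig_sums.add [OF add.IH] by (simp add: distrib_left)
  qed
next
  case (add f f')
  then show ?case using trig_sums.add [OF add.IH(1) [OF add.prems] add.IH(2) [OF add.prems]] by (simp add: distrib_right)
qed

lemma trig_sums_sin: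
  assumes "finite I" "i \<in> I"
  shows "(\<lambda>y. complex_of_real (sin (a * y i))) \<in> trig_sums I"
proof -
  have s: "(\<Sum>j\<in>I. (if j = i then b else 0) * y j) = b * y i" for b and y :: "'a \<Rightarrow> real"
    using assms by (simp add: if_distrib [of "\<lambda>x. x * _"] sum.delta cong: if_cong)
  have "(\<lambda>y. 1 / (2 * \<i>) * iexp (\<Sum>j\<in>I. (if j = i then a else 0) * y j) + (- 1 / (2 * \<i>)) * iexp (\<Sum>j\<in>I. (if j = i then - a else 0) * y j)) \<in> trig_sums I"
    by (intro trig_sums.add trig_sums.exp)
  moreover have "1 / (2 * \<i>) * iexp (\<Sum>j\<in>I. (if j = i then a else 0) * y j) + (- 1 / (2 * \<i>)) * iexp (\<Sum>j\<in>I. (if j = i then - a else 0) * y j) = complex_of_real (sin (a * y i))"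
    for y :: "'a \<Rightarrow> real"
    unfolding s sin_of_real [symmetric] sin_exp_eq by (simp add: field_simps)
  ultimately show ?thesis by simp
qed

lemma trig_sums_bounded: "f \<in> trig_sums I \<Longrightarrow> \<exists>C. \<forall>y. norm (f y) \<le> C"
proof (induction rule: trig_sums.induct)
  case (exp c \<xi>)
  then show ?case by (intro exI [of _ "norm c"]) (simp add: norm_mult)
next
  case (add f g)
  then show ?case by (meson norm_triangle_mono)
qed

lemma trig_sums_measurable: "f \<in> trig_sums I \<Longrightarrow> f \<in> borel_measurable (PiM I (\<lambda>_. borel))"
proof (induction rule: trig_sums.induct)
  case (exp c \<xi>)
  show ?case by measurable
next
  case (add f g)
  then show ?case by measurable
qed

lemma compact_PiE_interval:
  fixes I :: "'i::countable set"
  shows "compact (I \<rightarrow>\<^sub>E {- 1..1::real})"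
proof -
  have "(I \<rightarrow>\<^sub>E {- 1..1::real}) = (\<Pi>\<^sub>E i\<in>UNIV. if i \<in> I then {- 1..1} else {undefined})"
    by (auto simp: PiE_def Pi_def extensional_def split: if_splits)
  moreover have "compactin (product_topology (\<lambda>_. euclidean) UNIV) (\<Pi>\<^sub>E i\<in>(UNIV :: 'i set). if i \<in> I then {- 1..1::real} else {undefined})"
    unfolding compactin_PiE by auto
  ultimately show ?thesis by (simp add: euclidean_product_topology)
qed

text \<open>Replace the argument \<open>y i\<close> of \<open>g\<close> by \<open>arcsin (sin (a * y i)) / a\<close>, a zigzag that is the identity on
  \<open>[-L, L]\<close> and periodic. The result is a continuous function of the numbers \<open>sin (a * y i)\<close>, which range
  over a compact cube, so by the Stone-Weierstrass theorem it is a uniform limit of polynomials in them. These are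
  trigonometric sums, and they are close to \<open>g\<close> on the box and bounded everywhere.\<close>

lemma trig_approximation:
  fixes I :: "'i::countable set" and g :: "('i \<Rightarrow> real) \<Rightarrow> real"
  assumes I: "finite I" and g: "continuous_on (I \<rightarrow>\<^sub>E UNIV) g" and B: "\<And>y. y \<in> I \<rightarrow>\<^sub>E UNIV \<Longrightarrow> \<bar>g y\<bar> \<le> B"
    and L: "0 < L" and e: "0 < e"
  obtains q where "(\<lambda>y. complex_of_real (q y)) \<in> trig_sums I" "\<And>y. \<bar>q y\<bar> \<le> B + e"
    "\<And>y. y \<in> I \<rightarrow>\<^sub>E {- L..L} \<Longrightarrow> \<bar>q y - g y\<bar> \<le> e"
proof -
  define a where "a = pi / (2 * L)"
  have a: "0 < a" "a * L = pi / 2" using L by (auto simp: a_def)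
  define K where "K = (I \<rightarrow>\<^sub>E {- 1..1::real})"
  define sn where "sn y = (\<lambda>i\<in>I. sin (a * y i))" for y :: "'i \<Rightarrow> real"
  \<comment> \<open>\<open>fold (sn y)\<close> is the zigzag applied to each coordinate of \<open>y\<close>\<close>
  define fold where "fold x = (\<lambda>i\<in>I. arcsin (x i) / a)" for x :: "'i \<Rightarrow> real"
  \<comment> \<open>the function ring for the Stone-Weierstrass theorem\<close>
  define R where "R = {p. continuous_on K p \<and> (\<lambda>y. complex_of_real (p (sn y))) \<in> trig_sums I}"
  have cf: "continuous_on K fold"
  proof (rule continuous_on_coordinatewise_then_product)
    fix i
    show "continuous_on K (\<lambda>x. fold x i)"
    proof (cases "i \<in> I")
      case True
      have "continuous_on K (\<lambda>x. arcsin (x i) / a)"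
        using True a by (intro continuous_intros continuous_on_product_coordinates continuous_on_subset [OF continuous_on_product_coordinates])
          (auto simp: K_def)
      then show ?thesis using True by (simp add: fold_def)
    qed (simp add: fold_def)
  qed
  have cG: "continuous_on K (\<lambda>x. g (fold x))"
    by (rule continuous_on_compose2 [OF g cf]) (auto simp: fold_def)
  have "\<exists>p\<in>R. \<forall>x\<in>K. \<bar>g (fold x) - p x\<bar> < e"
  proof (rule function_ring_on.Stone_Weierstrass_basic [OF _ cG e], unfold_locales)
    show "compact K" unfolding K_def by (rule compact_PiE_interval)
    show "continuous_on K f" if "f \<in> R" for f using that by (simp add: R_def)
    show "(\<lambda>x. f x + f' x) \<in> R" if "f \<in> R" "f' \<in> R" for f f'
      using that by (auto simp: R_def intro!: continuous_intros trig_sums.add)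
    show "(\<lambda>x. f x * f' x) \<in> R" if "f \<in> R" "f' \<in> R" for f f'
      using that by (auto simp: R_def intro!: continuous_intros trig_sums_mult)
    show "(\<lambda>_. c) \<in> R" for c by (simp add: R_def trig_sums_const)
    show "\<exists>f\<in>R. f x \<noteq> f y" if xy: "x \<in> K" "y \<in> K" "x \<noteq> y" for x y
    proof -
      obtain i where i: "x i \<noteq> y i" using xy(3) by auto
      then have "i \<in> I" using xy by (auto simp: K_def PiE_def extensional_def)
      then have "(\<lambda>x. x i) \<in> R"
        by (auto simp: R_def sn_def intro!: trig_sums_sin I continuous_on_subset [OF continuous_on_product_coordinates])
      then show ?thesis using i by (intro bexI [of _ "\<lambda>x. x i"])
    qed
  qed
  then obtain p where p: "p \<in> R" "\<And>x. x \<in> K \<Longrightarrow> \<bar>g (fold x) - p x\<bar> < e" by auto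
  show thesis
  proof (rule that [of "\<lambda>y. p (sn y)"])
    show "(\<lambda>y. complex_of_real (p (sn y))) \<in> trig_sums I" using p(1) by (simp add: R_def)
    have snK: "sn y \<in> K" for y by (auto simp: sn_def K_def)
    have fE: "fold x \<in> I \<rightarrow>\<^sub>E UNIV" for x by (simp add: fold_def)
    show "\<bar>p (sn y)\<bar> \<le> B + e" for y
      using p(2) [OF snK [of y]] B [OF fE [of "sn y"]] by linarith
    fix y assume y: "y \<in> I \<rightarrow>\<^sub>E {- L..L}"
    have "fold (sn y) = y"
    proof
      fix i
      show "fold (sn y) i = y i"
      proof (cases "i \<in> I")
        case True
        then have "- L \<le> y i" "y i \<le> L" using y by auto
        then have "a * y i \<le> pi / 2" "a * - L \<le> a * y i"
          using a(1) mult_left_mono [of "- L" "y i" a] unfolding a(2) [symmetric] by (auto intro!: mult_left_mono)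
        then have "arcsin (sin (a * y i)) = a * y i"
          using a by (intro arcsin_sin) auto
        then show ?thesis using True a by (simp add: fold_def sn_def)
      qed (use y in \<open>auto simp: fold_def PiE_def extensional_def\<close>)
    qed
    then show "\<bar>p (sn y) - g y\<bar> \<le> e" using p(2) [OF snK [of y]] by simp
  qed
qed

text \<open>Approximate \<open>g\<close> by bounded trigonometric sums \<open>q n\<close> on boxes of side growing with \<open>n\<close>. Expectations of
  \<open>q n\<close> converge by hypothesis, the error outside the box is controlled by the second moments for the
  variables \<open>X k\<close>, and under \<open>\<mu>\<close> by dominated convergence. The same approximation
  shows that \<open>g\<close> is measurable.\<close>

proposition convergence_from_characteristic_functions:
  fixes X :: "nat \<Rightarrow> 'i::countable \<Rightarrow> 'w \<Rightarrow> real" and g :: "('i \<Rightarrow> real) \<Rightarrow> real"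
  assumes M: "prob_space M" and I: "finite I" and X: "\<And>k i. i \<in> I \<Longrightarrow> X k i \<in> borel_measurable M"
    and mu: "prob_space \<mu>" "sets \<mu> = sets (PiM I (\<lambda>_. borel))"
    and cf: "\<And>\<xi>. (\<lambda>k. \<integral>\<omega>. iexp (\<Sum>i\<in>I. \<xi> i * X k i \<omega>) \<partial>M) \<longlonglongrightarrow> (\<integral>y. iexp (\<Sum>i\<in>I. \<xi> i * y i) \<partial>\<mu>)"
    and sq: "\<And>k i. i \<in> I \<Longrightarrow> integrable M (\<lambda>\<omega>. (X k i \<omega>)\<^sup>2)" "\<And>k i. i \<in> I \<Longrightarrow> (\<integral>\<omega>. (X k i \<omega>)\<^sup>2 \<partial>M) \<le> K"
    and g: "continuous_on (I \<rightarrow>\<^sub>E UNIV) g" "bounded (g ` (I \<rightarrow>\<^sub>E UNIV))"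
  shows "(\<lambda>k. \<integral>\<omega>. g (\<lambda>i\<in>I. X k i \<omega>) \<partial>M) \<longlonglongrightarrow> (\<integral>y. g y \<partial>\<mu>)"
proof -
  interpret M: prob_space M by fact
  interpret mu: prob_space \<mu> by fact
  have spmu: "space \<mu> = I \<rightarrow>\<^sub>E UNIV" using sets_eq_imp_space_eq [OF mu(2)] by (simp add: space_PiM)
  obtain B where B: "\<And>y. y \<in> I \<rightarrow>\<^sub>E UNIV \<Longrightarrow> \<bar>g y\<bar> \<le> B" using g(2) by (auto simp: bounded_iff)
  have B0: "0 \<le> B" using B [of "\<lambda>i\<in>I. 0"] by auto
  define Y where "Y k \<omega> = (\<lambda>i\<in>I. X k i \<omega>)" for k \<omega>
  have Ym: "Y k \<in> measurable M (PiM I (\<lambda>_. borel))" for k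
    unfolding Y_def [abs_def] by (rule measurable_restrict) (rule X)
  have YE: "Y k \<omega> \<in> I \<rightarrow>\<^sub>E UNIV" for k \<omega> by (simp add: Y_def)
  have tm: "f \<in> borel_measurable \<mu>" if "f \<in> trig_sums I" for f :: "('i \<Rightarrow> real) \<Rightarrow> complex"
    using trig_sums_measurable [OF that] by (simp add: measurable_cong_sets [OF mu(2) refl])
  have tmY: "(\<lambda>\<omega>. f (Y k \<omega>)) \<in> borel_measurable M" if "f \<in> trig_sums I" for f :: "('i \<Rightarrow> real) \<Rightarrow> complex" and k
    by (rule measurable_compose [OF Ym trig_sums_measurable [OF that]])
  have ti: "integrable \<mu> f" "integrable M (\<lambda>\<omega>. f (Y k \<omega>))" if tf: "f \<in> trig_sums I" for f :: "('i \<Rightarrow> real) \<Rightarrow> complex" and k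
  proof -
    obtain C where C: "\<And>y. norm (f y) \<le> C" using trig_sums_bounded [OF tf] by auto
    show "integrable \<mu> f" by (rule mu.integrable_const_bound [of _ C]) (auto simp: C tm tf)
    show "integrable M (\<lambda>\<omega>. f (Y k \<omega>))" by (rule M.integrable_const_bound [of _ C]) (auto simp: C tmY tf)
  qed
  have tconv: "(\<lambda>k. \<integral>\<omega>. f (Y k \<omega>) \<partial>M) \<longlonglongrightarrow> (\<integral>y. f y \<partial>\<mu>)" if "f \<in> trig_sums I" for f
    using that
  proof induction
    case (exp c \<xi>)
    have "(\<Sum>i\<in>I. \<xi> i * Y k \<omega> i) = (\<Sum>i\<in>I. \<xi> i * X k i \<omega>)" for k \<omega>
      by (rule sum.cong) (auto simp: Y_def)
    then show ?case using tendsto_mult_left [OF cf [of \<xi>], of c] by simp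
  next
    case (add f f')
    then show ?case using tendsto_add [OF add.IH] by (simp add: ti)
  qed
  have "\<exists>q. (\<lambda>y. complex_of_real (q y)) \<in> trig_sums I \<and> (\<forall>y. \<bar>q y\<bar> \<le> B + 1 / real (Suc n)) \<and>
      (\<forall>y\<in>I \<rightarrow>\<^sub>E {- real (Suc n)..real (Suc n)}. \<bar>q y - g y\<bar> \<le> 1 / real (Suc n))" for n
    by (rule trig_approximation [OF I g(1) B, of "real (Suc n)" "1 / real (Suc n)"]) auto
  then obtain q where qt: "\<And>n. (\<lambda>y. complex_of_real (q n y)) \<in> trig_sums I"
    and qb: "\<And>n y. \<bar>q n y\<bar> \<le> B + 1 / real (Suc n)"
    and qa: "\<And>n y. y \<in> I \<rightarrow>\<^sub>E {- real (Suc n)..real (Suc n)} \<Longrightarrow> \<bar>q n y - g y\<bar> \<le> 1 / real (Suc n)"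
    by metis
  have qb1: "\<bar>q n y\<bar> \<le> B + 1" for n y
    using qb [of n y] by (rule order_trans) simp
  have qm: "q n \<in> borel_measurable \<mu>" for n
    using measurable_compose [OF tm [OF qt [of n]] borel_measurable_Re] by simp
  have qmY: "(\<lambda>\<omega>. q n (Y k \<omega>)) \<in> borel_measurable M" for n k
    using measurable_compose [OF tmY [OF qt [of n]] borel_measurable_Re] by simp
  have qiY: "integrable M (\<lambda>\<omega>. q n (Y k \<omega>))" for n k
    by (rule M.integrable_const_bound [of _ "B + 1"]) (auto simp: qb1 qmY)
  have lim: "(\<lambda>n. q n y) \<longlonglongrightarrow> g y" if y: "y \<in> I \<rightarrow>\<^sub>E UNIV" for y
  proof (rule LIMSEQ_I [OF ], goal_cases)
    case (1 r)
    obtain m :: nat where m: "(\<Sum>i\<in>I. \<bar>y i\<bar>) \<le> real m" using real_arch_simple by blast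
    obtain m' :: nat where m': "1 / real (Suc m') < r" using 1 nat_approx_posE by blast
    show ?case
    proof (intro exI [of _ "max m m'"] allI impI)
      fix n assume n: "max m m' \<le> n"
      have "- real (Suc n) \<le> y i \<and> y i \<le> real (Suc n)" if "i \<in> I" for i
      proof -
        have "\<bar>y i\<bar> \<le> (\<Sum>i\<in>I. \<bar>y i\<bar>)" using I that by (intro member_le_sum) auto
        also have "\<dots> \<le> real (Suc n)" using m n by auto
        finally show ?thesis unfolding abs_le_iff by linarith
      qed
      then have "y \<in> I \<rightarrow>\<^sub>E {- real (Suc n)..real (Suc n)}" using y by (simp add: PiE_iff)
      then have "\<bar>q n y - g y\<bar> \<le> 1 / real (Suc n)" by (rule qa)
      also have "\<dots> \<le> 1 / real (Suc m')" using n by (simp add: frac_le)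
      finally show "norm (q n y - g y) < r" using m' by simp
    qed
  qed
  have gm: "g \<in> borel_measurable \<mu>"
    by (rule borel_measurable_LIMSEQ_real [where u = q, OF _ qm]) (simp add: lim spmu)
  have gmY: "(\<lambda>\<omega>. g (Y k \<omega>)) \<in> borel_measurable M" for k
    by (rule borel_measurable_LIMSEQ_real [where u = "\<lambda>n \<omega>. q n (Y k \<omega>)", OF _ qmY]) (simp add: lim YE)
  have giY: "integrable M (\<lambda>\<omega>. g (Y k \<omega>))" for k
    by (rule M.integrable_const_bound [of _ B]) (auto simp: B YE gmY)
  have qmu: "(\<lambda>n. \<integral>y. q n y \<partial>\<mu>) \<longlonglongrightarrow> (\<integral>y. g y \<partial>\<mu>)"
    by (rule integral_dominated_convergence [where w = "\<lambda>_. B + 1"]) (auto simp: gm qm lim spmu qb1)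
  have qconv: "(\<lambda>k. \<integral>\<omega>. q n (Y k \<omega>) \<partial>M) \<longlonglongrightarrow> (\<integral>y. q n y \<partial>\<mu>)" for n
    using tendsto_Re [OF tconv [OF qt [of n]]] by simp
  \<comment> \<open>the first term is the error on the box, the second one bounds the part outside by Chebyshev\<close>
  define t where "t n = 1 / real (Suc n) + (2 * B + 1) * (real (card I) * K / (real (Suc n))\<^sup>2)" for n
  have t0: "t \<longlonglongrightarrow> 0"
  proof -
    have "(\<lambda>n. 1 / real (Suc n) + (2 * B + 1) * (real (card I) * K * (1 / real (Suc n) * (1 / real (Suc n))))) \<longlonglongrightarrow> 0 + (2 * B + 1) * (real (card I) * K * (0 * 0))"
      by (intro tendsto_intros LIMSEQ_Suc [OF lim_1_over_n])
    then show ?thesis by (simp add: t_def [abs_def] power2_eq_square)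
  qed
  have close: "\<bar>(\<integral>\<omega>. g (Y k \<omega>) \<partial>M) - (\<integral>\<omega>. q n (Y k \<omega>) \<partial>M)\<bar> \<le> t n" for k n
  proof -
    let ?n = "real (Suc n)"
    let ?b = "\<lambda>\<omega>. 1 / ?n + (2 * B + 1) * ((\<Sum>i\<in>I. (X k i \<omega>)\<^sup>2) / ?n\<^sup>2)"
    have bi: "integrable M ?b" using sq(1) by auto
    have le: "\<bar>g (Y k \<omega>) - q n (Y k \<omega>)\<bar> \<le> ?b \<omega>" for \<omega>
    proof (cases "\<forall>i\<in>I. \<bar>X k i \<omega>\<bar> \<le> ?n")
      case True
      then have "Y k \<omega> \<in> I \<rightarrow>\<^sub>E {- ?n..?n}" by (auto simp: Y_def abs_le_iff)
      then have "\<bar>g (Y k \<omega>) - q n (Y k \<omega>)\<bar> \<le> 1 / ?n" using qa [of "Y k \<omega>" n] by (simp add: abs_minus_commute)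
      moreover have "0 \<le> (2 * B + 1) * ((\<Sum>i\<in>I. (X k i \<omega>)\<^sup>2) / ?n\<^sup>2)" using B0 by (intro mult_nonneg_nonneg divide_nonneg_nonneg sum_nonneg) auto
      ultimately show ?thesis by linarith
    next
      case False
      then obtain i where i: "i \<in> I" "?n < \<bar>X k i \<omega>\<bar>" by auto
      then have "?n\<^sup>2 \<le> (X k i \<omega>)\<^sup>2" by (simp add: abs_le_square_iff [symmetric])
      also have "\<dots> \<le> (\<Sum>i\<in>I. (X k i \<omega>)\<^sup>2)" using I i by (intro member_le_sum) auto
      finally have "1 \<le> (\<Sum>i\<in>I. (X k i \<omega>)\<^sup>2) / ?n\<^sup>2" by simp
      then have "(2 * B + 1) * 1 \<le> (2 * B + 1) * ((\<Sum>i\<in>I. (X k i \<omega>)\<^sup>2) / ?n\<^sup>2)" using B0 by (intro mult_left_mono) auto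
      moreover have "\<bar>g (Y k \<omega>) - q n (Y k \<omega>)\<bar> \<le> (2 * B + 1) * 1" using abs_triangle_ineq4 [of "g (Y k \<omega>)" "q n (Y k \<omega>)"] B [OF YE, of k \<omega>] qb1 [of n "Y k \<omega>"] by simp
      ultimately have "\<bar>g (Y k \<omega>) - q n (Y k \<omega>)\<bar> \<le> (2 * B + 1) * ((\<Sum>i\<in>I. (X k i \<omega>)\<^sup>2) / ?n\<^sup>2)"
        by (rule order_trans [rotated])
      also have "\<dots> \<le> ?b \<omega>" by simp
      finally show ?thesis .
    qed
    have "\<bar>(\<integral>\<omega>. g (Y k \<omega>) \<partial>M) - (\<integral>\<omega>. q n (Y k \<omega>) \<partial>M)\<bar> = \<bar>\<integral>\<omega>. g (Y k \<omega>) - q n (Y k \<omega>) \<partial>M\<bar>"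
      by (simp add: giY qiY)
    also have "\<dots> \<le> (\<integral>\<omega>. \<bar>g (Y k \<omega>) - q n (Y k \<omega>)\<bar> \<partial>M)" by (rule integral_abs_bound)
    also have "\<dots> \<le> (\<integral>\<omega>. ?b \<omega> \<partial>M)" using giY qiY bi le by (intro integral_mono) auto
    also have "\<dots> = 1 / ?n + (2 * B + 1) * ((\<Sum>i\<in>I. \<integral>\<omega>. (X k i \<omega>)\<^sup>2 \<partial>M) / ?n\<^sup>2)"
      using sq(1) by (simp add: M.prob_space)
    also have "\<dots> \<le> t n"
    proof -
      have "(\<Sum>i\<in>I. \<integral>\<omega>. (X k i \<omega>)\<^sup>2 \<partial>M) \<le> (\<Sum>i\<in>I. K)" by (rule sum_mono) (rule sq(2))
      then have "(\<Sum>i\<in>I. \<integral>\<omega>. (X k i \<omega>)\<^sup>2 \<partial>M) / ?n\<^sup>2 \<le> real (card I) * K / ?n\<^sup>2" by (intro divide_right_mono) auto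
      then show ?thesis unfolding t_def using B0 by (intro add_left_mono mult_left_mono) auto
    qed
    finally show ?thesis .
  qed
  have "(\<lambda>k. \<integral>\<omega>. g (Y k \<omega>) \<partial>M) \<longlonglongrightarrow> (\<integral>y. g y \<partial>\<mu>)"
  proof (rule LIMSEQ_I)
    fix r :: real assume r: "0 < r"
    have "eventually (\<lambda>n. t n < r / 3) sequentially" using order_tendstoD(2) [OF t0, of "r / 3"] r by simp
    moreover have "eventually (\<lambda>n. dist (\<integral>y. q n y \<partial>\<mu>) (\<integral>y. g y \<partial>\<mu>) < r / 3) sequentially"
      using tendstoD [OF qmu, of "r / 3"] r by simp
    ultimately have "eventually (\<lambda>n. t n < r / 3 \<and> dist (\<integral>y. q n y \<partial>\<mu>) (\<integral>y. g y \<partial>\<mu>) < r / 3) sequentially"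
      by (rule eventually_conj)
    then obtain n where n: "t n < r / 3" "dist (\<integral>y. q n y \<partial>\<mu>) (\<integral>y. g y \<partial>\<mu>) < r / 3"
      using eventually_happens' [OF sequentially_bot] by blast
    have "eventually (\<lambda>k. dist (\<integral>\<omega>. q n (Y k \<omega>) \<partial>M) (\<integral>y. q n y \<partial>\<mu>) < r / 3) sequentially"
      using tendstoD [OF qconv [of n], of "r / 3"] r by simp
    then obtain k0 where k0: "\<And>k. k \<ge> k0 \<Longrightarrow> dist (\<integral>\<omega>. q n (Y k \<omega>) \<partial>M) (\<integral>y. q n y \<partial>\<mu>) < r / 3"
      by (auto simp: eventually_sequentially)
    show "\<exists>k0. \<forall>k\<ge>k0. norm ((\<integral>\<omega>. g (Y k \<omega>) \<partial>M) - (\<integral>y. g y \<partial>\<mu>)) < r"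
    proof (intro exI [of _ k0] allI impI)
      fix k assume "k \<ge> k0"
      from k0 [OF this] close [of k n] n
      show "norm ((\<integral>\<omega>. g (Y k \<omega>) \<partial>M) - (\<integral>y. g y \<partial>\<mu>)) < r"
        unfolding dist_real_def real_norm_def by linarith
    qed
  qed
  then show ?thesis by (simp add: Y_def)
qed

section \<open>The renormalized field\<close>

lemma renorm_spin: "renorm k \<alpha> spin \<tau> \<omega> = real k powr (- \<alpha> / 2) * (\<Sum>t\<in>block k \<tau>. \<omega> t)"
  by (simp add: renorm_def block_def spin_def)

lemma renorm_zero: "renorm 0 \<alpha> X \<tau> \<omega> = 0"
  by (simp add: renorm_def)

lemma local_renorm: "local_on (block k \<tau>) (renorm k \<alpha> spin \<tau>)"
  by (auto simp: local_on_def renorm_spin intro!: sum.cong)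

lemma measurable_renorm:
  assumes lam: "\<bar>lam\<bar> \<le> rad0 TYPE('n::finite)"
  shows "renorm k \<alpha> spin (\<tau> :: int ^ 'n) \<in> borel_measurable (limit_measure lam)"
proof (cases "0 < k")
  case True
  then show ?thesis by (intro limit_measure_local(1) [OF lam finite_block local_renorm])
next
  case False
  then have "renorm k \<alpha> spin \<tau> = (\<lambda>_. 0)" using renorm_zero by (intro ext) simp
  then show ?thesis by simp
qed

lemma renorm_second_moment:
  assumes lam: "\<bar>lam\<bar> \<le> rad0 TYPE('n::finite)"
  shows "integrable (limit_measure lam) (\<lambda>\<omega>. renorm k \<alpha> spin \<tau> \<omega> * renorm k \<alpha> spin (\<tau>' :: int ^ 'n) \<omega>)"
    and "(\<integral>\<omega>. renorm k \<alpha> spin \<tau> \<omega> * renorm k \<alpha> spin (\<tau>' :: int ^ 'n) \<omega> \<partial>limit_measure lam)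
      = real k powr (- \<alpha>) * (\<Sum>s\<in>block k \<tau>. \<Sum>t\<in>block k \<tau>'. pair_corr lam (t - s))"
proof -
  have e: "renorm k \<alpha> spin \<tau> \<omega> * renorm k \<alpha> spin \<tau>' \<omega> = real k powr (- \<alpha>) * (\<Sum>s\<in>block k \<tau>. \<Sum>t\<in>block k \<tau>'. \<omega> s * \<omega> t)" for \<omega>
  proof -
    have "real k powr (- \<alpha> / 2) * real k powr (- \<alpha> / 2) = real k powr (- \<alpha>)"
      by (simp add: powr_add [symmetric])
    then show ?thesis unfolding renorm_spin sum_product [symmetric] by (simp add: mult_ac)
  qed
  show "integrable (limit_measure lam) (\<lambda>\<omega>. renorm k \<alpha> spin \<tau> \<omega> * renorm k \<alpha> spin \<tau>' \<omega>)"
    unfolding e by (intro integrable_mult_right Bochner_Integration.integrable_sum spin_product_moment lam)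
  show "(\<integral>\<omega>. renorm k \<alpha> spin \<tau> \<omega> * renorm k \<alpha> spin (\<tau>' :: int ^ 'n) \<omega> \<partial>limit_measure lam)
      = real k powr (- \<alpha>) * (\<Sum>s\<in>block k \<tau>. \<Sum>t\<in>block k \<tau>'. pair_corr lam (t - s))"
    unfolding e using lam by (simp add: spin_product_moment)
qed

lemma renorm_covariance_tendsto:
  assumes lam: "\<bar>lam\<bar> \<le> rad0 TYPE('n::finite)"
  shows "(\<lambda>k. \<integral>\<omega>. renorm k (real CARD('n)) spin \<tau> \<omega> * renorm k (real CARD('n)) spin (\<tau>' :: int ^ 'n) \<omega> \<partial>limit_measure lam)
    \<longlonglongrightarrow> (if \<tau> = \<tau>' then limit_variance TYPE('n) lam else 0)"
proof (rule Lim_transform_eventually [OF block_covariance [OF lam]])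
  show "eventually (\<lambda>k. (\<Sum>s\<in>block k \<tau>. \<Sum>t\<in>block k \<tau>'. pair_corr lam (t - s)) / real k ^ CARD('n)
     = (\<integral>\<omega>. renorm k (real CARD('n)) spin \<tau> \<omega> * renorm k (real CARD('n)) spin \<tau>' \<omega> \<partial>limit_measure lam)) sequentially"
    using eventually_gt_at_top [of 0]
    by eventually_elim (simp add: renorm_second_moment(2) [OF lam] powr_minus powr_realpow divide_inverse mult.commute)
qed

text \<open>The second moment is \<open>k powr (\<nu> - \<alpha>)\<close> times a convergent sequence.\<close>

lemma renorm_mean_square:
  assumes lam: "\<bar>lam\<bar> \<le> rad0 TYPE('n::finite)" and \<alpha>: "real CARD('n) < \<alpha>"
  shows "tendsto_mean_square (limit_measure lam) (\<lambda>k. renorm k \<alpha> spin (\<tau> :: int ^ 'n)) (\<lambda>_. 0)"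
  unfolding tendsto_mean_square_def
proof (intro conjI allI)
  show "renorm k \<alpha> spin \<tau> \<in> borel_measurable (limit_measure lam)" for k by (rule measurable_renorm [OF lam])
  show "(\<lambda>_. 0) \<in> borel_measurable (limit_measure lam)" by simp
  show "integrable (limit_measure lam) (\<lambda>\<omega>. (renorm k \<alpha> spin \<tau> \<omega> - 0)\<^sup>2)" for k
    using renorm_second_moment(1) [OF lam, of k \<alpha> \<tau> \<tau>] by (simp add: power2_eq_square)
  have "(\<lambda>k. real k powr (real CARD('n) - \<alpha>)) \<longlonglongrightarrow> 0"
    by (rule tendsto_neg_powr [OF _ filterlim_real_sequentially]) (use \<alpha> in simp)
  then have "(\<lambda>k. real k powr (real CARD('n) - \<alpha>) * ((\<Sum>s\<in>block k \<tau>. \<Sum>t\<in>block k \<tau>. pair_corr lam (t - s)) / real k ^ CARD('n)))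
      \<longlonglongrightarrow> 0 * (if \<tau> = \<tau> then limit_variance TYPE('n) lam else 0)"
    by (intro tendsto_mult block_covariance lam)
  moreover have "eventually (\<lambda>k. real k powr (real CARD('n) - \<alpha>) * ((\<Sum>s\<in>block k \<tau>. \<Sum>t\<in>block k \<tau>. pair_corr lam (t - s)) / real k ^ CARD('n))
      = (\<integral>\<omega>. (renorm k \<alpha> spin \<tau> \<omega> - 0)\<^sup>2 \<partial>limit_measure lam)) sequentially"
    using eventually_gt_at_top [of 0]
  proof eventually_elim
    case (elim k)
    have "real k powr (real CARD('n) - \<alpha>) = real k ^ CARD('n) * real k powr (- \<alpha>)"
      using elim by (simp add: powr_diff powr_minus powr_realpow divide_inverse)
    then show ?case
      using elim renorm_second_moment(2) [OF lam, of k \<alpha> \<tau> \<tau>] by (simp add: power2_eq_square)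
  qed
  ultimately show "(\<lambda>k. \<integral>\<omega>. (renorm k \<alpha> spin \<tau> \<omega> - 0)\<^sup>2 \<partial>limit_measure lam) \<longlonglongrightarrow> 0"
    by (simp add: Lim_transform_eventually)
qed

text \<open>Apply \<open>limit_characteristic_function\<close> with \<open>\<theta> = k powr (- \<nu> / 2)\<close>. The number of sites is at most
  \<open>card S * k ^ \<nu>\<close>, so the error is of order \<open>\<theta>\<close>, while the variance converges by \<open>renorm_covariance_tendsto\<close>.\<close>

lemma renorm_characteristic_function:
  fixes \<xi> :: "int ^ 'n::finite \<Rightarrow> real"
  assumes lam: "\<bar>lam\<bar> \<le> rad0 TYPE('n)" and S: "finite S"
  shows "(\<lambda>k. \<integral>\<omega>. iexp (\<Sum>\<tau>\<in>S. \<xi> \<tau> * renorm k (real CARD('n)) spin \<tau> \<omega>) \<partial>limit_measure lam)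
    \<longlonglongrightarrow> exp (of_real (- (limit_variance TYPE('n) lam * (\<Sum>\<tau>\<in>S. (\<xi> \<tau>)\<^sup>2) / 2)))"
proof -
  let ?\<nu> = "real CARD('n)"
  let ?P = "limit_measure lam :: 'n config measure"
  let ?Y = "\<lambda>k \<tau> \<omega>. renorm k ?\<nu> spin \<tau> \<omega>"
  \<comment> \<open>a bound for the coefficients; the summand 1 keeps it positive\<close>
  define H where "H = 1 + (\<Sum>\<tau>\<in>S. \<bar>\<xi> \<tau>\<bar>)"
  define R where "R = rad0 TYPE('n) / H"
  define T where "T k = (\<Union>\<tau>\<in>S. block k \<tau>)" for k
  \<comment> \<open>coefficients of the spins in the linear combination of the block variables\<close>
  define \<eta> where "\<eta> k t = (if block_map k t \<in> S then \<xi> (block_map k t) else 0)" for k t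
  define \<theta> where "\<theta> k = real k powr (- ?\<nu> / 2)" for k
  define v where "v k = (\<integral>\<omega>. (\<Sum>\<tau>\<in>S. \<xi> \<tau> * ?Y k \<tau> \<omega>)\<^sup>2 \<partial>?P)" for k
  define \<phi> where "\<phi> k = (\<integral>\<omega>. iexp (\<Sum>\<tau>\<in>S. \<xi> \<tau> * ?Y k \<tau> \<omega>) \<partial>?P)" for k
  have sum_ge: "0 \<le> (\<Sum>\<tau>\<in>S. \<bar>\<xi> \<tau>\<bar>)" by (rule sum_nonneg) simp
  then have H: "0 < H" unfolding H_def by linarith
  have R: "0 < R" using H rad0_pos [where 'n = 'n] by (simp add: R_def)
  have \<eta>H: "\<bar>\<eta> k t\<bar> \<le> H" for k t
  proof (cases "block_map k t \<in> S")
    case True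
    then have "\<bar>\<xi> (block_map k t)\<bar> \<le> (\<Sum>\<tau>\<in>S. \<bar>\<xi> \<tau>\<bar>)" using S by (intro member_le_sum) auto
    then show ?thesis using True by (simp add: \<eta>_def H_def)
  qed (use H in \<open>simp add: \<eta>_def\<close>)
  have lin: "(\<Sum>\<tau>\<in>S. \<xi> \<tau> * ?Y k \<tau> \<omega>) = \<theta> k * (\<Sum>t\<in>T k. \<eta> k t * \<omega> t)" if k: "0 < k" for k \<omega>
  proof -
    have "(\<Sum>t\<in>T k. \<eta> k t * \<omega> t) = (\<Sum>\<tau>\<in>S. \<Sum>t\<in>block k \<tau>. \<eta> k t * \<omega> t)"
      unfolding T_def by (rule sum.UNION_disjoint) (use S finite_block [OF k] in \<open>auto simp: block_def\<close>)
    also have "\<dots> = (\<Sum>\<tau>\<in>S. \<xi> \<tau> * (\<Sum>t\<in>block k \<tau>. \<omega> t))"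
      by (rule sum.cong) (auto simp: sum_distrib_left \<eta>_def block_def intro!: sum.cong)
    finally have eq: "(\<Sum>t\<in>T k. \<eta> k t * \<omega> t) = (\<Sum>\<tau>\<in>S. \<xi> \<tau> * (\<Sum>t\<in>block k \<tau>. \<omega> t))" .
    show ?thesis unfolding renorm_spin \<theta>_def eq by (subst sum_distrib_left [of _ _ S]) (simp only: mult.left_commute)
  qed
  have cardT: "real (card (T k)) \<le> real (card S) * real k ^ CARD('n)" if k: "0 < k" for k
  proof -
    have "card (T k) \<le> (\<Sum>\<tau>\<in>S. card (block k \<tau>))" unfolding T_def by (rule card_UN_le [OF S])
    also have "\<dots> = card S * k ^ CARD('n)" by (simp add: card_block [OF k])
    finally show ?thesis by (metis of_nat_le_iff of_nat_mult of_nat_power)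
  qed
  have \<theta>0: "\<theta> \<longlonglongrightarrow> 0"
    unfolding \<theta>_def [abs_def] by (rule tendsto_neg_powr [OF _ filterlim_real_sequentially]) simp
  have \<theta>n: "0 \<le> \<theta> k" for k by (simp add: \<theta>_def)
  let ?c = "H * real (card S) / R\<^sup>2"
  have err: "H * real (card (T k)) * \<theta> k ^ 3 / R\<^sup>2 \<le> ?c * \<theta> k" if k: "0 < k" for k
  proof -
    have "(\<theta> k)\<^sup>2 = real k powr (- ?\<nu>)"
      unfolding \<theta>_def power2_eq_square by (simp only: powr_add [symmetric]) simp
    then have "real k ^ CARD('n) * (\<theta> k)\<^sup>2 = 1"
      using k by (simp add: powr_minus powr_realpow)
    then have e: "real k ^ CARD('n) * \<theta> k ^ 3 = \<theta> k" by (simp add: power3_eq_cube power2_eq_square mult.assoc [symmetric])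
    have "H * real (card (T k)) * \<theta> k ^ 3 \<le> H * (real (card S) * real k ^ CARD('n)) * \<theta> k ^ 3"
      using H \<theta>n cardT [OF k] by (intro mult_right_mono mult_left_mono) auto
    also have "\<dots> = H * real (card S) * \<theta> k" using e by (simp add: mult.assoc)
    finally have "H * real (card (T k)) * \<theta> k ^ 3 / R\<^sup>2 \<le> H * real (card S) * \<theta> k / R\<^sup>2" by (rule divide_right_mono) simp
    then show ?thesis by simp
  qed
  have c\<theta>: "(\<lambda>k. C * (?c * \<theta> k)) \<longlonglongrightarrow> 0" for C
    by (rule tendsto_mult_right_zero [OF tendsto_mult_right_zero [OF \<theta>0]])
  have "(\<lambda>k. \<phi> k * exp (of_real (v k / 2)) - 1) \<longlonglongrightarrow> 0"
  proof (rule Lim_null_comparison [OF _ c\<theta> [of 24]])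
    have "eventually (\<lambda>k. 16 * (?c * \<theta> k) < 1 / 2) sequentially" using order_tendstoD(2) [OF c\<theta> [of 16], of "1 / 2"] by simp
    moreover have "eventually (\<lambda>k. \<theta> k < R / 2) sequentially" using order_tendstoD(2) [OF \<theta>0, of "R / 2"] R by simp
    ultimately show "eventually (\<lambda>k. norm (\<phi> k * exp (of_real (v k / 2)) - 1) \<le> 24 * (?c * \<theta> k)) sequentially"
      using eventually_gt_at_top [of 0]
    proof eventually_elim
      case (elim k)
      have fT: "finite (T k)" unfolding T_def using S finite_block [OF elim(3)] by auto
      have "16 * (H * real (card (T k))) * \<theta> k ^ 3 / R\<^sup>2 \<le> 1 / 2" using err [OF elim(3)] elim(1) by simp
      then have "norm ((\<integral>\<omega>. iexp (\<theta> k * (\<Sum>t\<in>T k. \<eta> k t * \<omega> t)) \<partial>?P) * exp (of_real ((\<theta> k)\<^sup>2 * (\<integral>\<omega>. (\<Sum>t\<in>T k. \<eta> k t * \<omega> t)\<^sup>2 \<partial>?P) / 2)) - 1)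
        \<le> 24 * (H * real (card (T k))) * \<theta> k ^ 3 / R\<^sup>2"
        using elim(2) \<theta>n unfolding R_def
        by (intro limit_characteristic_function [OF lam fT H \<eta>H]) auto
      also have "\<dots> \<le> 24 * (?c * \<theta> k)" using err [OF elim(3)] by simp
      finally show ?case
        unfolding \<phi>_def v_def lin [OF elim(3)] by (simp add: power_mult_distrib)
    qed
  qed
  then have p1: "(\<lambda>k. \<phi> k * exp (of_real (v k / 2))) \<longlonglongrightarrow> 1" by (rule LIM_zero_cancel)
  have vk: "v k = (\<Sum>\<tau>\<in>S. \<Sum>\<tau>'\<in>S. \<xi> \<tau> * \<xi> \<tau>' * (\<integral>\<omega>. ?Y k \<tau> \<omega> * ?Y k \<tau>' \<omega> \<partial>?P))" for k
  proof -
    have "(\<Sum>\<tau>\<in>S. \<xi> \<tau> * ?Y k \<tau> \<omega>)\<^sup>2 = (\<Sum>\<tau>\<in>S. \<Sum>\<tau>'\<in>S. \<xi> \<tau> * \<xi> \<tau>' * (?Y k \<tau> \<omega> * ?Y k \<tau>' \<omega>))" for \<omega>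
      by (simp add: power2_eq_square sum_product mult_ac)
    then show ?thesis
      unfolding v_def by (simp add: renorm_second_moment(1) [OF lam])
  qed
  have "v \<longlonglongrightarrow> (\<Sum>\<tau>\<in>S. \<Sum>\<tau>'\<in>S. \<xi> \<tau> * \<xi> \<tau>' * (if \<tau> = \<tau>' then limit_variance TYPE('n) lam else 0))"
    unfolding vk [abs_def] by (intro tendsto_sum tendsto_mult_left renorm_covariance_tendsto lam)
  also have "(\<Sum>\<tau>\<in>S. \<Sum>\<tau>'\<in>S. \<xi> \<tau> * \<xi> \<tau>' * (if \<tau> = \<tau>' then limit_variance TYPE('n) lam else 0)) = limit_variance TYPE('n) lam * (\<Sum>\<tau>\<in>S. (\<xi> \<tau>)\<^sup>2)"
  proof -
    have "(\<Sum>\<tau>'\<in>S. \<xi> \<tau> * \<xi> \<tau>' * (if \<tau> = \<tau>' then limit_variance TYPE('n) lam else 0)) = limit_variance TYPE('n) lam * (\<xi> \<tau>)\<^sup>2" if "\<tau> \<in> S" for \<tau>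
    proof -
      have "(\<Sum>\<tau>'\<in>S. \<xi> \<tau> * \<xi> \<tau>' * (if \<tau> = \<tau>' then limit_variance TYPE('n) lam else 0)) = (\<Sum>\<tau>'\<in>S. if \<tau> = \<tau>' then \<xi> \<tau> * \<xi> \<tau>' * limit_variance TYPE('n) lam else 0)"
        by (rule sum.cong) auto
      also have "\<dots> = limit_variance TYPE('n) lam * (\<xi> \<tau>)\<^sup>2" using S that by (simp add: power2_eq_square)
      finally show ?thesis .
    qed
    then show ?thesis by (simp add: sum_distrib_left)
  qed
  finally have vl: "v \<longlonglongrightarrow> limit_variance TYPE('n) lam * (\<Sum>\<tau>\<in>S. (\<xi> \<tau>)\<^sup>2)" .
  have "(\<lambda>k. (\<phi> k * exp (of_real (v k / 2))) * exp (of_real (- (v k / 2))))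
     \<longlonglongrightarrow> 1 * exp (of_real (- (limit_variance TYPE('n) lam * (\<Sum>\<tau>\<in>S. (\<xi> \<tau>)\<^sup>2) / 2)))"
    by (intro tendsto_mult p1 tendsto_exp tendsto_of_real tendsto_minus tendsto_divide vl tendsto_const) simp
  moreover have "(\<phi> k * exp (of_real (v k / 2))) * exp (of_real (- (v k / 2))) = \<phi> k" for k
    by (simp add: mult.assoc mult_exp_exp)
  ultimately show ?thesis unfolding \<phi>_def [symmetric] by (simp only: mult_1)
qed

text \<open>Substituting \<open>\<sigma> * x\<close> reduces this to the standard normal distribution.\<close>

lemma normal_characteristic_function:
  assumes \<sigma>: "0 < \<sigma>"
  shows "(\<integral>x. iexp (\<xi> * x) \<partial>density lborel (\<lambda>x. ennreal (normal_density 0 \<sigma> x))) = exp (of_real (- (\<sigma>\<^sup>2 * \<xi>\<^sup>2 / 2)))"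
proof -
  have "(\<integral>x. iexp (\<xi> * x) \<partial>density lborel (\<lambda>x. ennreal (normal_density 0 \<sigma> x))) = (\<integral>x. normal_density 0 \<sigma> x *\<^sub>R iexp (\<xi> * x) \<partial>lborel)"
    by (rule integral_density) auto
  also have "\<dots> = \<bar>\<sigma>\<bar> *\<^sub>R (\<integral>x. normal_density 0 \<sigma> (0 + \<sigma> * x) *\<^sub>R iexp (\<xi> * (0 + \<sigma> * x)) \<partial>lborel)"
    by (rule lborel_integral_real_affine) (use \<sigma> in simp)
  also have "\<dots> = (\<integral>x. \<sigma> *\<^sub>R (normal_density 0 \<sigma> (\<sigma> * x) *\<^sub>R iexp (\<xi> * (\<sigma> * x))) \<partial>lborel)"
    by (simp only: integral_scaleR_right abs_of_pos [OF \<sigma>] add_0)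
  also have "\<dots> = (\<integral>x. std_normal_density x *\<^sub>R iexp ((\<xi> * \<sigma>) * x) \<partial>lborel)"
  proof (rule Bochner_Integration.integral_cong [OF refl])
    fix x
    have "\<sigma> * normal_density 0 \<sigma> (\<sigma> * x) = std_normal_density x"
      using \<sigma> by (simp add: normal_density_def real_sqrt_mult power_mult_distrib)
    then show "\<sigma> *\<^sub>R (normal_density 0 \<sigma> (\<sigma> * x) *\<^sub>R iexp (\<xi> * (\<sigma> * x))) = std_normal_density x *\<^sub>R iexp ((\<xi> * \<sigma>) * x)"
      by (simp add: mult.assoc)
  qed
  also have "\<dots> = (\<integral>x. iexp ((\<xi> * \<sigma>) * x) \<partial>std_normal_distribution)"
    by (rule integral_density [symmetric]) auto
  also have "\<dots> = char std_normal_distribution (\<xi> * \<sigma>)" by (simp add: char_def)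
  also have "\<dots> = exp (of_real (- (\<sigma>\<^sup>2 * \<xi>\<^sup>2 / 2)))"
    by (simp add: char_std_normal_distribution power_mult_distrib mult.commute flip: exp_of_real)
  finally show ?thesis .
qed

lemma indep_normal_characteristic_function:
  assumes V: "0 < V" and S: "finite S"
  shows "prob_space (indep_normal S V)" "sets (indep_normal S V) = sets (PiM S (\<lambda>_. borel))"
    and "(\<integral>y. iexp (\<Sum>i\<in>S. \<xi> i * y i) \<partial>indep_normal S V) = exp (of_real (- (V * (\<Sum>i\<in>S. (\<xi> i)\<^sup>2) / 2)))"
proof -
  let ?N = "density lborel (\<lambda>x. ennreal (normal_density 0 (sqrt V) x))"
  have pN: "prob_space ?N" using V by (intro prob_space_normal_density) simp
  interpret N: prob_space ?N by fact
  interpret product_prob_space "\<lambda>_. ?N" S by unfold_locales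
  show "prob_space (indep_normal S V)" unfolding indep_normal_def by (rule prob_space_PiM) (rule pN)
  show "sets (indep_normal S V) = sets (PiM S (\<lambda>_. borel))"
    unfolding indep_normal_def by (rule sets_PiM_cong) auto
  have "(\<integral>y. iexp (\<Sum>i\<in>S. \<xi> i * y i) \<partial>indep_normal S V) = (\<integral>y. (\<Prod>i\<in>S. iexp (\<xi> i * y i)) \<partial>PiM S (\<lambda>_. ?N))"
    using S by (simp add: indep_normal_def exp_sum sum_distrib_left)
  also have "\<dots> = (\<Prod>i\<in>S. \<integral>x. iexp (\<xi> i * x) \<partial>?N)"
  proof (rule product_integral_prod [OF S])
    fix i
    show "integrable ?N (\<lambda>x. iexp (\<xi> i * x))"
      by (rule N.integrable_const_bound [of _ 1]) auto
  qed
  also have "\<dots> = (\<Prod>i\<in>S. exp (of_real (- (V * (\<xi> i)\<^sup>2 / 2))))"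
    using V by (intro prod.cong refl) (subst normal_characteristic_function, auto)
  also have "\<dots> = exp (of_real (- (V * (\<Sum>i\<in>S. (\<xi> i)\<^sup>2) / 2)))"
    using S by (simp add: exp_sum [symmetric] sum_negf sum_divide_distrib sum_distrib_left)
  finally show "(\<integral>y. iexp (\<Sum>i\<in>S. \<xi> i * y i) \<partial>indep_normal S V) = exp (of_real (- (V * (\<Sum>i\<in>S. (\<xi> i)\<^sup>2) / 2)))" .
qed

lemma renorm_tendsto_distr:
  fixes S :: "(int ^ 'n::finite) set"
  assumes lam: "\<bar>lam\<bar> \<le> rad0 TYPE('n)" and S: "finite S"
  shows "tendsto_distr (limit_measure lam) S (\<lambda>k. renorm k (real CARD('n)) spin) (indep_normal S (limit_variance TYPE('n) lam))"
  unfolding tendsto_distr_def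
proof (intro conjI allI ballI impI)
  let ?Y = "\<lambda>k \<tau> \<omega>. renorm k (real CARD('n)) spin \<tau> \<omega>"
  let ?P = "limit_measure lam :: 'n config measure"
  show m: "renorm k (real CARD('n)) spin \<tau> \<in> borel_measurable ?P" for k \<tau> by (rule measurable_renorm [OF lam])
  note V = limit_variance_pos [OF lam]
  note N = indep_normal_characteristic_function [OF V S]
  have "\<exists>K. \<forall>k. (\<integral>\<omega>. (?Y k \<tau> \<omega>)\<^sup>2 \<partial>?P) \<le> K" for \<tau> :: "int ^ 'n"
  proof -
    have "Bseq (\<lambda>k. \<integral>\<omega>. ?Y k \<tau> \<omega> * ?Y k \<tau> \<omega> \<partial>?P)"
      by (rule convergent_imp_Bseq, rule convergentI, rule renorm_covariance_tendsto [OF lam])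
    then obtain K where "\<And>k. norm (\<integral>\<omega>. ?Y k \<tau> \<omega> * ?Y k \<tau> \<omega> \<partial>?P) \<le> K" by (auto simp: Bseq_def)
    then have "(\<integral>\<omega>. (?Y k \<tau> \<omega>)\<^sup>2 \<partial>?P) \<le> K" for k
      unfolding power2_eq_square real_norm_def by (meson abs_le_D1)
    then show ?thesis by blast
  qed
  then obtain K where K: "\<And>\<tau> k. (\<integral>\<omega>. (?Y k \<tau> \<omega>)\<^sup>2 \<partial>?P) \<le> K \<tau>" by metis
  fix g :: "(int ^ 'n \<Rightarrow> real) \<Rightarrow> real"
  assume g: "continuous_on (S \<rightarrow>\<^sub>E UNIV) g \<and> bounded (g ` (S \<rightarrow>\<^sub>E UNIV))"
  show "(\<lambda>k. \<integral>\<omega>. g (\<lambda>i\<in>S. ?Y k i \<omega>) \<partial>?P) \<longlonglongrightarrow> (\<integral>y. g y \<partial>indep_normal S (limit_variance TYPE('n) lam))"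
  proof (rule convergence_from_characteristic_functions [where X = "\<lambda>k \<tau> \<omega>. ?Y k \<tau> \<omega>" and K = "\<Sum>\<tau>\<in>S. \<bar>K \<tau>\<bar>", OF limit_measure(1) [OF lam] S])
    show "(\<lambda>\<omega>. ?Y k \<tau> \<omega>) \<in> borel_measurable ?P" for k \<tau> by (rule m)
    show "(\<lambda>k. \<integral>\<omega>. iexp (\<Sum>i\<in>S. \<xi> i * ?Y k i \<omega>) \<partial>?P) \<longlonglongrightarrow> (\<integral>y. iexp (\<Sum>i\<in>S. \<xi> i * y i) \<partial>indep_normal S (limit_variance TYPE('n) lam))" for \<xi>
      unfolding N(3) by (rule renorm_characteristic_function [OF lam S])
    show "integrable ?P (\<lambda>\<omega>. (?Y k \<tau> \<omega>)\<^sup>2)" for k \<tau>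
      using renorm_second_moment(1) [OF lam, of k _ \<tau> \<tau>] by (simp add: power2_eq_square)
    show "(\<integral>\<omega>. (?Y k \<tau> \<omega>)\<^sup>2 \<partial>?P) \<le> (\<Sum>\<tau>\<in>S. \<bar>K \<tau>\<bar>)" if "\<tau> \<in> S" for k \<tau>
    proof -
      have "\<bar>K \<tau>\<bar> \<le> (\<Sum>\<tau>\<in>S. \<bar>K \<tau>\<bar>)" using S that by (intro member_le_sum) auto
      then show ?thesis using K [of k \<tau>] by linarith
    qed
  qed (use N g in auto)
qed

lemma C_nu_pos: "0 < C_nu CARD('n::finite)"
  unfolding C_nu_def Let_def by (intro divide_pos_pos mult_pos_pos) (auto simp: zero_less_power)

text \<open>The constant is \<open>min (C_nu \<nu>) rad0\<close>, and the variance \<open>V\<close> is \<open>limit_variance\<close>.\<close>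

theorem theorem3p1:
  shows "\<exists>C>0. C \<le> C_nu CARD('n::finite) \<and>
    (\<forall>lam::real. \<bar>lam\<bar> < C \<longrightarrow>
      (\<forall>\<alpha>::real. \<alpha> > real CARD('n) \<longrightarrow>
        (\<forall>\<tau> :: int ^ 'n.
          tendsto_mean_square (limit_measure lam) (\<lambda>k. renorm k \<alpha> spin \<tau>) (\<lambda>_. 0))) \<and>
      (\<forall>\<alpha>::real. \<alpha> = real CARD('n) \<longrightarrow>
        (\<exists>V>0. (\<lambda>n. lam ^ Suc n * var_coeff TYPE('n) (Suc n)) sums (V - 1) \<and>
          (\<forall>S :: (int ^ 'n) set. finite S \<longrightarrow>
            tendsto_distr (limit_measure lam) S (\<lambda>k. renorm k \<alpha> spin) (indep_normal S V)))))"
proof (rule exI [of _ "min (C_nu CARD('n)) (rad0 TYPE('n))"], intro conjI allI impI)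
  show "0 < min (C_nu CARD('n)) (rad0 TYPE('n))" using C_nu_pos [where 'n = 'n] rad0_pos [where 'n = 'n] by simp
  show "min (C_nu CARD('n)) (rad0 TYPE('n)) \<le> C_nu CARD('n)" by simp
next
  fix lam \<alpha> :: real and \<tau> :: "int ^ 'n"
  assume "\<bar>lam\<bar> < min (C_nu CARD('n)) (rad0 TYPE('n))" and \<alpha>: "\<alpha> > real CARD('n)"
  then have lam: "\<bar>lam\<bar> \<le> rad0 TYPE('n)" by simp
  show "tendsto_mean_square (limit_measure lam) (\<lambda>k. renorm k \<alpha> spin \<tau>) (\<lambda>_. 0)"
    by (rule renorm_mean_square [OF lam \<alpha>])
next
  fix lam \<alpha> :: real
  assume "\<bar>lam\<bar> < min (C_nu CARD('n)) (rad0 TYPE('n))" and \<alpha>: "\<alpha> = real CARD('n)"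
  then have lam: "\<bar>lam\<bar> < rad0 TYPE('n)" and lam': "\<bar>lam\<bar> \<le> rad0 TYPE('n)" by auto
  show "\<exists>V>0. (\<lambda>n. lam ^ Suc n * var_coeff TYPE('n) (Suc n)) sums (V - 1) \<and>
          (\<forall>S :: (int ^ 'n) set. finite S \<longrightarrow>
            tendsto_distr (limit_measure lam) S (\<lambda>k. renorm k \<alpha> spin) (indep_normal S V))"
    using limit_variance_pos [OF lam'] limit_variance_series [OF lam] renorm_tendsto_distr [OF lam'] \<alpha>
    by (intro exI [of _ "limit_variance TYPE('n) lam"]) simp
qed

end
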